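(* Let $1\le p,q\le\infty$, let $\lambda,\gamma>0$ and $\alpha_0>\left(\frac1p-\frac1q\right)_+$, and let $$\alpha(t)=\alpha_0+\lambda t^\gamma,\qquad 0\le t\le1 .$$ Then there are constants $c,C>0$ (independent of $n$) such that for all integers $n\ge2$ $$\frac{c\,n^{-\alpha_0}}{(\ln n)^{(\alpha_0+1/q-1/p)/\gamma}}\le e_n(R^{\alpha(\cdot)}:L_p[0,1]\to L_q[0,1])\le\frac{C\,n^{-\alpha_0}}{(\ln n)^{(\alpha_0+1/q-1/p)/\gamma}} .$$
   Context: For a measurable function $\alpha:[0,1]\to[0,\infty)$ with $\alpha(t)>0$ for almost every $t$, the Riemann--Liouville operator of variable order is $$(R^{\alpha(\cdot)}f)(t):=\frac{1}{\Gamma(\alpha(t))}\int_0^t (t-s)^{\alpha(t)-1}f(s)\,ds,\qquad t\in[0,1].$$ For a bounded operator $S$ between Banach spaces $E$ and $F$ with unit balls $B_E$, $B_F$, the $n$-th (dyadic) entropy number is $$e_n(S):=\inf\Big\{\varepsilon>0:\ \exists\,y_1,\dots,y_{2^{n-1}}\in F\ \text{such that}\ S(B_E)\subseteq\bigcup_{j=1}^{2^{n-1}}(y_j+\varepsilon B_F)\Big\}.$$ Here $x_+=\max\{x,0\}$ and $1/\infty=0$. *)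

theory Defs
  imports "HOL-Analysis.Analysis" "HOL-Probability.Essential_Supremum"
begin

text \<open>
  Exponents range over \<open>ennreal\<close>, with \<open>\<infinity>\<close> admitted. The reciprocal is taken in \<open>ennreal\<close>,
  where \<open>inverse \<infinity> = 0\<close>.
\<close>

definition recip :: "ennreal \<Rightarrow> real" where
  "recip p = enn2real (inverse p)"

text \<open>
  Elements of \<open>L_p\<close> are represented by real-valued measurable functions instead of classes modulo
  a.e. equality. Since balls below are formed with respect to the seminorm, they are unions of
  such classes, so that coverings by balls mean the same for functions and for classes.
\<close>

definition Lp_norm :: "'a measure \<Rightarrow> ennreal \<Rightarrow> ('a \<Rightarrow> real) \<Rightarrow> ennreal" where
  "Lp_norm M p f =
     (if p = \<infinity> then esssup M (\<lambda>x. ennreal \<bar>f x\<bar>)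
      else let I = (\<integral>\<^sup>+x. ennreal (\<bar>f x\<bar> powr enn2real p) \<partial>M)
           in if I = \<infinity> then \<infinity> else ennreal (enn2real I powr recip p))"

definition Lp_space :: "'a measure \<Rightarrow> ennreal \<Rightarrow> ('a \<Rightarrow> real) set" where
  "Lp_space M p = {f \<in> borel_measurable M. Lp_norm M p f < \<infinity>}"

definition Lp_cball :: "'a measure \<Rightarrow> ennreal \<Rightarrow> ('a \<Rightarrow> real) \<Rightarrow> real \<Rightarrow> ('a \<Rightarrow> real) set" where
  "Lp_cball M p y r = {f \<in> Lp_space M p. Lp_norm M p (\<lambda>x. f x - y x) \<le> ennreal r}"

text \<open>
  Entropy numbers of \<open>S : L_p(M) \<rightarrow> L_q(N)\<close>, for indices \<open>n \<ge> 1\<close>. As the covering sets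
  consist of elements of \<open>L_q(N)\<close>, a finite value entails that \<open>S\<close> maps the unit ball of \<open>L_p(M)\<close>
  into a bounded subset of \<open>L_q(N)\<close>; if no covering exists, the value is \<open>\<infinity>\<close>.
\<close>

definition entropy_number ::
  "'a measure \<Rightarrow> ennreal \<Rightarrow> 'b measure \<Rightarrow> ennreal \<Rightarrow> (('a \<Rightarrow> real) \<Rightarrow> 'b \<Rightarrow> real) \<Rightarrow> nat \<Rightarrow> ennreal"
  where
  "entropy_number M p N q S n =
     Inf {ennreal \<epsilon> | \<epsilon>. \<epsilon> > 0 \<and>
       (\<exists>y :: nat \<Rightarrow> 'b \<Rightarrow> real. (\<forall>j\<in>{1..2^(n-1)}. y j \<in> Lp_space N q) \<and>
          S ` Lp_cball M p (\<lambda>_. 0) 1 \<subseteq> (\<Union>j\<in>{1..2^(n-1)}. Lp_cball N q (y j) \<epsilon>))}"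

definition RL_op :: "(real \<Rightarrow> real) \<Rightarrow> (real \<Rightarrow> real) \<Rightarrow> real \<Rightarrow> real" where
  "RL_op \<alpha> f t =
     1 / Gamma (\<alpha> t) * (\<integral>s. (t - s) powr (\<alpha> t - 1) * f s \<partial>lebesgue_on {0..t})"

end

theory Submission
  imports Defs
begin

text \<open>
  Put \<open>u = 1/p\<close>, \<open>v = 1/q\<close> and let \<open>r = (ln 2 / ln n) powr (1/\<gamma>)\<close>, so that \<open>n powr (lam * r powr \<gamma>) = 2 powr lam\<close>.
  At the length scale \<open>h = r / n\<close>, which matters for the \<open>n\<close>-th entropy number, the kernel of order \<open>\<alpha> t\<close>
  differs from the one of order \<open>\<alpha>\<^sub>0\<close> by a factor of about \<open>n powr (- lam * t powr \<gamma>)\<close>. This is of constant order on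
  \<open>[0, r]\<close> and decreases rapidly from one interval of length \<open>r\<close> to the next one. Hence the
  entropy numbers are those of fractional integration of constant order \<open>\<alpha>\<^sub>0\<close> on an interval of
  length \<open>r\<close>, that is, of the order \<open>n powr (- \<alpha>\<^sub>0) * r powr (\<alpha>\<^sub>0 + v - u)\<close>.

  For the lower bound, divide \<open>[0, r]\<close> into \<open>n\<close> cells of length \<open>h\<close>, take step functions with integer steps
  and record the integrals of their images over the cells. As the operator only looks to the left, the
  matrix of this map is triangular, with diagonal entries of at least the order of
  \<open>r powr (- u) * h powr (\<alpha>\<^sub>0 + 1)\<close>. A triangular map with large diagonal entries cannot put many lattice points
  into one \<open>l_1\<close>-ball (\<open>card_triangular_near_le\<close>); this plays the role of a comparison of volumes, where
  the determinant is the product of the diagonal. A count of the step functions then bounds the radius of every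
  covering (\<open>covering_radius_lower_bound\<close>).

  For the upper bound, decompose for every \<open>t\<close> the interval \<open>[0, t)\<close> into Whitney sets, one for each dyadic
  level \<open>i\<close>, whose length and distance to \<open>t\<close> are comparable to \<open>mesh i\<close> and which depend only on the cell of
  \<open>t\<close>. On each of them expand the kernel \<open>(t - s) powr (\<alpha> t - 1)\<close> into its Taylor series in \<open>s\<close>
  (\<open>weight_moment_sums\<close>); in \<open>t\<close> it is only as smooth as the order \<open>\<alpha>\<close>. This separates the variables. The term of
  level \<open>i\<close> and degree \<open>m\<close> maps \<open>f\<close> to its moments on the Whitney sets, one for each cell, and these to a
  function that is on each cell a multiple of a fixed weight. Cutting the cells of level \<open>i\<close> into blocks
  that cover intervals of length about \<open>r\<close>, each block \<open>(i, m, k)\<close> factors through the identity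
  from \<open>l_p\<close> to \<open>l_q\<close> in dimension \<open>N i\<close> (\<open>block_net\<close>).

  Nets for the latter come from rounding coordinates towards zero and counting integer vectors by a
  generating function (\<open>lp_ball_nets\<close>): for every \<open>A > max 0 (u - v)\<close>, the radius
  \<open>C * N powr (v - u) * (N / \<nu>) powr A\<close> is reached with \<open>\<nu>\<close> bits. The \<open>n - 1\<close> bits are distributed over the blocks with
  quadratically decreasing shares in the distance from the critical level, where \<open>[0, r]\<close> has about \<open>n\<close> cells, in
  the degree and in the block number. An exponent \<open>A\<close> below \<open>\<alpha>\<^sub>0\<close> makes the radii summable over the fine
  levels, a large one does so for the coarse levels (\<open>level_estimate\<close>); the Taylor coefficients decrease
  geometrically, and the blocks by \<open>2 powr (- lam * k powr \<gamma>)\<close> (\<open>mesh_powr_block_le\<close>). By Minkowski's inequality the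
  sum of the radii bounds the entropy number (\<open>covering_from_nets\<close>).
\<close>


section \<open>Norm bounds with reciprocal exponents\<close>

text \<open>
  A convex function lies above its tangent at \<open>a\<close>. Written without subtraction, so that it can be
  integrated with values in \<open>ennreal\<close>.
\<close>

lemma powr_tangent_bound:
  fixes a y s :: real
  assumes "0 \<le> y" "0 \<le> a" "1 \<le> s"
  shows "s * a powr (s - 1) * y \<le> y powr s + (s - 1) * a powr s"
proof (cases "y = 0 \<or> a = 0")
  case True
  then show ?thesis using assms by auto
next
  case False
  then have pos: "y > 0" "a > 0" using assms by auto
  have "(y powr s) powr (1/s) * (a powr s) powr (1 - 1/s) \<le> (1/s) * y powr s + (1 - 1/s) * a powr s"
    using assms pos by (intro Youngs_inequality_0) auto
  moreover have "(y powr s) powr (1/s) = y" "(a powr s) powr (1 - 1/s) = a powr (s - 1)"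
    using assms pos by (simp_all add: powr_powr right_diff_distrib)
  ultimately have "s * (y * a powr (s - 1)) \<le> s * ((1/s) * y powr s + (1 - 1/s) * a powr s)"
    using assms by (intro mult_left_mono) auto
  also have "\<dots> = y powr s + (s - 1) * a powr s"
    using assms by (simp add: field_simps)
  finally show ?thesis by (simp add: mult_ac)
qed

text \<open>
  The bound is stated for every real number below the integral instead of the integral itself, so that
  infinite integrals are included.
\<close>

lemma jensen_powr:
  fixes y :: "'a \<Rightarrow> real"
  assumes [measurable]: "y \<in> borel_measurable M" and y: "\<And>x. x \<in> space M \<Longrightarrow> 0 \<le> y x"
    and s: "1 \<le> s" and mu: "emeasure M (space M) = ennreal \<mu>" "0 < \<mu>"
    and A: "0 \<le> A" "ennreal A \<le> (\<integral>\<^sup>+x. ennreal (y x) \<partial>M)"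
  shows "ennreal (A powr s) \<le> ennreal (\<mu> powr (s - 1)) * (\<integral>\<^sup>+x. ennreal (y x powr s) \<partial>M)"
proof (cases "A = 0")
  case True
  then show ?thesis by simp
next
  case False
  then have "A > 0" using A by simp
  define a where "a = A / \<mu>"
  have a: "a > 0" "A = a * \<mu>" using \<open>A > 0\<close> mu by (auto simp: a_def)
  let ?I = "\<integral>\<^sup>+x. ennreal (y x powr s) \<partial>M"
  \<comment> \<open>Integrate the tangent bound at the mean value \<open>a = A / \<mu>\<close>. The term with \<open>(s - 1) * a powr s\<close> is
    finite and cancels, also when one of the integrals is infinite.\<close>
  have "ennreal (s * a powr s * \<mu>) = ennreal (s * a powr (s - 1)) * ennreal A"
    using a s mu by (subst ennreal_mult[symmetric]) (auto simp: powr_diff field_simps)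
  also have "\<dots> \<le> ennreal (s * a powr (s - 1)) * (\<integral>\<^sup>+x. ennreal (y x) \<partial>M)"
    using A by (intro mult_left_mono) auto
  also have "\<dots> = (\<integral>\<^sup>+x. ennreal (s * a powr (s - 1) * y x) \<partial>M)"
    using s y by (subst nn_integral_cmult[symmetric]) (auto intro!: nn_integral_cong simp: ennreal_mult)
  also have "\<dots> \<le> (\<integral>\<^sup>+x. ennreal (y x powr s) + ennreal ((s - 1) * a powr s) \<partial>M)"
    using powr_tangent_bound[of _ a s] a s y
    by (intro nn_integral_mono) (auto simp: ennreal_plus[symmetric] simp del: ennreal_plus intro!: ennreal_leI)
  also have "\<dots> = ?I + ennreal ((s - 1) * a powr s) * ennreal \<mu>"
    by (subst nn_integral_add) (auto simp: mu)
  also have "\<dots> = ?I + ennreal ((s - 1) * a powr s * \<mu>)"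
    using s mu by (subst ennreal_mult) auto
  finally have *: "ennreal (s * a powr s * \<mu>) \<le> ?I + ennreal ((s - 1) * a powr s * \<mu>)" .
  have "ennreal (a powr s * \<mu>) \<le> ?I"
  proof -
    have "ennreal (s * a powr s * \<mu>) = ennreal (a powr s * \<mu>) + ennreal ((s - 1) * a powr s * \<mu>)"
      using s mu a by (subst ennreal_plus[symmetric]) (auto simp: algebra_simps simp del: ennreal_plus)
    with * show ?thesis by simp
  qed
  then have "ennreal (\<mu> powr (s - 1)) * ennreal (a powr s * \<mu>) \<le> ennreal (\<mu> powr (s - 1)) * ?I"
    by (rule mult_left_mono) simp
  also have "ennreal (\<mu> powr (s - 1)) * ennreal (a powr s * \<mu>) = ennreal (A powr s)"
    using a mu by (subst ennreal_mult[symmetric]) (auto simp: powr_mult powr_diff)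
  finally show ?thesis .
qed

text \<open>
  The norm bound in \<open>L_q\<close>, parametrized by \<open>v = 1/q\<close>: the exponents in Hoelder's inequality are linear
  in \<open>v\<close>, and \<open>v = 0\<close> is the essential supremum. With \<open>M = count_space {..<N}\<close> it speaks of sequence spaces.
\<close>

definition Lq_le :: "'a measure \<Rightarrow> real \<Rightarrow> ('a \<Rightarrow> real) \<Rightarrow> real \<Rightarrow> bool" where
  "Lq_le M v f b \<longleftrightarrow>
     (if v = 0 then AE x in M. \<bar>f x\<bar> \<le> b
      else (\<integral>\<^sup>+x. ennreal (\<bar>f x\<bar> powr (1 / v)) \<partial>M) \<le> ennreal (b powr (1 / v)))"

lemma recip_bounds:
  assumes "1 \<le> p"
  shows "0 \<le> recip p" "recip p \<le> 1" "recip p = 0 \<longleftrightarrow> p = \<infinity>" "p \<noteq> \<infinity> \<Longrightarrow> enn2real p = 1 / recip p"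
proof -
  show "0 \<le> recip p" by (simp add: recip_def)
  show "recip p \<le> 1" "recip p = 0 \<longleftrightarrow> p = \<infinity>" "p \<noteq> \<infinity> \<Longrightarrow> enn2real p = 1 / recip p"
    using assms
    by (cases p; auto simp: recip_def inverse_ennreal ennreal_1[symmetric] divide_simps simp del: ennreal_1)+
qed

lemma Lp_norm_le_iff:
  assumes [measurable]: "f \<in> borel_measurable M" and p: "1 \<le> p" and b: "0 \<le> b"
  shows "Lp_norm M p f \<le> ennreal b \<longleftrightarrow> Lq_le M (recip p) f b"
proof (cases "p = \<infinity>")
  case True
  have "esssup M (\<lambda>x. ennreal \<bar>f x\<bar>) \<le> ennreal b \<longleftrightarrow> (AE x in M. \<bar>f x\<bar> \<le> b)"
  proof
    assume *: "esssup M (\<lambda>x. ennreal \<bar>f x\<bar>) \<le> ennreal b"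
    have "AE x in M. ennreal \<bar>f x\<bar> \<le> esssup M (\<lambda>x. ennreal \<bar>f x\<bar>)" by (rule esssup_AE)
    then show "AE x in M. \<bar>f x\<bar> \<le> b"
    proof eventually_elim
      case (elim x)
      then have "ennreal \<bar>f x\<bar> \<le> ennreal b" using * by (rule order_trans)
      then show ?case using b by simp
    qed
  next
    assume "AE x in M. \<bar>f x\<bar> \<le> b"
    then have "AE x in M. ennreal \<bar>f x\<bar> \<le> ennreal b" by eventually_elim (auto intro: ennreal_leI)
    then show "esssup M (\<lambda>x. ennreal \<bar>f x\<bar>) \<le> ennreal b" by (intro esssup_I) auto
  qed
  then show ?thesis using True recip_bounds(3)[OF p] by (simp add: Lp_norm_def Lq_le_def)
next
  case False
  define P where "P = enn2real p"
  have "P = 1 / recip p" unfolding P_def by (rule recip_bounds(4)[OF p False])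
  moreover have "recip p > 0" using recip_bounds(1,3)[OF p] False by auto
  ultimately have P: "recip p = 1 / P" "P > 0" "recip p \<noteq> 0" by auto
  let ?I = "\<integral>\<^sup>+x. ennreal (\<bar>f x\<bar> powr P) \<partial>M"
  have "(let I = ?I in if I = \<infinity> then \<infinity> else ennreal (enn2real I powr (1/P))) \<le> ennreal b
       \<longleftrightarrow> ?I \<le> ennreal (b powr P)"
  proof (cases ?I)
    case (real c)
    have "c powr (1/P) \<le> b \<longleftrightarrow> c \<le> b powr P"
    proof
      assume "c powr (1/P) \<le> b"
      then have "(c powr (1/P)) powr P \<le> b powr P" using P by (intro powr_mono2) auto
      then show "c \<le> b powr P" using P real by (simp add: powr_powr)
    next
      assume "c \<le> b powr P"
      then have "c powr (1/P) \<le> (b powr P) powr (1/P)" using P real by (intro powr_mono2) auto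
      then show "c powr (1/P) \<le> b" using P b by (simp add: powr_powr)
    qed
    then show ?thesis using real b by (simp add: Let_def)
  next
    case top
    then show ?thesis by (simp add: Let_def top_unique)
  qed
  moreover have "Lp_norm M p f = (let I = ?I in if I = \<infinity> then \<infinity> else ennreal (enn2real I powr (1/P)))"
    unfolding Lp_norm_def P(1) P_def using False by simp
  ultimately show ?thesis using P(2) by (simp add: Lq_le_def P(1))
qed

lemma Lq_le_cong_AE:
  assumes "AE x in M. \<bar>f x\<bar> \<le> \<bar>g x\<bar>" "Lq_le M v g b" "0 \<le> v"
  shows "Lq_le M v f b"
proof (cases "v = 0")
  case True
  then show ?thesis using assms by (auto simp: Lq_le_def elim: eventually_elim2)
next
  case False
  have "(\<integral>\<^sup>+x. ennreal (\<bar>f x\<bar> powr (1/v)) \<partial>M) \<le> (\<integral>\<^sup>+x. ennreal (\<bar>g x\<bar> powr (1/v)) \<partial>M)"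
    using assms(1) by (intro nn_integral_mono_AE) (auto elim!: eventually_mono intro!: ennreal_leI powr_mono2 assms)
  then show ?thesis using assms False by (auto simp: Lq_le_def)
qed

lemma Lq_le_scale:
  assumes "Lq_le M v f b" "0 \<le> b" "0 \<le> v" and [measurable]: "f \<in> borel_measurable M"
  shows "Lq_le M v (\<lambda>x. c * f x) (\<bar>c\<bar> * b)"
proof (cases "v = 0")
  case True
  then show ?thesis using assms by (auto simp: Lq_le_def abs_mult elim!: eventually_mono intro!: mult_left_mono)
next
  case False
  have "(\<integral>\<^sup>+x. ennreal (\<bar>c * f x\<bar> powr (1/v)) \<partial>M)
      = (\<integral>\<^sup>+x. ennreal (\<bar>c\<bar> powr (1/v)) * ennreal (\<bar>f x\<bar> powr (1/v)) \<partial>M)"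
    by (simp add: abs_mult powr_mult ennreal_mult)
  also have "\<dots> = ennreal (\<bar>c\<bar> powr (1/v)) * (\<integral>\<^sup>+x. ennreal (\<bar>f x\<bar> powr (1/v)) \<partial>M)"
    by (rule nn_integral_cmult) auto
  also have "\<dots> \<le> ennreal (\<bar>c\<bar> powr (1/v)) * ennreal (b powr (1/v))"
    using assms False by (intro mult_left_mono) (auto simp: Lq_le_def)
  also have "\<dots> = ennreal ((\<bar>c\<bar> * b) powr (1/v))"
    using assms by (simp add: ennreal_mult powr_mult)
  finally show ?thesis using False by (simp add: Lq_le_def)
qed

lemma Lq_le_mono:
  assumes "Lq_le M v f b" "b \<le> c" "0 \<le> v" "0 \<le> b"
  shows "Lq_le M v f c"
proof (cases "v = 0")
  case True
  then show ?thesis using assms by (auto simp: Lq_le_def elim!: eventually_mono)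
next
  case False
  then have "ennreal (b powr (1/v)) \<le> ennreal (c powr (1/v))"
    using assms by (intro ennreal_leI powr_mono2) auto
  with assms(1) False show ?thesis unfolding Lq_le_def by (auto intro: order_trans)
qed

text \<open>
  Hoelder's inequality on a finite measure space, by Jensen for the power \<open>v / u\<close>.
\<close>

lemma Lq_le_lower_exponent:
  fixes f :: "'a \<Rightarrow> real"
  assumes [measurable]: "f \<in> borel_measurable M" and f: "Lq_le M u f b"
    and uv: "0 \<le> u" "u \<le> v" and b: "0 \<le> b"
    and mu: "emeasure M (space M) = ennreal \<mu>" "0 < \<mu>"
  shows "Lq_le M v f (b * \<mu> powr (v - u))"
proof -
  consider "v = 0" | "v > 0" "u = 0" | "u > 0" using uv by force
  then show ?thesis
  proof cases
    case 1
    then show ?thesis using f mu uv by (simp add: Lq_le_def)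
  next
    case 2
    then have "AE x in M. \<bar>f x\<bar> \<le> b" using f by (simp add: Lq_le_def)
    then have "(\<integral>\<^sup>+x. ennreal (\<bar>f x\<bar> powr (1/v)) \<partial>M) \<le> (\<integral>\<^sup>+x. ennreal (b powr (1/v)) \<partial>M)"
      by (intro nn_integral_mono_AE) (auto elim!: eventually_mono intro!: ennreal_leI powr_mono2 simp: uv 2 less_imp_le)
    also have "\<dots> = ennreal ((b * \<mu> powr v) powr (1/v))"
      using mu b 2 by (simp add: powr_mult powr_powr ennreal_mult)
    finally show ?thesis using 2 by (simp add: Lq_le_def)
  next
    case 3
    then have "v > 0" using uv by simp
    define s where "s = v / u"
    have s: "1 \<le> s" "s / v = 1 / u" using 3 uv by (auto simp: s_def field_simps)
    let ?I = "\<integral>\<^sup>+x. ennreal (\<bar>f x\<bar> powr (1/v)) \<partial>M"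
    \<comment> \<open>The integral may be infinite, so Jensen is applied to a real number \<open>A\<close> strictly between the
      claimed bound and the integral.\<close>
    have "?I \<le> ennreal ((b * \<mu> powr (v - u)) powr (1/v))" (is "_ \<le> ennreal ?c")
    proof (rule ccontr)
      assume "\<not> ?I \<le> ennreal ?c"
      then have "ennreal ?c < ?I" by simp
      then obtain z where z: "ennreal ?c < z" "z < ?I" using dense by blast
      then obtain A where A: "z = ennreal A" "0 \<le> A" by (cases z) auto
      have cA: "?c < A" using z A by (simp add: ennreal_less_iff)
      have "ennreal (A powr s) \<le> ennreal (\<mu> powr (s - 1)) * (\<integral>\<^sup>+x. ennreal ((\<bar>f x\<bar> powr (1/v)) powr s) \<partial>M)"
        by (rule jensen_powr) (use s mu A z in auto)
      also have "\<dots> \<le> ennreal (\<mu> powr (s - 1)) * ennreal (b powr (1/u))"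
        using f 3 by (intro mult_left_mono) (auto simp: powr_powr s Lq_le_def)
      also have "\<dots> = ennreal (\<mu> powr (s - 1) * b powr (1/u))"
        by (simp add: ennreal_mult)
      finally have "A powr s \<le> \<mu> powr (s - 1) * b powr (1/u)" by simp
      also have "\<dots> = ?c powr s"
      proof -
        have "(v - u) / v * s = s - 1" using 3 \<open>v > 0\<close> by (simp add: s_def field_simps)
        then show ?thesis using b mu by (simp add: powr_mult powr_powr s)
      qed
      finally have "A powr s \<le> ?c powr s" .
      moreover have "?c powr s < A powr s" using cA s by (intro powr_less_mono2) auto
      ultimately show False by simp
    qed
    then show ?thesis using \<open>v > 0\<close> by (simp add: Lq_le_def)
  qed
qed

text \<open>
  Minkowski's inequality for countable sums, in the form needed for coverings: \<open>F\<close> is only assumed to be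
  dominated by the sum, which may diverge on a null set.
\<close>

lemma Lq_le_countable_sum:
  fixes g :: "'i :: countable \<Rightarrow> 'a \<Rightarrow> real"
  assumes g[measurable]: "\<And>i. g i \<in> borel_measurable M" and [measurable]: "F \<in> borel_measurable M"
    and v: "0 \<le> v" "v \<le> 1"
    and b: "\<And>i. 0 < b i" and B: "(\<integral>\<^sup>+i. ennreal (b i) \<partial>count_space UNIV) \<le> ennreal B"
    and gb: "\<And>i. Lq_le M v (g i) (b i)"
    and F: "AE x in M. ennreal \<bar>F x\<bar> \<le> (\<integral>\<^sup>+i. ennreal \<bar>g i x\<bar> \<partial>count_space UNIV)"
  shows "Lq_le M v F B"
proof -
  define bb where "bb = enn2real (\<integral>\<^sup>+i. ennreal (b i) \<partial>count_space UNIV)"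
  have sumb: "(\<integral>\<^sup>+i. ennreal (b i) \<partial>count_space UNIV) = ennreal bb"
    unfolding bb_def using B by (intro ennreal_enn2real[symmetric]) (auto simp: less_top[symmetric] top_unique)
  have "ennreal 0 < ennreal (b undefined)" using b by (simp add: ennreal_less_iff)
  also have "\<dots> \<le> ennreal bb"
    unfolding sumb[symmetric] by (rule nn_integral_ge_point) auto
  finally have bb: "0 < bb" by (simp add: ennreal_less_iff bb_def)
  have bbB: "bb \<le> B"
    using B bb unfolding sumb by (metis ennreal_le_iff2 linorder_not_less)
  have "Lq_le M v F bb"
  proof (cases "v = 0")
    case True
    have "AE x in M. \<forall>i. \<bar>g i x\<bar> \<le> b i"
      using gb True by (subst AE_all_countable) (simp add: Lq_le_def)
    with F have "AE x in M. \<bar>F x\<bar> \<le> bb"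
    proof eventually_elim
      case (elim x)
      have "ennreal \<bar>F x\<bar> \<le> (\<integral>\<^sup>+i. ennreal (b i) \<partial>count_space UNIV)"
        using elim by (intro order_trans[OF elim(1)] nn_integral_mono ennreal_leI) auto
      then show ?case using bb by (simp add: sumb)
    qed
    then show ?thesis using True by (simp add: Lq_le_def)
  next
    case False
    define s where "s = 1 / v"
    have s: "1 \<le> s" "v > 0" using v False by (auto simp: s_def)
    \<comment> \<open>Jensen for the finite measure with weights \<open>b i\<close> and the function \<open>\<bar>g i x\<bar> / b i\<close>: in the mean
      over \<open>i\<close>, its \<open>s\<close>-th power has integral at most 1.\<close>
    define N where "N = density (count_space UNIV) (\<lambda>i. ennreal (b i))"
    have N: "emeasure N (space N) = ennreal bb"
      by (simp add: N_def emeasure_density sumb)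
    have [measurable]: "y \<in> borel_measurable N" for y :: "'i \<Rightarrow> real" by (simp add: N_def)
    have int: "(\<integral>\<^sup>+i. h i \<partial>N) = (\<integral>\<^sup>+i. ennreal (b i) * h i \<partial>count_space UNIV)" for h
      by (simp add: N_def nn_integral_density)
    have pt: "AE x in M. ennreal (\<bar>F x\<bar> powr s) \<le>
        ennreal (bb powr (s - 1)) * (\<integral>\<^sup>+i. ennreal (b i powr (1 - s) * \<bar>g i x\<bar> powr s) \<partial>count_space UNIV)"
      using F
    proof eventually_elim
      case (elim x)
      have "ennreal (\<bar>F x\<bar> powr s) \<le> ennreal (bb powr (s - 1)) * (\<integral>\<^sup>+i. ennreal ((\<bar>g i x\<bar> / b i) powr s) \<partial>N)"
      proof (rule jensen_powr)
        have "(\<integral>\<^sup>+i. ennreal \<bar>g i x\<bar> \<partial>count_space UNIV) = (\<integral>\<^sup>+i. ennreal (\<bar>g i x\<bar> / b i) \<partial>N)"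
          unfolding int using b by (intro nn_integral_cong) (simp add: ennreal_mult[symmetric] less_imp_le less_imp_neq[symmetric])
        then show "ennreal \<bar>F x\<bar> \<le> (\<integral>\<^sup>+i. ennreal (\<bar>g i x\<bar> / b i) \<partial>N)" using elim by simp
      qed (use s bb N b in \<open>auto simp: less_imp_le\<close>)
      also have "(\<integral>\<^sup>+i. ennreal ((\<bar>g i x\<bar> / b i) powr s) \<partial>N)
          = (\<integral>\<^sup>+i. ennreal (b i powr (1 - s) * \<bar>g i x\<bar> powr s) \<partial>count_space UNIV)"
        unfolding int using b
        by (intro nn_integral_cong) (simp add: ennreal_mult[symmetric] less_imp_le powr_divide powr_diff)
      finally show ?case .
    qed
    have "(\<integral>\<^sup>+x. ennreal (\<bar>F x\<bar> powr s) \<partial>M) \<le>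
        (\<integral>\<^sup>+x. (\<integral>\<^sup>+i. ennreal (bb powr (s - 1)) * ennreal (b i powr (1 - s) * \<bar>g i x\<bar> powr s) \<partial>count_space UNIV) \<partial>M)"
      by (rule nn_integral_mono_AE, subst nn_integral_cmult) (auto intro: pt)
    also have "\<dots> = (\<integral>\<^sup>+i. (\<integral>\<^sup>+x. ennreal (bb powr (s - 1)) * ennreal (b i powr (1 - s) * \<bar>g i x\<bar> powr s) \<partial>M) \<partial>count_space UNIV)"
      by (rule nn_integral_count_space_nn_integral) auto
    also have "\<dots> = ennreal (bb powr (s - 1)) * (\<integral>\<^sup>+i. (\<integral>\<^sup>+x. ennreal (b i powr (1 - s) * \<bar>g i x\<bar> powr s) \<partial>M) \<partial>count_space UNIV)"
      by (simp add: nn_integral_cmult)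
    also have "(\<integral>\<^sup>+i. (\<integral>\<^sup>+x. ennreal (b i powr (1 - s) * \<bar>g i x\<bar> powr s) \<partial>M) \<partial>count_space UNIV)
        \<le> (\<integral>\<^sup>+i. ennreal (b i) \<partial>count_space UNIV)"
    proof (intro nn_integral_mono)
      fix i
      have "(\<integral>\<^sup>+x. ennreal (b i powr (1 - s) * \<bar>g i x\<bar> powr s) \<partial>M)
          = ennreal (b i powr (1 - s)) * (\<integral>\<^sup>+x. ennreal (\<bar>g i x\<bar> powr s) \<partial>M)"
        by (subst nn_integral_cmult[symmetric]) (auto simp: ennreal_mult)
      also have "\<dots> \<le> ennreal (b i powr (1 - s)) * ennreal (b i powr s)"
        using gb[of i] False by (intro mult_left_mono) (auto simp: Lq_le_def s_def)
      also have "\<dots> = ennreal (b i)"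
        using b[of i] by (subst ennreal_mult[symmetric]) (auto simp: powr_add[symmetric])
      finally show "(\<integral>\<^sup>+x. ennreal (b i powr (1 - s) * \<bar>g i x\<bar> powr s) \<partial>M) \<le> ennreal (b i)" .
    qed
    also have "ennreal (bb powr (s - 1)) * (\<integral>\<^sup>+i. ennreal (b i) \<partial>count_space UNIV) = ennreal (bb powr s)"
      unfolding sumb using bb by (subst ennreal_mult[symmetric]) (auto simp: powr_diff)
    finally show ?thesis
      using False by (simp add: Lq_le_def s_def mult_left_mono)
  qed
  then show ?thesis using bbB bb v by (auto intro: Lq_le_mono)
qed

lemma Lq_le_add:
  fixes f g :: "'a \<Rightarrow> real"
  assumes [measurable]: "f \<in> borel_measurable M" "g \<in> borel_measurable M"
    and f: "Lq_le M v f a" and g: "Lq_le M v g b" and v: "0 \<le> v" "v \<le> 1" and ab: "0 < a" "0 < b"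
  shows "Lq_le M v (\<lambda>x. f x + g x) (a + b)"
proof (rule Lq_le_countable_sum[where g = "\<lambda>c. if c then f else g" and b = "\<lambda>c. if c then a else b"])
  show "(\<integral>\<^sup>+i. ennreal (if i then a else b) \<partial>count_space UNIV) \<le> ennreal (a + b)"
    using ab by (simp add: nn_integral_count_space_finite UNIV_bool)
  show "AE x in M. ennreal \<bar>f x + g x\<bar> \<le> (\<integral>\<^sup>+i. ennreal \<bar>(if i then f else g) x\<bar> \<partial>count_space UNIV)"
    by (intro AE_I2) (simp add: nn_integral_count_space_finite UNIV_bool ennreal_plus[symmetric] abs_triangle_ineq add.commute del: ennreal_plus)
  show "(\<lambda>x. f x + g x) \<in> borel_measurable M" by measurable
  fix c :: bool
  show "(if c then f else g) \<in> borel_measurable M" "0 < (if c then a else b)"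
    "Lq_le M v (if c then f else g) (if c then a else b)"
    using assms by (cases c; simp)+
qed (rule v)+

lemma Lq_le_count_space:
  fixes N :: nat
  shows "Lq_le (count_space {..<N}) v x b \<longleftrightarrow>
     (if v = 0 then \<forall>j<N. \<bar>x j\<bar> \<le> b else (\<Sum>j<N. \<bar>x j\<bar> powr (1/v)) \<le> b powr (1/v))"
proof -
  have "(\<integral>\<^sup>+j. ennreal (\<bar>x j\<bar> powr (1/v)) \<partial>count_space {..<N}) = ennreal (\<Sum>j<N. \<bar>x j\<bar> powr (1/v))"
    by (simp only: nn_integral_count_space_finite[OF finite_lessThan], rule sum_ennreal) simp
  then show ?thesis by (auto simp: Lq_le_def AE_count_space)
qed

lemma Lq_le_lebesgue_on_iff:
  assumes "S \<in> sets lebesgue" "0 \<le> b"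
  shows "Lq_le (lebesgue_on S) v f b \<longleftrightarrow> Lq_le lebesgue v (\<lambda>x. indicator S x * f x) b"
proof -
  have "(\<integral>\<^sup>+x. ennreal (\<bar>f x\<bar> powr (1/v)) \<partial>lebesgue_on S) = (\<integral>\<^sup>+x. ennreal (\<bar>indicator S x * f x\<bar> powr (1/v)) \<partial>lebesgue)"
    using assms by (subst nn_integral_restrict_space) (auto intro!: nn_integral_cong simp: indicator_def)
  moreover have "(AE x in lebesgue_on S. \<bar>f x\<bar> \<le> b) \<longleftrightarrow> (AE x in lebesgue. \<bar>indicator S x * f x\<bar> \<le> b)"
    using assms by (subst AE_restrict_space_iff) (auto intro!: AE_cong simp: indicator_def)
  ultimately show ?thesis by (simp add: Lq_le_def)
qed

lemma Lq_le_lebesgue_on_subset: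
  assumes "S \<in> sets lebesgue" "T \<in> sets lebesgue" "S \<subseteq> T" "0 \<le> b" "0 \<le> v" "Lq_le (lebesgue_on T) v f b"
  shows "Lq_le (lebesgue_on S) v f b"
proof -
  have T: "Lq_le lebesgue v (\<lambda>x. indicator T x * f x) b" using assms by (simp add: Lq_le_lebesgue_on_iff)
  have "AE x in lebesgue. \<bar>indicator S x * f x\<bar> \<le> \<bar>indicator T x * f x\<bar>"
    using assms(3) by (intro AE_I2) (auto simp: indicator_def)
  from Lq_le_cong_AE[OF this T assms(5)] have "Lq_le lebesgue v (\<lambda>x. indicator S x * f x) b" .
  then show ?thesis using assms by (simp add: Lq_le_lebesgue_on_iff)
qed

lemma emeasure_lebesgue_on_interval:
  fixes a b :: real
  assumes "a \<le> b"
  shows "emeasure (lebesgue_on {a..b}) (space (lebesgue_on {a..b})) = ennreal (b - a)"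
  using assms by (simp add: emeasure_restrict_space)

lemma Lq_le_imp_integrable:
  assumes f: "f \<in> borel_measurable M" "Lq_le M v f b" and v: "0 \<le> v" "v \<le> 1" and b: "0 \<le> b"
    and mu: "emeasure M (space M) = ennreal \<mu>" "0 < \<mu>"
  shows "integrable M f" "(\<integral>x. \<bar>f x\<bar> \<partial>M) \<le> b * \<mu> powr (1 - v)"
proof -
  have "Lq_le M 1 f (b * \<mu> powr (1 - v))" using assms by (intro Lq_le_lower_exponent) auto
  then have le: "(\<integral>\<^sup>+x. ennreal \<bar>f x\<bar> \<partial>M) \<le> ennreal (b * \<mu> powr (1 - v))"
    using b by (simp add: Lq_le_def)
  also have "\<dots> < \<infinity>" by simp
  finally show int: "integrable M f" using f by (intro integrableI_bounded) auto
  have "ennreal (\<integral>x. \<bar>f x\<bar> \<partial>M) = (\<integral>\<^sup>+x. ennreal \<bar>f x\<bar> \<partial>M)"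
    using int by (intro nn_integral_eq_integral[symmetric]) auto
  then have "ennreal (\<integral>x. \<bar>f x\<bar> \<partial>M) \<le> ennreal (b * \<mu> powr (1 - v))" using le by simp
  then show "(\<integral>x. \<bar>f x\<bar> \<partial>M) \<le> b * \<mu> powr (1 - v)" using b by (subst (asm) ennreal_le_iff) auto
qed

lemma Lp_space_imp_Lq_le:
  assumes q: "1 \<le> q" and g: "g \<in> Lp_space M q"
  obtains b where "0 \<le> b" "Lq_le M (recip q) g b"
proof -
  have m: "g \<in> borel_measurable M" and "Lp_norm M q g < \<infinity>" using g by (auto simp: Lp_space_def)
  then obtain b where b: "Lp_norm M q g = ennreal b" "0 \<le> b" by (cases "Lp_norm M q g") auto
  show ?thesis using that[of b] b Lp_norm_le_iff[OF m q, of b] by simp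
qed

lemma Lq_le_imp_Lp_space:
  assumes "1 \<le> q" "f \<in> borel_measurable M" "Lq_le M (recip q) f b" "0 \<le> b"
  shows "f \<in> Lp_space M q"
proof -
  have "Lp_norm M q f \<le> ennreal b" using assms by (simp add: Lp_norm_le_iff)
  then show ?thesis using assms(2) by (auto simp: Lp_space_def intro: le_less_trans)
qed

lemma bounded_imp_Lq_le:
  fixes f :: "real \<Rightarrow> real"
  assumes m: "f \<in> borel_measurable (lebesgue_on {0..1})" and b: "\<And>t. t \<in> {0..1} \<Longrightarrow> \<bar>f t\<bar> \<le> b" "0 \<le> b" and v: "0 \<le> v"
  shows "Lq_le (lebesgue_on {0..1}) v f b"
proof -
  have "Lq_le (lebesgue_on {0..1}) 0 f b" using b by (auto simp: Lq_le_def intro!: AE_I2)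
  then have "Lq_le (lebesgue_on {0..1}) v f (b * 1 powr (v - 0))"
    by (rule Lq_le_lower_exponent[OF m _ order_refl v b(2)]) (use emeasure_lebesgue_on_interval[of 0 1] in simp_all)
  then show ?thesis by simp
qed


section \<open>Counting integer points in an octahedron\<close>

definition int_l1_ball :: "nat \<Rightarrow> real \<Rightarrow> (nat \<Rightarrow> int) set" where
  "int_l1_ball N K = {z \<in> {..<N} \<rightarrow>\<^sub>E UNIV. real_of_int (\<Sum>j<N. \<bar>z j\<bar>) \<le> K}"

lemma sum_power_abs_le:
  fixes x :: real
  assumes "0 < x" "x < 1"
  shows "(\<Sum>k\<in>{-int m..int m}. x ^ nat \<bar>k\<bar>) = (1 + x - 2 * x ^ (m + 1)) / (1 - x)"
proof (induction m)
  case 0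
  then show ?case using assms by simp
next
  case (Suc m)
  have "{-int (Suc m)..int (Suc m)} = insert (int (Suc m)) (insert (- int (Suc m)) {-int m..int m})"
    by auto
  then have "(\<Sum>k\<in>{-int (Suc m)..int (Suc m)}. x ^ nat \<bar>k\<bar>) = 2 * x ^ Suc m + (\<Sum>k\<in>{-int m..int m}. x ^ nat \<bar>k\<bar>)"
    by (simp add: nat_add_distrib)
  then show ?case using assms Suc by (simp add: field_simps)
qed

text \<open>
  Markov's inequality for the generating function. The parameter \<open>x\<close> is free: values near 1 suit large radii
  \<open>K\<close>, small values suit \<open>K\<close> much smaller than \<open>N\<close>.
\<close>

lemma card_int_l1_ball:
  assumes x: "0 < x" "x < 1"
  shows "finite (int_l1_ball N K)" "real (card (int_l1_ball N K)) \<le> x powr (- K) * ((1 + x) / (1 - x)) ^ N"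
proof -
  define m where "m = nat \<lfloor>K\<rfloor>"
  let ?P = "{..<N} \<rightarrow>\<^sub>E {-int m..int m}"
  have sub: "int_l1_ball N K \<subseteq> ?P"
  proof
    fix z assume z: "z \<in> int_l1_ball N K"
    have "z j \<in> {-int m..int m}" if "j < N" for j
    proof -
      have "\<bar>z j\<bar> \<le> (\<Sum>j<N. \<bar>z j\<bar>)" using that by (intro member_le_sum) auto
      also have "\<dots> \<le> \<lfloor>K\<rfloor>" using z by (simp add: int_l1_ball_def le_floor_iff)
      finally show ?thesis unfolding m_def atLeastAtMost_iff by linarith
    qed
    moreover have "z \<in> extensional {..<N}" using z by (simp add: int_l1_ball_def PiE_iff)
    ultimately show "z \<in> ?P" by (simp add: PiE_iff)
  qed
  have fin: "finite ?P" by (intro finite_PiE) auto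
  show "finite (int_l1_ball N K)" using sub fin by (rule finite_subset)
  \<comment> \<open>Every point of the ball contributes at least \<open>x powr K\<close> to the generating function
    \<open>\<Sum>z. x powr (\<Sum>j. \<bar>z j\<bar>)\<close>, which is a product of one-dimensional sums.\<close>
  have "real (card (int_l1_ball N K)) * x powr K = (\<Sum>z\<in>int_l1_ball N K. x powr K)" by simp
  also have "\<dots> \<le> (\<Sum>z\<in>int_l1_ball N K. \<Prod>j<N. x ^ nat \<bar>z j\<bar>)"
  proof (intro sum_mono)
    fix z assume z: "z \<in> int_l1_ball N K"
    have "x powr K \<le> x powr (real_of_int (\<Sum>j<N. \<bar>z j\<bar>))"
      using z x by (intro powr_mono') (auto simp: int_l1_ball_def)
    also have "real_of_int (\<Sum>j<N. \<bar>z j\<bar>) = real (\<Sum>j<N. nat \<bar>z j\<bar>)" by simp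
    also have "x powr \<dots> = x ^ (\<Sum>j<N. nat \<bar>z j\<bar>)" using x by (simp only: powr_realpow)
    also have "\<dots> = (\<Prod>j<N. x ^ nat \<bar>z j\<bar>)" by (rule power_sum)
    finally show "x powr K \<le> (\<Prod>j<N. x ^ nat \<bar>z j\<bar>)" .
  qed
  also have "\<dots> \<le> (\<Sum>z\<in>?P. \<Prod>j<N. x ^ nat \<bar>z j\<bar>)"
    using x by (intro sum_mono2 fin sub prod_nonneg) auto
  also have "\<dots> = (\<Prod>j<N. \<Sum>k\<in>{-int m..int m}. x ^ nat \<bar>k\<bar>)"
    by (rule prod_sum_PiE[symmetric]) auto
  also have "\<dots> \<le> (\<Prod>j<N. (1 + x) / (1 - x))"
  proof (intro prod_mono conjI sum_nonneg)
    show "(\<Sum>k\<in>{-int m..int m}. x ^ nat \<bar>k\<bar>) \<le> (1 + x) / (1 - x)"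
      unfolding sum_power_abs_le[OF x] using x by (intro divide_right_mono) auto
  qed (use x in auto)
  also have "\<dots> = ((1 + x) / (1 - x)) ^ N" by simp
  finally show "real (card (int_l1_ball N K)) \<le> x powr (- K) * ((1 + x) / (1 - x)) ^ N"
    using x by (simp add: powr_minus field_simps)
qed


section \<open>Finite nets for the unit ball of a sequence space\<close>

text \<open>
  Rounding towards zero: unlike the nearest integer it never increases the modulus, which keeps the
  rounded vector and the error inside of the same ball as the vector itself.
\<close>

definition trunc :: "real \<Rightarrow> int" where
  "trunc t = (if t \<ge> 0 then \<lfloor>t\<rfloor> else - \<lfloor>- t\<rfloor>)"

lemma trunc_bounds:
  "\<bar>real_of_int (trunc t)\<bar> \<le> \<bar>t\<bar>" "\<bar>t - trunc t\<bar> \<le> 1" "\<bar>t - trunc t\<bar> \<le> \<bar>t\<bar>"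
proof -
  have "0 \<le> \<lfloor>t\<rfloor>" if "t \<ge> 0" using that by simp
  moreover have "0 \<le> \<lfloor>- t\<rfloor>" if "\<not> t \<ge> 0" using that by simp
  ultimately show "\<bar>real_of_int (trunc t)\<bar> \<le> \<bar>t\<bar>" "\<bar>t - trunc t\<bar> \<le> 1" "\<bar>t - trunc t\<bar> \<le> \<bar>t\<bar>"
    unfolding trunc_def by (cases "t \<ge> 0"; simp; linarith)+
qed

text \<open>
  Nets by rounding to the lattice with step \<open>h\<close>; \<open>X\<close> describes the set to be covered and \<open>Q\<close> the admissible
  errors, of which only the two pointwise bounds are known.
\<close>

lemma rounding_net:
  fixes N :: nat and h K :: real
  assumes h: "0 < h"
    and K: "\<And>x. X x \<Longrightarrow> (\<Sum>j<N. \<bar>real_of_int (trunc (x j / h))\<bar>) \<le> K"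
    and e: "\<And>x y. X x \<Longrightarrow> (\<And>j. j < N \<Longrightarrow> \<bar>y j\<bar> \<le> h \<and> \<bar>y j\<bar> \<le> \<bar>x j\<bar>) \<Longrightarrow> Q y"
  shows "\<exists>Z :: (nat \<Rightarrow> real) set. finite Z \<and> card Z \<le> card (int_l1_ball N K) \<and>
    (\<forall>x. X x \<longrightarrow> (\<exists>z\<in>Z. Q (\<lambda>j. x j - z j)))"
proof -
  let ?Z = "(\<lambda>z j. h * real_of_int (z j)) ` int_l1_ball N K"
  have fin: "finite (int_l1_ball N K)" by (rule card_int_l1_ball[of "1/2"]) auto
  have Z: "finite ?Z" "card ?Z \<le> card (int_l1_ball N K)" using fin by (auto intro: card_image_le)
  have net: "\<exists>z\<in>?Z. Q (\<lambda>j. x j - z j)" if X: "X x" for x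
  proof -
    define z where "z = (\<lambda>j\<in>{..<N}. trunc (x j / h))"
    have "z \<in> int_l1_ball N K" using K[OF X] by (simp add: int_l1_ball_def z_def)
    moreover have "Q (\<lambda>j. x j - h * real_of_int (z j))"
    proof (rule e[OF X])
      fix j assume "j < N"
      have "x j - h * real_of_int (trunc (x j / h)) = h * (x j / h - real_of_int (trunc (x j / h)))"
        using h by (simp add: right_diff_distrib)
      then have "\<bar>x j - h * real_of_int (trunc (x j / h))\<bar> = h * \<bar>x j / h - real_of_int (trunc (x j / h))\<bar>"
        using h by (simp add: abs_mult)
      also have "\<dots> \<le> h \<and> \<dots> \<le> \<bar>x j\<bar>"
        using h trunc_bounds(2,3)[of "x j / h"] by (auto simp: field_simps)
      finally show "\<bar>x j - h * real_of_int (z j)\<bar> \<le> h \<and> \<bar>x j - h * real_of_int (z j)\<bar> \<le> \<bar>x j\<bar>"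
        using \<open>j < N\<close> by (simp add: z_def)
    qed
    ultimately show ?thesis by (intro bexI[of _ "\<lambda>j. h * real_of_int (z j)"]) auto
  qed
  show ?thesis
  proof (intro exI[of _ ?Z] conjI allI impI)
    show "finite ?Z" "card ?Z \<le> card (int_l1_ball N K)" by (fact Z)+
  qed (rule net)
qed

text \<open>
  Maximize \<open>y powr A * exp (- c * y)\<close> over \<open>y\<close>.
\<close>

lemma powr_le_exp:
  fixes y A c :: real
  assumes "0 < y" "0 < A" "0 < c"
  shows "y powr A \<le> (A / c) powr A * exp (c * y)"
proof -
  have "ln (c * y / A) \<le> c * y / A - 1" using assms by (intro ln_le_minus_one) auto
  then have "A * ln (c * y / A) \<le> A * (c * y / A)" using assms by (intro mult_left_mono) auto
  also have "\<dots> = c * y" using assms by simp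
  finally have *: "(c * y / A) powr A \<le> exp (c * y)" using assms by (simp add: powr_def)
  have "y powr A = (A / c) powr A * (c * y / A) powr A"
    using assms by (simp add: powr_mult[symmetric])
  also have "\<dots> \<le> (A / c) powr A * exp (c * y)" by (rule mult_left_mono[OF *]) simp
  finally show ?thesis .
qed

text \<open>
  \<open>\<nu>\<close> is a real number of bits. With less than one bit the only net admitted is the zero vector, so that blocks
  with such a budget contribute nothing to the centres of a covering.
\<close>

definition net_exists :: "real \<Rightarrow> real \<Rightarrow> nat \<Rightarrow> real \<Rightarrow> real \<Rightarrow> bool" where
  "net_exists u v N \<nu> \<epsilon> \<longleftrightarrow> (\<exists>Z :: (nat \<Rightarrow> real) set. finite Z \<and> card Z \<le> 2 ^ nat \<lfloor>\<nu>\<rfloor> \<and> (\<nu> < 1 \<longrightarrow> Z = {\<lambda>_. 0}) \<and>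
     (\<forall>x. Lq_le (count_space {..<N}) u x 1 \<longrightarrow> (\<exists>z\<in>Z. Lq_le (count_space {..<N}) v (\<lambda>j. x j - z j) \<epsilon>)))"

lemma lp_ball_lq_norm:
  assumes x: "Lq_le (count_space {..<N}) u x 1" and uv: "0 \<le> u" "0 \<le> v" and N: "1 \<le> N"
  shows "Lq_le (count_space {..<N}) v x (real N powr max 0 (v - u))"
proof (cases "u \<le> v")
  case True
  have "Lq_le (count_space {..<N}) v x (1 * real N powr (v - u))"
    using True x uv N by (intro Lq_le_lower_exponent[where u=u]) (auto simp: ennreal_of_nat_eq_real_of_nat)
  then show ?thesis using True by simp
next
  case False
  then have u: "u > 0" using uv by auto
  then have s: "(\<Sum>j<N. \<bar>x j\<bar> powr (1/u)) \<le> 1" using x by (simp add: Lq_le_count_space)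
  have le1: "\<bar>x j\<bar> \<le> 1" if "j < N" for j
  proof -
    have "\<bar>x j\<bar> powr (1/u) \<le> (\<Sum>j<N. \<bar>x j\<bar> powr (1/u))" using that by (intro member_le_sum) auto
    then have "(\<bar>x j\<bar> powr (1/u)) powr u \<le> 1 powr u" using s u by (intro powr_mono2) auto
    then show ?thesis using u by (simp add: powr_powr)
  qed
  have "(\<Sum>j<N. \<bar>x j\<bar> powr (1/v)) \<le> 1" if "v > 0"
  proof -
    have "(\<Sum>j<N. \<bar>x j\<bar> powr (1/v)) \<le> (\<Sum>j<N. \<bar>x j\<bar> powr (1/u))"
      using le1 False that u by (intro sum_mono powr_mono') (auto simp: frac_le)
    then show ?thesis using s by simp
  qed
  moreover have "real N powr max 0 (v - u) = 1" using False N by simp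
  ultimately show ?thesis using le1 uv unfolding Lq_le_count_space by simp
qed

lemma net_exists_trivial:
  assumes "0 \<le> u" "0 \<le> v" "1 \<le> N" "real N powr max 0 (v - u) \<le> \<epsilon>"
  shows "net_exists u v N \<nu> \<epsilon>"
  unfolding net_exists_def
proof (rule exI[of _ "{\<lambda>_. 0}"], intro conjI allI impI)
  fix x assume "Lq_le (count_space {..<N}) u x 1"
  then have "Lq_le (count_space {..<N}) v x \<epsilon>"
    by (rule Lq_le_mono[OF lp_ball_lq_norm]) (use assms in auto)
  then show "\<exists>z\<in>{\<lambda>_. 0}. Lq_le (count_space {..<N}) v (\<lambda>j. x j - z j) \<epsilon>" by simp
qed simp_all

lemma ln_2_ge_half: "1 / 2 \<le> ln (2 :: real)"
  using ln_le_minus_one[of "1 / 2 :: real"] by (simp add: ln_div)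

lemma card_le_2_power_floor:
  assumes "real n \<le> 2 powr (3 / 4 * \<nu>)" "4 \<le> \<nu>"
  shows "n \<le> 2 ^ nat \<lfloor>\<nu>\<rfloor>"
proof -
  have "real n \<le> 2 powr (3 / 4 * \<nu>)" by fact
  also have "\<dots> \<le> 2 powr real (nat \<lfloor>\<nu>\<rfloor>)" using assms(2) by (intro powr_mono) linarith+
  also have "\<dots> = real (2 ^ nat \<lfloor>\<nu>\<rfloor>)" by (simp add: powr_realpow)
  finally show ?thesis by (simp only: of_nat_le_iff)
qed

text \<open>
  The case of many bits per coordinate, where the radius decreases exponentially in \<open>\<nu> / N\<close>.
\<close>

lemma net_exists_fine:
  assumes uv: "0 \<le> u" "u \<le> 1" "0 \<le> v" and N: "1 \<le> N" and nu: "4 \<le> \<nu>" and e: "\<epsilon> = 9 * 2 powr (- (3 / 4) * (\<nu> / N))" "\<epsilon> \<le> 1"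
  shows "net_exists u v N \<nu> (real N powr (v - u) * \<epsilon>)"
proof -
  \<comment> \<open>The step \<open>h\<close> makes the error \<open>h * N powr v\<close> the claimed one; by Hoelder the rounded vectors have
    \<open>l_1\<close>-norm at most \<open>N powr (1 - u) / h = N / \<epsilon>\<close>.\<close>
  define h where "h = real N powr (- u) * \<epsilon>"
  have e0: "\<epsilon> > 0" using e by simp
  have h: "h > 0" using N e by (simp add: h_def)
  define K where "K = real N / \<epsilon>"
  let ?X = "\<lambda>x. Lq_le (count_space {..<N}) u x 1"
  let ?Q = "\<lambda>y. Lq_le (count_space {..<N}) v y (real N powr (v - u) * \<epsilon>)"
  have "\<exists>Z :: (nat \<Rightarrow> real) set. finite Z \<and> card Z \<le> card (int_l1_ball N K) \<and>
    (\<forall>x. ?X x \<longrightarrow> (\<exists>z\<in>Z. ?Q (\<lambda>j. x j - z j)))"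
  proof (rule rounding_net[OF h, of ?X N K ?Q])
    fix x assume x: "?X x"
    have "Lq_le (count_space {..<N}) 1 x (1 * real N powr (1 - u))"
      using x uv N by (intro Lq_le_lower_exponent[where u=u]) (auto simp: ennreal_of_nat_eq_real_of_nat)
    then have *: "(\<Sum>j<N. \<bar>x j\<bar>) \<le> real N powr (1 - u)"
      by (simp add: Lq_le_count_space)
    have "(\<Sum>j<N. \<bar>real_of_int (trunc (x j / h))\<bar>) \<le> (\<Sum>j<N. \<bar>x j / h\<bar>)"
      by (intro sum_mono trunc_bounds)
    also have "\<dots> = (\<Sum>j<N. \<bar>x j\<bar>) / h" using h by (simp add: sum_divide_distrib)
    also have "\<dots> \<le> real N powr (1 - u) / h" using * h by (intro divide_right_mono) auto
    also have "\<dots> = K" using N by (simp add: h_def K_def powr_diff powr_minus field_simps)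
    finally show "(\<Sum>j<N. \<bar>real_of_int (trunc (x j / h))\<bar>) \<le> K" .
  next
    fix x y :: "nat \<Rightarrow> real" assume y: "\<And>j. j < N \<Longrightarrow> \<bar>y j\<bar> \<le> h \<and> \<bar>y j\<bar> \<le> \<bar>x j\<bar>"
    have "Lq_le (count_space {..<N}) v y (h * real N powr (v - 0))"
      using y uv N h by (intro Lq_le_lower_exponent[where u=0]) (auto simp: Lq_le_count_space ennreal_of_nat_eq_real_of_nat)
    then show "?Q y" using N by (simp add: h_def powr_diff powr_minus field_simps)
  qed
  then obtain Z :: "(nat \<Rightarrow> real) set" where Z: "finite Z" "card Z \<le> card (int_l1_ball N K)"
    "\<And>x. ?X x \<Longrightarrow> \<exists>z\<in>Z. ?Q (\<lambda>j. x j - z j)"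
    by (elim exE conjE) simp
  \<comment> \<open>This \<open>x\<close> turns the counting bound into \<open>exp 1 ^ N * ((2 + \<epsilon>) / \<epsilon>) ^ N \<le> (9 / \<epsilon>) ^ N\<close>.\<close>
  define x where "x = 1 / (1 + \<epsilon>)"
  have x: "0 < x" "x < 1" using e0 by (auto simp: x_def)
  have xK: "x powr (- K) \<le> 3 ^ N"
  proof -
    have "x powr (- K) = (1 + \<epsilon>) powr (real N / \<epsilon>)"
      using e0 by (simp add: x_def K_def powr_minus powr_divide)
    also have "\<dots> \<le> exp \<epsilon> powr (real N / \<epsilon>)"
      using e0 by (intro powr_mono2) auto
    also have "\<dots> = exp 1 ^ N" using e0 by (simp add: powr_def exp_of_nat_mult[symmetric])
    also have "exp 1 ^ N \<le> (3::real) ^ N" using exp_le by (intro power_mono) auto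
    finally show ?thesis .
  qed
  have "1 + x = (2 + \<epsilon>) / (1 + \<epsilon>)" "1 - x = \<epsilon> / (1 + \<epsilon>)"
    using e0 by (simp_all add: x_def field_simps)
  then have "(1 + x) / (1 - x) = (2 + \<epsilon>) / \<epsilon>" using e0 by simp
  also have "\<dots> \<le> 3 / \<epsilon>" using e e0 by (intro divide_right_mono) auto
  finally have x3: "((1 + x) / (1 - x)) ^ N \<le> (3 / \<epsilon>) ^ N" using x by (intro power_mono) auto
  have "real (card Z) \<le> x powr (- K) * ((1 + x) / (1 - x)) ^ N"
    using Z(2) card_int_l1_ball(2)[OF x, of N K] by linarith
  also have "\<dots> \<le> 3 ^ N * (3 / \<epsilon>) ^ N" using xK x3 x by (intro mult_mono) auto
  also have "\<dots> = (9 / \<epsilon>) ^ N" by (simp add: power_mult_distrib[symmetric])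
  also have "9 / \<epsilon> = 2 powr ((3 / 4) * (\<nu> / N))" by (simp add: e powr_minus divide_simps)
  also have "\<dots> ^ N = 2 powr (3 / 4 * \<nu>)" using N by (simp add: powr_realpow[symmetric] powr_powr)
  finally have "real (card Z) \<le> 2 powr (3 / 4 * \<nu>)" .
  then have "card Z \<le> 2 ^ nat \<lfloor>\<nu>\<rfloor>" using nu by (rule card_le_2_power_floor)
  then show ?thesis unfolding net_exists_def using Z nu by (intro exI[of _ Z]) auto
qed

text \<open>
  The case of few bits per coordinate and \<open>v < u\<close>: vectors of the unit ball have few large coordinates, and
  rounding with a large step sets the others to zero. The exponent \<open>\<eta>\<close> absorbs a logarithm of \<open>N / \<nu>\<close>.
\<close>

lemma net_exists_coarse:
  assumes uv: "0 \<le> v" "v < u" "u \<le> 1" and N: "1 \<le> N" and nu: "4 \<le> \<nu>" and coarse: "\<nu> / N \<le> 16 / 3"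
    and eta: "0 < \<eta>" and K: "K = \<nu> * (\<eta> / 4) * (64 * (N / \<nu>)) powr (- \<eta>)"
  shows "net_exists u v N \<nu> (K powr (v - u))"
proof -
  \<comment> \<open>With \<open>h = K powr (- u)\<close> a vector of the unit ball has \<open>\<Sum>j. \<bar>x j / h\<bar> powr (1/u) \<le> K\<close>. This also bounds the
    \<open>l_1\<close>-norm of the rounded vector, since \<open>\<bar>z\<bar> \<le> \<bar>z\<bar> powr (1/u)\<close> for integers \<open>z\<close>.\<close>
  define h where "h = K powr (- u)"
  have K0: "K > 0" using N nu eta unfolding K by (intro mult_pos_pos) auto
  have h: "h > 0" using K0 by (simp add: h_def)
  let ?X = "\<lambda>x. Lq_le (count_space {..<N}) u x 1"
  let ?Q = "\<lambda>y. Lq_le (count_space {..<N}) v y (K powr (v - u))"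
  have X: "(\<Sum>j<N. \<bar>x j\<bar> powr (1/u)) \<le> 1" if "?X x" for x using that uv by (simp add: Lq_le_count_space)
  have "\<exists>Z :: (nat \<Rightarrow> real) set. finite Z \<and> card Z \<le> card (int_l1_ball N K) \<and>
    (\<forall>x. ?X x \<longrightarrow> (\<exists>z\<in>Z. ?Q (\<lambda>j. x j - z j)))"
  proof (rule rounding_net[OF h, of ?X N K ?Q])
    fix x assume x: "?X x"
    have "(\<Sum>j<N. \<bar>real_of_int (trunc (x j / h))\<bar>) \<le> (\<Sum>j<N. \<bar>x j / h\<bar> powr (1/u))"
    proof (intro sum_mono)
      fix j
      let ?z = "\<bar>real_of_int (trunc (x j / h))\<bar>"
      have "?z \<le> ?z powr (1/u)"
      proof (cases "trunc (x j / h) = 0")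
        case False
        then have "?z \<ge> 1" by linarith
        then show ?thesis using powr_mono[of 1 "1/u" ?z] uv by auto
      qed auto
      also have "\<dots> \<le> \<bar>x j / h\<bar> powr (1/u)" using uv trunc_bounds(1)[of "x j / h"] by (intro powr_mono2) auto
      finally show "?z \<le> \<bar>x j / h\<bar> powr (1/u)" .
    qed
    also have "\<dots> = (\<Sum>j<N. \<bar>x j\<bar> powr (1/u)) / h powr (1/u)" using h by (simp add: sum_divide_distrib powr_divide)
    also have "\<dots> \<le> 1 / h powr (1/u)" using X[OF x] by (intro divide_right_mono) auto
    also have "h powr (1/u) = K powr (- 1)" unfolding h_def powr_powr using uv by simp
    also have "1 / K powr (- 1) = K" using K0 by (simp add: powr_minus divide_simps)
    finally show "(\<Sum>j<N. \<bar>real_of_int (trunc (x j / h))\<bar>) \<le> K" .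
  next
    fix x y :: "nat \<Rightarrow> real" assume x: "?X x" and y: "\<And>j. j < N \<Longrightarrow> \<bar>y j\<bar> \<le> h \<and> \<bar>y j\<bar> \<le> \<bar>x j\<bar>"
    show "?Q y"
    proof (cases "v = 0")
      case True
      then show ?thesis using y by (simp add: Lq_le_count_space h_def)
    next
      case False
      then have v: "v > 0" using uv by simp
      have "(\<Sum>j<N. \<bar>y j\<bar> powr (1/v)) \<le> (\<Sum>j<N. h powr (1/v - 1/u) * \<bar>x j\<bar> powr (1/u))"
      proof (intro sum_mono)
        fix j assume j: "j \<in> {..<N}"
        \<comment> \<open>Interpolation between the sup norm \<open>h\<close> and the norm with exponent \<open>u\<close>.\<close>
        have "\<bar>y j\<bar> powr (1/v) = \<bar>y j\<bar> powr (1/v - 1/u) * \<bar>y j\<bar> powr (1/u)"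
          by (simp add: powr_add[symmetric])
        also have "\<dots> \<le> h powr (1/v - 1/u) * \<bar>x j\<bar> powr (1/u)"
          using y[of j] j uv v by (intro mult_mono powr_mono2) (auto simp: frac_le)
        finally show "\<bar>y j\<bar> powr (1/v) \<le> h powr (1/v - 1/u) * \<bar>x j\<bar> powr (1/u)" .
      qed
      also have "\<dots> \<le> h powr (1/v - 1/u) * 1"
        unfolding sum_distrib_left[symmetric] using X[OF x] by (intro mult_left_mono) auto
      also have "\<dots> = (K powr (v - u)) powr (1/v)"
      proof -
        have "(- u) * (1/v - 1/u) = (v - u) * (1/v)" using v uv by (simp add: field_simps)
        then show ?thesis by (simp only: h_def powr_powr mult_1_right)
      qed
      finally show ?thesis using False by (simp add: Lq_le_count_space)
    qed
  qed
  then obtain Z :: "(nat \<Rightarrow> real) set" where Z: "finite Z" "card Z \<le> card (int_l1_ball N K)"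
    "\<And>x. ?X x \<Longrightarrow> \<exists>z\<in>Z. ?Q (\<lambda>j. x j - z j)"
    by (elim exE conjE) simp
  define \<beta> where "\<beta> = N / \<nu>"
  have be: "\<beta> \<ge> 3 / 16" using coarse N nu by (simp add: \<beta>_def field_simps)
  \<comment> \<open>The value \<open>x = \<nu> / (64 N)\<close> balances the two factors of the counting bound: \<open>2 powr (\<nu> / 2)\<close>
    for \<open>x powr (- K)\<close> and \<open>2 powr (\<nu> / 4)\<close> for the power of \<open>(1 + x) / (1 - x)\<close>.\<close>
  define x where "x = 1 / (64 * \<beta>)"
  have "1 / (64 * \<beta>) \<le> 1 / (64 * (3/16))" using be by (intro divide_left_mono) auto
  then have x: "0 < x" "x \<le> 1/12" using be by (auto simp: x_def)
  have xK: "x powr (- K) \<le> 2 powr (\<nu> / 2)"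
  proof -
    have "ln (64 * \<beta>) \<le> (64 * \<beta>) powr \<eta> / \<eta>" using be eta by (intro ln_powr_bound) auto
    then have "K * ln (64 * \<beta>) \<le> K * ((64 * \<beta>) powr \<eta> / \<eta>)" using K0 by (intro mult_left_mono) auto
    also have "\<dots> = \<nu> / 4" using eta be by (simp add: K \<beta>_def[symmetric] powr_minus)
    also have "\<dots> \<le> \<nu> / 2 * ln 2"
      using mult_left_mono[OF ln_2_ge_half, of "\<nu> / 2"] nu by simp
    finally have "K * ln (64 * \<beta>) \<le> \<nu> / 2 * ln 2" .
    moreover have "ln x = - ln (64 * \<beta>)" using be by (simp add: x_def ln_div)
    ultimately show ?thesis using x by (simp add: powr_def)
  qed
  have xN: "((1 + x) / (1 - x)) ^ N \<le> 2 powr (\<nu> / 4)"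
  proof -
    have "((1 + x) / (1 - x)) ^ N \<le> exp (3 * x) ^ N"
    proof (intro power_mono)
      have "3 * x * x \<le> 3 * x * (1/12)" using x by (intro mult_left_mono) auto
      then have "(1 + x) / (1 - x) \<le> 1 + 3 * x" using x by (simp add: divide_le_eq algebra_simps)
      also have "\<dots> \<le> exp (3 * x)" by simp
      finally show "(1 + x) / (1 - x) \<le> exp (3 * x)" .
    qed (use x in auto)
    also have "real N * (3 * x) = 3 / 64 * \<nu>" using N nu by (simp add: x_def \<beta>_def)
    then have "exp (3 * x) ^ N = exp (3 / 64 * \<nu>)" by (metis exp_of_nat_mult)
    also have "\<dots> \<le> exp (\<nu> / 4 * ln 2)"
      using mult_left_mono[OF ln_2_ge_half, of "\<nu> / 4"] nu by simp
    also have "\<dots> = 2 powr (\<nu> / 4)" by (simp add: powr_def)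
    finally show ?thesis .
  qed
  have "real (card Z) \<le> x powr (- K) * ((1 + x) / (1 - x)) ^ N"
    using Z(2) card_int_l1_ball(2)[of x N K] x by linarith
  also have "\<dots> \<le> 2 powr (\<nu> / 2) * 2 powr (\<nu> / 4)" using xK xN x by (intro mult_mono) auto
  also have "\<dots> = 2 powr (3 / 4 * \<nu>)" by (simp add: powr_add[symmetric])
  finally have "real (card Z) \<le> 2 powr (3 / 4 * \<nu>)" .
  then have "card Z \<le> 2 ^ nat \<lfloor>\<nu>\<rfloor>" using nu by (rule card_le_2_power_floor)
  then show ?thesis unfolding net_exists_def using Z nu by (intro exI[of _ Z]) auto
qed

lemma net_exists_mono:
  assumes "net_exists u v N \<nu> \<epsilon>" "\<epsilon> \<le> \<epsilon>'" "0 \<le> \<epsilon>" "0 \<le> v"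
  shows "net_exists u v N \<nu> \<epsilon>'"
proof -
  obtain Z where "finite Z" "card Z \<le> 2 ^ nat \<lfloor>\<nu>\<rfloor>" "\<nu> < 1 \<longrightarrow> Z = {\<lambda>_. 0}"
    and Z: "\<And>x. Lq_le (count_space {..<N}) u x 1 \<Longrightarrow> \<exists>z\<in>Z. Lq_le (count_space {..<N}) v (\<lambda>j. x j - z j) \<epsilon>"
    using assms(1) unfolding net_exists_def by (elim exE conjE) simp
  moreover have "\<exists>z\<in>Z. Lq_le (count_space {..<N}) v (\<lambda>j. x j - z j) \<epsilon>'"
    if "Lq_le (count_space {..<N}) u x 1" for x
    using Z[OF that] Lq_le_mono[OF _ assms(2,4,3)] by blast
  ultimately show ?thesis unfolding net_exists_def by (intro exI[of _ Z]) auto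
qed

text \<open>
  The decrease of the radius in \<open>\<nu>\<close>, at most polynomial for few bits and exponential for many, is weakened to one power
  of \<open>N / \<nu>\<close>, which leaves the choice of a suitable exponent \<open>A\<close> to the application.
\<close>

lemma lp_ball_nets:
  assumes uv: "0 \<le> u" "u \<le> 1" "0 \<le> v" "v \<le> 1" and A: "max 0 (u - v) < A"
  shows "\<exists>C>0. \<forall>N\<ge>1. \<forall>\<nu>>0. net_exists u v N \<nu> (C * real N powr (v - u) * (N / \<nu>) powr A)"
proof -
  define \<eta> where "\<eta> = (A - (u - v)) / (u - v)"
  define C1 where "C1 = (16 / 3) powr A"
  define C2 where "C2 = 9 * (A / (3 / 4 * ln 2)) powr A"
  define C3 where "C3 = (\<eta> / 4) powr (v - u) * 64 powr (A - (u - v))"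
  define C where "C = C1 + C2 + C3"
  have C: "C1 \<ge> 1" "C2 \<ge> 0" "C3 \<ge> 0" "C \<ge> C1" "C \<ge> C2" "C \<ge> C3" "C > 0"
    using A by (auto simp: C1_def C2_def C3_def C_def intro!: ge_one_powr_ge_zero add_pos_nonneg)
  show ?thesis
  proof (intro exI[of _ C] conjI allI impI)
    fix N :: nat and \<nu> :: real assume N: "1 \<le> N" and nu: "0 < \<nu>"
    define \<beta> where "\<beta> = N / \<nu>"
    have be: "\<beta> > 0" using N nu by (simp add: \<beta>_def)
    let ?R = "\<lambda>C. C * real N powr (v - u) * \<beta> powr A"
    have mono: "?R C' \<le> ?R C" if "C' \<le> C" for C' using that by (intro mult_right_mono) auto
    have scale: "C1 * \<beta> powr A = (16/3 * \<beta>) powr A"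
      using be by (simp only: C1_def powr_mult)
    \<comment> \<open>Fewer than four bits, or a coarse net with \<open>u \<le> v\<close>: the single point 0 suffices. For
      \<open>N / \<nu> \<le> 3/16\<close> the radius \<open>9 * 2 powr (- 3/4 * \<nu> / N)\<close> of the fine net is at most \<open>9/16\<close>.\<close>
    consider (triv) "\<nu> < 4" | (triv2) "u \<le> v" "\<beta> \<ge> 3/16" | (fine) "\<nu> \<ge> 4" "\<beta> \<le> 3/16" | (coarse) "\<nu> \<ge> 4" "\<beta> \<ge> 3/16" "v < u"
      by linarith
    then show "net_exists u v N \<nu> (?R C)"
    proof cases
      case triv
      have "real N powr max 0 (v - u) \<le> ?R C1"
      proof (cases "u \<le> v")
        case True
        have "1 \<le> (16/3 * \<beta>) powr A" using A N nu triv by (intro ge_one_powr_ge_zero) (auto simp: \<beta>_def field_simps)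
        then have "real N powr (v - u) * 1 \<le> real N powr (v - u) * (C1 * \<beta> powr A)"
          using scale by (intro mult_left_mono) auto
        then show ?thesis using True be by (simp add: mult_ac)
      next
        case False
        have "real N powr 0 \<le> real N powr (A - (u - v))" using A N by (intro powr_mono) auto
        also have "\<dots> = real N powr (v - u) * real N powr A" using N by (simp add: powr_add[symmetric] algebra_simps)
        also have "\<dots> \<le> real N powr (v - u) * (C1 * \<beta> powr A)"
          unfolding scale using A N nu triv by (intro mult_left_mono powr_mono2) (auto simp: \<beta>_def field_simps)
        finally show ?thesis using False be N by (simp add: mult_ac)
      qed
      from net_exists_trivial[OF uv(1) uv(3) N order_trans[OF this mono[OF C(4)]]] show ?thesis .
    next
      case triv2
      have "1 \<le> (16/3 * \<beta>) powr A" using A triv2 by (intro ge_one_powr_ge_zero) auto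
      then have "real N powr (v - u) * 1 \<le> real N powr (v - u) * (C1 * \<beta> powr A)"
        using scale by (intro mult_left_mono) auto
      then have "real N powr max 0 (v - u) \<le> ?R C1" using triv2 be by (simp add: mult_ac)
      from net_exists_trivial[OF uv(1) uv(3) N order_trans[OF this mono[OF C(4)]]] show ?thesis .
    next
      case fine
      define \<epsilon> where "\<epsilon> = 9 * 2 powr (- (3 / 4) * (\<nu> / N))"
      have nb: "\<nu> / N = 1 / \<beta>" by (simp add: \<beta>_def)
      have "\<nu> / N \<ge> 16/3" using fine be unfolding nb by (simp add: field_simps)
      then have "- (3 / 4) * (\<nu> / N) \<le> - 4" by linarith
      then have "2 powr (- (3 / 4) * (\<nu> / N)) \<le> 2 powr (- 4 :: real)" by (intro powr_mono) auto
      also have "\<dots> = 1 / 16" by (simp add: powr_minus)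
      finally have e1: "\<epsilon> \<le> 1" by (simp add: \<epsilon>_def)
      have "(1/\<beta>) powr A \<le> (A / (3 / 4 * ln 2)) powr A * exp (3 / 4 * ln 2 * (1 / \<beta>))"
        using be A by (intro powr_le_exp) auto
      then have "\<epsilon> \<le> C2 * \<beta> powr A"
        using be by (simp add: \<epsilon>_def C2_def nb powr_def[of 2] powr_divide exp_minus field_simps)
      then have "real N powr (v - u) * \<epsilon> \<le> real N powr (v - u) * (C2 * \<beta> powr A)" by (intro mult_left_mono) auto
      also have "\<dots> \<le> ?R C" using mono[OF C(5)] by (simp add: mult_ac)
      finally show ?thesis
        using net_exists_fine[OF uv(1-3) N fine(1) \<epsilon>_def e1] uv
        by (elim net_exists_mono) (auto simp: \<epsilon>_def)
    next
      case coarse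
      have eta: "\<eta> > 0" using coarse A by (simp add: \<eta>_def)
      define K where "K = \<nu> * (\<eta> / 4) * (64 * (N / \<nu>)) powr (- \<eta>)"
      have "- \<eta> * (v - u) = \<eta> * (u - v)" by (simp add: algebra_simps)
      also have "\<dots> = A - (u - v)" using coarse by (simp add: \<eta>_def)
      finally have "K powr (v - u) = \<nu> powr (v - u) * (\<eta> / 4) powr (v - u) * (64 * \<beta>) powr (A - (u - v))"
        unfolding K_def \<beta>_def[symmetric] by (simp only: powr_mult powr_powr)
      also have "\<dots> = C3 * (\<nu> powr (v - u) * \<beta> powr (v - u)) * \<beta> powr A"
        by (simp add: C3_def powr_mult powr_add[symmetric] algebra_simps)
      also have "\<nu> powr (v - u) * \<beta> powr (v - u) = real N powr (v - u)"
        using nu by (simp add: powr_mult[symmetric] \<beta>_def)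
      finally have "K powr (v - u) \<le> ?R C" using mono[OF C(6)] by simp
      moreover have "net_exists u v N \<nu> (K powr (v - u))"
        using coarse be N by (intro net_exists_coarse[OF _ _ _ _ _ _ eta K_def] uv) (auto simp: \<beta>_def field_simps)
      ultimately show ?thesis using uv by (elim net_exists_mono) auto
    qed
  qed (use C in auto)
qed

text \<open>
  One constant for the two exponents that are used above and below the critical level.
\<close>

lemma net_exponents:
  fixes u v \<alpha>\<^sub>0 lam :: real
  assumes uv: "0 \<le> u" "u \<le> 1" "0 \<le> v" "v \<le> 1" and a0: "max 0 (u - v) < \<alpha>\<^sub>0" and lam: "0 < lam"
  obtains A1 C where "max 0 (u - v) < A1" "A1 < \<alpha>\<^sub>0" "0 < C"
    "\<And>N \<nu>. 1 \<le> N \<Longrightarrow> 0 < \<nu> \<Longrightarrow> net_exists u v N \<nu> (C * real N powr (v - u) * (N / \<nu>) powr A1)"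
    "\<And>N \<nu>. 1 \<le> N \<Longrightarrow> 0 < \<nu> \<Longrightarrow> net_exists u v N \<nu> (C * real N powr (v - u) * (N / \<nu>) powr (2 * (\<alpha>\<^sub>0 + lam) + 3))"
proof -
  define A1 where "A1 = (max 0 (u - v) + \<alpha>\<^sub>0) / 2"
  define A2 where "A2 = 2 * (\<alpha>\<^sub>0 + lam) + 3"
  have A: "max 0 (u - v) < A1" "A1 < \<alpha>\<^sub>0" using a0 by (simp_all add: A1_def)
  have A2: "max 0 (u - v) < A2" using a0 lam uv by (simp add: A2_def)
  obtain C1 where C1: "0 < C1" "\<And>N \<nu>. 1 \<le> N \<Longrightarrow> 0 < \<nu> \<Longrightarrow> net_exists u v N \<nu> (C1 * real N powr (v - u) * (N / \<nu>) powr A1)"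
    using lp_ball_nets[OF uv A(1)] by blast
  obtain C2 where C2: "0 < C2" "\<And>N \<nu>. 1 \<le> N \<Longrightarrow> 0 < \<nu> \<Longrightarrow> net_exists u v N \<nu> (C2 * real N powr (v - u) * (N / \<nu>) powr A2)"
    using lp_ball_nets[OF uv A2] by blast
  have mono: "net_exists u v N \<nu> (max C1 C2 * real N powr (v - u) * (N / \<nu>) powr A')"
    if "net_exists u v N \<nu> (C' * real N powr (v - u) * (N / \<nu>) powr A')" "C' \<le> max C1 C2" "0 < C'" for N \<nu> C' A'
    using that uv by (intro net_exists_mono[OF that(1)] mult_right_mono) auto
  show ?thesis
  proof (rule that[of A1 "max C1 C2"])
    show "0 < max C1 C2" using C1 by simp
    fix N :: nat and \<nu> :: real assume N: "1 \<le> N" "0 < \<nu>"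
    show "net_exists u v N \<nu> (max C1 C2 * real N powr (v - u) * (N / \<nu>) powr A1)"
      by (rule mono[OF C1(2)[OF N] _ C1(1)]) simp
    show "net_exists u v N \<nu> (max C1 C2 * real N powr (v - u) * (N / \<nu>) powr (2 * (\<alpha>\<^sub>0 + lam) + 3))"
      unfolding A2_def[symmetric] by (rule mono[OF C2(2)[OF N] _ C2(1)]) simp
  qed (rule A)+
qed


section \<open>The Riemann-Liouville kernel\<close>

lemma powr_kernel_integral:
  fixes a c t :: real
  assumes a: "0 < a" and ct: "c \<le> t"
  shows "set_integrable lebesgue {c..t} (\<lambda>s. (t - s) powr (a - 1))"
    "(LINT s:{c..t}|lebesgue. (t - s) powr (a - 1)) = (t - c) powr a / a"
proof -
  have "((\<lambda>s. (t - s) powr (a - 1)) has_integral (- ((t - t) powr a / a) - (- ((t - c) powr a / a)))) {c..t}"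
  proof (rule fundamental_theorem_of_calculus_interior[OF ct])
    show "continuous_on {c..t} (\<lambda>s. - ((t - s) powr a / a))"
      using a by (intro continuous_intros continuous_on_powr') auto
    fix s assume "s \<in> {c<..<t}"
    then have "((\<lambda>s. - ((t - s) powr a / a)) has_real_derivative (t - s) powr (a - 1)) (at s)"
      using a by (auto intro!: derivative_eq_intros simp: powr_diff field_simps)
    then show "((\<lambda>s. - ((t - s) powr a / a)) has_vector_derivative (t - s) powr (a - 1)) (at s)"
      by (simp add: has_real_derivative_iff_has_vector_derivative)
  qed
  then have *: "((\<lambda>s. (t - s) powr (a - 1)) has_integral ((t - c) powr a / a)) {c..t}" by simp
  then show 1: "set_integrable lebesgue {c..t} (\<lambda>s. (t - s) powr (a - 1))"
    by (subst absolutely_integrable_on_iff_nonneg) (auto simp: has_integral_iff)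
  show "(LINT s:{c..t}|lebesgue. (t - s) powr (a - 1)) = (t - c) powr a / a"
    using set_lebesgue_integral_eq_integral(2)[OF 1] * by (simp add: has_integral_iff)
qed

lemma RL_op_set_integral:
  "RL_op \<alpha> f t = 1 / Gamma (\<alpha> t) * (LINT s:{0..t}|lebesgue. (t - s) powr (\<alpha> t - 1) * f s)"
  unfolding RL_op_def set_lebesgue_integral_def by (subst integral_restrict_space) auto

lemma RL_op_indicator:
  assumes "t \<le> 1"
  shows "RL_op \<alpha> f t = RL_op \<alpha> (\<lambda>s. indicator {0..1} s * f s) t"
  unfolding RL_op_def using assms by (intro arg_cong2[where f="(*)"] refl Bochner_Integration.integral_cong) auto

lemma kernel_mult_integrable:
  fixes a t B :: real and f :: "real \<Rightarrow> real"
  assumes a: "0 < a" and f: "f \<in> borel_measurable lebesgue" and B: "\<And>s. \<bar>f s\<bar> \<le> B"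
  shows "set_integrable lebesgue {0..t} (\<lambda>s. (t - s) powr (a - 1) * f s)"
proof (cases "0 \<le> t")
  case True
  have "set_integrable lebesgue {0..t} (\<lambda>s. B * (t - s) powr (a - 1))"
    using powr_kernel_integral(1)[OF a, of 0 t] True by simp
  moreover have "set_borel_measurable lebesgue {0..t} (\<lambda>s. (t - s) powr (a - 1) * f s)"
    using powr_kernel_integral(1)[OF a, of 0 t] True f
    unfolding set_borel_measurable_def set_integrable_def
    by (auto simp: mult.assoc[symmetric] intro: borel_measurable_times dest: borel_measurable_integrable)
  ultimately show ?thesis
  proof (rule set_integrable_bound, intro AE_I2 impI)
    fix s
    have "\<bar>f s\<bar> \<le> \<bar>B\<bar>" using B[of s] by linarith
    then have "\<bar>f s\<bar> * (t - s) powr (a - 1) \<le> \<bar>B\<bar> * (t - s) powr (a - 1)" by (rule mult_right_mono) simp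
    then show "norm ((t - s) powr (a - 1) * f s) \<le> norm (B * (t - s) powr (a - 1))"
      by (simp add: abs_mult mult.commute)
  qed
qed (simp add: set_integrable_def)

text \<open>
  If two functions agree up to \<open>c\<close> and differ by the constant \<open>d\<close> afterwards, their images differ by
  a multiple of a power of \<open>t - c\<close>. This computes the diagonal of the triangular map of the lower bound.
\<close>

lemma RL_op_step_difference:
  fixes \<alpha> f g :: "real \<Rightarrow> real"
  assumes a: "0 < \<alpha> t" and ct: "0 \<le> c" "c \<le> t"
    and m: "f \<in> borel_measurable lebesgue" "g \<in> borel_measurable lebesgue"
    and B: "\<And>s. \<bar>f s\<bar> \<le> B" "\<And>s. \<bar>g s\<bar> \<le> B"
    and eq: "\<And>s. 0 \<le> s \<Longrightarrow> s < c \<Longrightarrow> f s = g s" and d: "\<And>s. c \<le> s \<Longrightarrow> s \<le> t \<Longrightarrow> f s - g s = d"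
  shows "RL_op \<alpha> f t - RL_op \<alpha> g t = d * ((t - c) powr \<alpha> t / (\<alpha> t * Gamma (\<alpha> t)))"
proof -
  let ?K = "\<lambda>s. (t - s) powr (\<alpha> t - 1)"
  have "RL_op \<alpha> f t - RL_op \<alpha> g t
      = 1 / Gamma (\<alpha> t) * ((LINT s:{0..t}|lebesgue. ?K s * f s) - (LINT s:{0..t}|lebesgue. ?K s * g s))"
    by (simp add: RL_op_set_integral right_diff_distrib)
  also have "(LINT s:{0..t}|lebesgue. ?K s * f s) - (LINT s:{0..t}|lebesgue. ?K s * g s)
      = (LINT s:{0..t}|lebesgue. ?K s * f s - ?K s * g s)"
    by (rule set_integral_diff(2)[symmetric]; rule kernel_mult_integrable[OF a _ B(1)] kernel_mult_integrable[OF a _ B(2)]; rule m)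
  also have "\<dots> = (LINT s:{c..t}|lebesgue. d * ?K s)"
    unfolding set_lebesgue_integral_def
  proof (intro Bochner_Integration.integral_cong refl)
    fix s
    consider "s < 0" | "0 \<le> s" "s < c" | "c \<le> s" by linarith
    then show "indicat_real {0..t} s *\<^sub>R (?K s * f s - ?K s * g s) = indicat_real {c..t} s *\<^sub>R (d * ?K s)"
    proof cases
      case 3
      then show ?thesis using ct d[of s] by (auto simp: indicator_def simp flip: right_diff_distrib)
    qed (use ct eq in \<open>auto simp: indicator_def\<close>)
  qed
  also have "\<dots> = d * ((t - c) powr \<alpha> t / \<alpha> t)"
    using powr_kernel_integral(2)[OF a ct(2)] by simp
  finally show ?thesis using a by (simp add: field_simps)
qed

lemma Gamma_bounds_on_interval:
  fixes a b :: real
  assumes "0 < a"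
  obtains L U where "0 < L" "0 < U" "\<And>x. x \<in> {a..b} \<Longrightarrow> L \<le> Gamma x" "\<And>x. x \<in> {a..b} \<Longrightarrow> Gamma x \<le> U"
proof (cases "a \<le> b")
  case True
  have cont: "continuous_on {a..b} (Gamma :: real \<Rightarrow> real)"
    using assms by (intro continuous_on_Gamma continuous_on_id) (auto elim!: nonpos_Ints_cases)
  obtain x where x: "x \<in> {a..b}" "\<And>y. y \<in> {a..b} \<Longrightarrow> Gamma x \<le> Gamma y"
    using continuous_attains_inf[OF compact_Icc _ cont] True by auto
  obtain x' where x': "x' \<in> {a..b}" "\<And>y. y \<in> {a..b} \<Longrightarrow> Gamma y \<le> Gamma x'"
    using continuous_attains_sup[OF compact_Icc _ cont] True by auto
  show ?thesis
    using assms x x' by (intro that[of "Gamma x" "Gamma x'"]) (auto intro!: Gamma_real_pos)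
next
  case False
  then show ?thesis by (intro that[of 1 1]) auto
qed


section \<open>The lower bound\<close>

text \<open>
  A substitute for volume comparison. The map \<open>Y\<close> is triangular in the sense that its \<open>l\<close>-th coordinate separates
  points that agree in all coordinates before \<open>l\<close> and differ in the \<open>l\<close>-th one.
\<close>

lemma card_triangular_near_le:
  fixes Y :: "(nat \<Rightarrow> nat) \<Rightarrow> nat \<Rightarrow> real"
  assumes X: "finite X" "X \<subseteq> extensional {..<n}" and d: "0 < d"
    and tri: "\<And>x x' l. x \<in> X \<Longrightarrow> x' \<in> X \<Longrightarrow> l < n \<Longrightarrow> (\<And>k. k < l \<Longrightarrow> x k = x' k) \<Longrightarrow> x l \<noteq> x' l
      \<Longrightarrow> d \<le> \<bar>Y x l - Y x' l\<bar>"
  shows "card {x \<in> X. (\<Sum>l<n. \<bar>Y x l - z l\<bar>) \<le> real n * d} \<le> 12 ^ n"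
proof -
  define S where "S = {x \<in> X. (\<Sum>l<n. \<bar>Y x l - z l\<bar>) \<le> real n * d}"
  \<comment> \<open>Dividing by the diagonal bound \<open>d\<close> and taking integer parts codes \<open>x\<close> by an integer vector. The
    code is injective: at the first coordinate where two points differ, their images differ by at
    least \<open>d\<close>.\<close>
  define k where "k x = (\<lambda>l\<in>{..<n}. \<lfloor>(Y x l - z l) / d\<rfloor>)" for x
  have sub: "k ` S \<subseteq> int_l1_ball n (2 * real n)"
  proof safe
    fix x assume x: "x \<in> S"
    have "real_of_int (\<Sum>l<n. \<bar>k x l\<bar>) \<le> (\<Sum>l<n. \<bar>Y x l - z l\<bar> / d + 1)"
      unfolding of_int_sum
    proof (intro sum_mono)
      fix l assume "l \<in> {..<n}"
      moreover have "\<bar>real_of_int \<lfloor>y\<rfloor>\<bar> \<le> \<bar>y\<bar> + 1" for y :: real by linarith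
      ultimately have "real_of_int \<bar>k x l\<bar> \<le> \<bar>(Y x l - z l) / d\<bar> + 1" by (simp add: k_def del: abs_divide)
      then show "real_of_int \<bar>k x l\<bar> \<le> \<bar>Y x l - z l\<bar> / d + 1" using d by simp
    qed
    also have "\<dots> = (\<Sum>l<n. \<bar>Y x l - z l\<bar>) / d + real n" by (simp add: sum.distrib sum_divide_distrib)
    also have "\<dots> \<le> real n * d / d + real n" using x d by (intro add_right_mono divide_right_mono) (auto simp: S_def)
    finally show "k x \<in> int_l1_ball n (2 * real n)" using d by (simp add: int_l1_ball_def k_def)
  qed
  have inj: "inj_on k S"
  proof (rule inj_onI, rule ccontr)
    fix x x' assume x: "x \<in> S" "x' \<in> S" "k x = k x'" "x \<noteq> x'"
    have "\<exists>l. l < n \<and> x l \<noteq> x' l"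
    proof (rule ccontr)
      assume "\<not> ?thesis"
      then have "x = x'" using x X(2) by (intro extensionalityI[of x "{..<n}" x']) (auto simp: S_def)
      then show False using x by simp
    qed
    then obtain l where l: "l < n \<and> x l \<noteq> x' l" "\<And>k. k < l \<Longrightarrow> \<not> (k < n \<and> x k \<noteq> x' k)"
      using exists_least_iff[of "\<lambda>l. l < n \<and> x l \<noteq> x' l"] by blast
    have "d \<le> \<bar>Y x l - Y x' l\<bar>" using l x by (intro tri) (auto simp: S_def)
    moreover have "\<lfloor>(Y x l - z l) / d\<rfloor> = \<lfloor>(Y x' l - z l) / d\<rfloor>"
      using fun_cong[OF x(3), of l] l by (simp add: k_def)
    then have "\<bar>(Y x l - z l) / d - (Y x' l - z l) / d\<bar> < 1" by linarith
    then have "\<bar>(Y x l - Y x' l) / d\<bar> < 1" by (simp add: diff_divide_distrib)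
    then have "\<bar>Y x l - Y x' l\<bar> < d" using d by (simp add: field_simps)
    ultimately show False by simp
  qed
  have "card S = card (k ` S)" using inj by (simp add: card_image)
  also have "\<dots> \<le> card (int_l1_ball n (2 * real n))"
    by (intro card_mono sub card_int_l1_ball[of "1/2"]) auto
  also have "real \<dots> \<le> (1/2) powr (- (2 * real n)) * ((1 + 1/2) / (1 - 1/2)) ^ n"
    by (rule card_int_l1_ball) auto
  also have "(1/2) powr (- (2 * real n)) = (4::real) ^ n"
    by (simp add: powr_minus powr_divide powr_powr[symmetric] powr_realpow)
  also have "4 ^ n * ((1 + 1/2) / (1 - 1/2)) ^ n = (12::real) ^ n"
    by (simp add: power_mult_distrib[symmetric])
  finally have "real (card S) \<le> real (12 ^ n)" by simp
  then show ?thesis unfolding S_def of_nat_le_iff .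
qed

lemma cell_index_iff:
  fixes h t :: real
  assumes "0 < h"
  shows "t \<in> {real l * h..<real (Suc l) * h} \<longleftrightarrow> 0 \<le> t \<and> nat \<lfloor>t / h\<rfloor> = l"
proof
  assume t: "t \<in> {real l * h..<real (Suc l) * h}"
  have "0 \<le> real l * h" using assms by simp
  then have "0 \<le> t" using t by simp
  moreover have "\<lfloor>t / h\<rfloor> = int l" using assms t by (intro floor_unique) (auto simp: field_simps)
  ultimately show "0 \<le> t \<and> nat \<lfloor>t / h\<rfloor> = l" by simp
next
  assume t: "0 \<le> t \<and> nat \<lfloor>t / h\<rfloor> = l"
  then have "\<lfloor>t / h\<rfloor> = int l" using assms by (auto simp: nat_eq_iff)
  then have "real l \<le> t / h" "t / h < real l + 1" by linarith+
  then show "t \<in> {real l * h..<real (Suc l) * h}" using assms by (simp add: field_simps)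
qed

lemma integrable_indicator_mult:
  fixes g :: "real \<Rightarrow> real"
  assumes g: "integrable (lebesgue_on S) g" and S: "S \<in> sets lebesgue" and A: "A \<in> sets lebesgue"
  shows "integrable (lebesgue_on S) (\<lambda>t. indicator A t * g t)"
proof -
  have "S \<inter> A \<in> sets (lebesgue_on S)" using S A by (auto simp: sets_restrict_space)
  then have "integrable (lebesgue_on S) (\<lambda>t. indicator (S \<inter> A) t *\<^sub>R g t)"
    using g by (rule integrable_mult_indicator)
  then show ?thesis
    by (rule iffD1[OF Bochner_Integration.integrable_cong[OF refl], rotated]) (auto simp: indicator_def)
qed

text \<open>
  Passing to the integrals over the cells does not increase the \<open>L_1\<close>-norm on \<open>[0, r]\<close>, so that functions
  close to each other have close vectors of integrals.
\<close>

lemma sum_cell_integrals_le: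
  fixes g :: "real \<Rightarrow> real"
  assumes g: "integrable (lebesgue_on {0..1}) g" and h: "0 < h" and r: "r = real n * h" "r \<le> 1"
  shows "(\<Sum>l<n. \<bar>\<integral>t. indicator {real l * h..<real (Suc l) * h} t * g t \<partial>lebesgue_on {0..1}\<bar>)
      \<le> (\<integral>t. \<bar>g t\<bar> \<partial>lebesgue_on {0..r})"
proof -
  let ?M = "lebesgue_on {0..1::real}" and ?I = "\<lambda>l. {real l * h..<real (Suc l) * h}"
  have I: "integrable ?M (\<lambda>t. indicator A t * \<bar>g t\<bar>)" if "A \<in> sets borel" for A
    using g that by (intro integrable_indicator_mult) auto
  have "(\<Sum>l<n. \<bar>\<integral>t. indicator (?I l) t * g t \<partial>?M\<bar>) \<le> (\<Sum>l<n. \<integral>t. indicator (?I l) t * \<bar>g t\<bar> \<partial>?M)"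
  proof (rule sum_mono)
    fix l
    have "\<bar>\<integral>t. indicator (?I l) t * g t \<partial>?M\<bar> \<le> (\<integral>t. \<bar>indicator (?I l) t * g t\<bar> \<partial>?M)"
      by (rule integral_abs_bound)
    then show "\<bar>\<integral>t. indicator (?I l) t * g t \<partial>?M\<bar> \<le> (\<integral>t. indicator (?I l) t * \<bar>g t\<bar> \<partial>?M)"
      by (simp add: abs_mult)
  qed
  also have "\<dots> = (\<integral>t. (\<Sum>l<n. indicator (?I l) t * \<bar>g t\<bar>) \<partial>?M)"
    by (rule Bochner_Integration.integral_sum[symmetric]) (intro I, simp)
  also have "\<dots> \<le> (\<integral>t. indicator {0..r} t * \<bar>g t\<bar> \<partial>?M)"
  proof (rule integral_mono)
    show "integrable ?M (\<lambda>t. \<Sum>l<n. indicator (?I l) t * \<bar>g t\<bar>)" by (intro Bochner_Integration.integrable_sum I) simp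
    show "integrable ?M (\<lambda>t. indicator {0..r} t * \<bar>g t\<bar>)" by (intro I) simp
    fix t assume "t \<in> space ?M"
    then have t: "0 \<le> t" by simp
    have "(\<Sum>l<n. indicator (?I l) t) = (\<Sum>l<n. if l = nat \<lfloor>t / h\<rfloor> then 1 else 0 :: real)"
      using t by (intro sum.cong refl) (simp only: indicator_def cell_index_iff[OF h] eq_commute simp_thms, simp)
    also have "\<dots> \<le> indicator {0..r} t"
    proof -
      have "t \<le> r" if "nat \<lfloor>t / h\<rfloor> < n"
      proof -
        have "t < real (Suc (nat \<lfloor>t / h\<rfloor>)) * h" using cell_index_iff[OF h, of t "nat \<lfloor>t / h\<rfloor>"] t by simp
        also have "\<dots> \<le> real n * h" using that h by (intro mult_right_mono) auto
        finally show ?thesis using r by simp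
      qed
      then show ?thesis using t by (auto simp: indicator_def)
    qed
    finally have "(\<Sum>l<n. indicator (?I l) t) * \<bar>g t\<bar> \<le> indicator {0..r} t * \<bar>g t\<bar>"
      by (intro mult_right_mono) auto
    then show "(\<Sum>l<n. indicator (?I l) t * \<bar>g t\<bar>) \<le> indicator {0..r} t * \<bar>g t\<bar>"
      by (simp add: sum_distrib_right)
  qed
  also have "\<dots> = (\<integral>t. \<bar>g t\<bar> \<partial>lebesgue_on {0..r})"
    using r by (subst (1 2) integral_restrict_space) (auto intro!: Bochner_Integration.integral_cong simp: indicator_def)
  finally show ?thesis .
qed

text \<open>
  \<open>G\<close> and \<open>E\<close> bound the two quantities that enter the diagonal, and \<open>r\<close> is arbitrary. The left-hand side is
  \<open>n\<close> times a lower bound for the diagonal entries, the right-hand side bounds the \<open>l_1\<close>-norm of the cell integrals of a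
  function with \<open>L_q\<close>-norm \<open>\<epsilon>\<close>.
\<close>

lemma covering_radius_lower_bound:
  fixes \<alpha> :: "real \<Rightarrow> real" and r G E \<epsilon> :: real
  defines "M \<equiv> lebesgue_on {0..1::real}"
  assumes p: "1 \<le> p" and q: "1 \<le> q" and n: "1 \<le> n" and r: "0 < r" "r \<le> 1"
    and a: "\<And>t. t \<in> {0..1} \<Longrightarrow> 0 < \<alpha> t" and G: "0 < G" "\<And>t. t \<in> {0..r} \<Longrightarrow> G \<le> 1 / (\<alpha> t * Gamma (\<alpha> t))"
    and E: "\<And>t. t \<in> {0..r} \<Longrightarrow> \<alpha> t \<le> E"
    and \<epsilon>: "0 < \<epsilon>" and y: "\<forall>j\<in>{1..2^(n-1)}. y j \<in> Lp_space M q"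
    and cover: "RL_op \<alpha> ` Lp_cball M p (\<lambda>_. 0) 1 \<subseteq> (\<Union>j\<in>{1..2^(n-1)::nat}. Lp_cball M q (y j) \<epsilon>)"
  defines "h \<equiv> r / real n"
  shows "real n * (r powr (- recip p) / 32 * G * (h / 2) powr E * (h / 2)) \<le> r powr (1 - recip q) * \<epsilon>"
proof -
  define u where "u = recip p"
  define v where "v = recip q"
  have uv: "0 \<le> u" "u \<le> 1" "0 \<le> v" "v \<le> 1" using recip_bounds(1,2) p q by (auto simp: u_def v_def)
  have h: "0 < h" "r = real n * h" "h \<le> 1" using r n by (auto simp: h_def field_simps)
  \<comment> \<open>The test functions take values \<open>\<kappa> * x l\<close>, with \<open>0 \<le> x l < 32\<close>, on the \<open>l\<close>-th of \<open>n\<close> cells of length \<open>h\<close>.\<close>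
  define \<kappa> where "\<kappa> = r powr (- u) / 32"
  have kap: "\<kappa> > 0" using r by (simp add: \<kappa>_def)
  define X where "X = ({..<n} \<rightarrow>\<^sub>E {..<32::nat})"
  define f where "f x s = indicator {0..<r} s * (\<kappa> * real (x (nat \<lfloor>s / h\<rfloor>)))" for x :: "nat \<Rightarrow> nat" and s
  define d where "d = \<kappa> * G * (h / 2) powr E * (h / 2)"
  have d: "d > 0" using kap G h by (simp add: d_def)
  have space: "emeasure M (space M) = ennreal 1" unfolding M_def by (subst emeasure_lebesgue_on_interval) auto
  have fm: "f x \<in> borel_measurable lebesgue" for x
  proof -
    have "(\<lambda>s. nat \<lfloor>s / h\<rfloor>) \<in> borel \<rightarrow>\<^sub>M count_space UNIV" by measurable
    then have "(\<lambda>s. real (x (nat \<lfloor>s / h\<rfloor>))) \<in> borel_measurable borel"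
      by (rule measurable_compose) simp
    then have "f x \<in> borel_measurable borel" unfolding f_def by measurable
    then show ?thesis by (intro measurable_completion) simp
  qed
  have fb: "\<bar>f x s\<bar> \<le> r powr (- u)" if x: "x \<in> X" for x s
  proof (cases "s \<in> {0..<r}")
    case True
    have "s / h < real n" using True h by (simp add: field_simps)
    then have "nat \<lfloor>s / h\<rfloor> < n" using n True h by (simp add: floor_less_iff nat_less_iff)
    then have "x (nat \<lfloor>s / h\<rfloor>) < 32" using x by (auto simp: X_def PiE_iff)
    then have "\<kappa> * real (x (nat \<lfloor>s / h\<rfloor>)) \<le> \<kappa> * 32" using kap by (intro mult_left_mono) auto
    then show ?thesis using True kap by (simp add: f_def \<kappa>_def)
  qed (simp add: f_def)
  have f1: "Lq_le M u (f x) 1" if x: "x \<in> X" for x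
  proof (cases "u = 0")
    case True
    then show ?thesis using fb[OF x] r by (simp add: Lq_le_def)
  next
    case False
    have "(\<integral>\<^sup>+s. ennreal (\<bar>f x s\<bar> powr (1/u)) \<partial>M) \<le> (\<integral>\<^sup>+s. ennreal (1/r) * indicator {0..r} s \<partial>M)"
    proof (intro nn_integral_mono)
      fix s
      have "\<bar>f x s\<bar> powr (1/u) \<le> (r powr (- u)) powr (1/u)" using fb[OF x] uv by (intro powr_mono2) auto
      also have "\<dots> = r powr (- 1)" unfolding powr_powr using False by simp
      also have "\<dots> = 1 / r" using r by (simp add: powr_minus divide_simps)
      finally have "\<bar>f x s\<bar> powr (1/u) \<le> 1 / r" .
      then show "ennreal (\<bar>f x s\<bar> powr (1/u)) \<le> ennreal (1/r) * indicator {0..r} s"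
        by (auto simp: f_def indicator_def intro: ennreal_leI)
    qed
    also have "\<dots> = ennreal (1/r) * ennreal r"
      using r unfolding M_def by (subst nn_integral_cmult_indicator) (auto simp: emeasure_restrict_space sets_restrict_space)
    also have "\<dots> = 1" using r by (simp flip: ennreal_mult)
    finally show ?thesis using False by (simp add: Lq_le_def)
  qed
  have fM: "f x \<in> borel_measurable M" for x unfolding M_def using fm by (rule measurable_restrict_space1)
  have ball: "f x \<in> Lp_cball M p (\<lambda>_. 0) 1" if x: "x \<in> X" for x
  proof -
    have "Lp_norm M p (f x) \<le> ennreal 1" using f1[OF x] Lp_norm_le_iff[OF fM p, of 1] by (simp add: u_def)
    then show ?thesis using fM by (auto simp: Lp_cball_def Lp_space_def intro: le_less_trans)
  qed
  have covered: "\<exists>j\<in>{1..2^(n-1)}. RL_op \<alpha> (f x) \<in> Lp_cball M q (y j) \<epsilon>" if "x \<in> X" for x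
    using cover ball[OF that] by blast
  have int: "integrable M g" if "g \<in> Lp_space M q" for g
  proof -
    obtain b where b: "0 \<le> b" "Lq_le M v g b" using Lp_space_imp_Lq_le[OF q \<open>g \<in> _\<close>] unfolding v_def by blast
    show ?thesis using that b uv space by (intro Lq_le_imp_integrable(1)[where v = v]) (auto simp: Lp_space_def)
  qed
  have intR: "integrable M (RL_op \<alpha> (f x))" if "x \<in> X" for x
    using covered[OF that] int by (auto simp: Lp_cball_def)
  let ?I = "\<lambda>l. {real l * h..<real (Suc l) * h}"
  define Y where "Y x l = (\<integral>t. indicator (?I l) t * RL_op \<alpha> (f x) t \<partial>M)" for x l
  define z where "z j l = (\<integral>t. indicator (?I l) t * y j t \<partial>M)" for j l
  have intI: "integrable M (\<lambda>t. indicator A t * g t)" if "integrable M g" "A \<in> sets borel" for g :: "real \<Rightarrow> real" and A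
    using that unfolding M_def by (intro integrable_indicator_mult) auto
  have tri: "d \<le> \<bar>Y x l - Y x' l\<bar>"
    if x: "x \<in> X" "x' \<in> X" and l: "l < n" and eq: "\<And>k. k < l \<Longrightarrow> x k = x' k" and ne: "x l \<noteq> x' l" for x x' l
  proof -
    define c where "c = real (x l) - real (x' l)"
    have c: "1 \<le> \<bar>c\<bar>" using ne by (simp add: c_def)
    define D where "D t = sgn c * (RL_op \<alpha> (f x) t - RL_op \<alpha> (f x') t)" for t
    have lh: "0 \<le> real l * h" "real (Suc l) * h \<le> r" unfolding h(2) using h(1) l by (auto intro!: mult_right_mono)
    have D: "D t = \<kappa> * \<bar>c\<bar> * ((t - real l * h) powr \<alpha> t / (\<alpha> t * Gamma (\<alpha> t)))" if t: "t \<in> ?I l" for t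
    proof -
      have t01: "t \<in> {0..1}" "t < r" using t lh r by auto
      have "RL_op \<alpha> (f x) t - RL_op \<alpha> (f x') t = \<kappa> * c * ((t - real l * h) powr \<alpha> t / (\<alpha> t * Gamma (\<alpha> t)))"
      proof (rule RL_op_step_difference[where \<alpha> = \<alpha> and t = t, OF a[OF t01(1)] lh(1) _ fm[of x] fm[of x'] fb[OF x(1)] fb[OF x(2)]])
        show "real l * h \<le> t" using t by simp
        fix s
        { assume s: "0 \<le> s" "s < real l * h"
          then have "s / h < real l" using h by (simp add: field_simps)
          then have "nat \<lfloor>s / h\<rfloor> < l" using s h by (simp add: floor_less_iff nat_less_iff)
          then show "f x s = f x' s" using eq by (simp add: f_def) }
        { assume s: "real l * h \<le> s" "s \<le> t"
          then have "s \<in> ?I l" using t by simp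
          then have "0 \<le> s" "nat \<lfloor>s / h\<rfloor> = l" using cell_index_iff[OF h(1)] by blast+
          moreover have "s < r" using s t01 by simp
          ultimately show "f x s - f x' s = \<kappa> * c" by (simp add: f_def c_def algebra_simps) }
      qed
      then show ?thesis by (simp add: D_def) (simp add: sgn_if)
    qed
    \<comment> \<open>On the right half of the cell the kernel has had the length \<open>h / 2\<close> to act.\<close>
    let ?H = "{real l * h + h / 2..<real (Suc l) * h}"
    have "d = (\<integral>t. indicator ?H t * (\<kappa> * G * (h / 2) powr E) \<partial>M)"
    proof -
      have sub: "?H \<subseteq> {0..1}"
      proof
        fix t assume t: "t \<in> ?H"
        then have "real l * h \<le> t" "t < real (Suc l) * h" using h(1) unfolding atLeastLessThan_iff by linarith+
        then show "t \<in> {0..1}" using lh r(2) unfolding atLeastAtMost_iff by linarith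
      qed
      then have "measure M ?H = measure lebesgue ?H"
        unfolding M_def by (intro measure_restrict_space) auto
      also have "\<dots> = h / 2" using h(1) by (simp add: algebra_simps)
      finally show ?thesis using sub by (simp add: d_def M_def Int_absorb2)
    qed
    also have "\<dots> \<le> (\<integral>t. indicator (?I l) t * D t \<partial>M)"
    proof (rule integral_mono)
      show "integrable M (\<lambda>t. indicator ?H t * (\<kappa> * G * (h / 2) powr E))"
        using space by (intro intI finite_measure.integrable_const finite_measureI) auto
      show "integrable M (\<lambda>t. indicator (?I l) t * D t)"
        unfolding D_def using intR x by (intro intI) auto
      fix t
      show "indicator ?H t * (\<kappa> * G * (h / 2) powr E) \<le> indicator (?I l) t * D t"
      proof (cases "t \<in> ?I l")
        case True
        then have t01: "t \<in> {0..1}" "t \<in> {0..r}" using lh r by auto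
        have D': "indicator (?I l) t * D t = \<kappa> * \<bar>c\<bar> * ((t - real l * h) powr \<alpha> t / (\<alpha> t * Gamma (\<alpha> t)))"
          using D True by simp
        show ?thesis
        proof (cases "t \<in> ?H")
          case True
          have "(h / 2) powr E \<le> (h / 2) powr \<alpha> t" using h E[OF t01(2)] by (intro powr_mono') auto
          also have "\<dots> \<le> (t - real l * h) powr \<alpha> t" using True h a[OF t01(1)] by (intro powr_mono2) auto
          finally have "(h / 2) powr E * G \<le> (t - real l * h) powr \<alpha> t * (1 / (\<alpha> t * Gamma (\<alpha> t)))"
            using G t01 by (intro mult_mono) auto
          then have "\<kappa> * 1 * ((h / 2) powr E * G) \<le> \<kappa> * \<bar>c\<bar> * ((t - real l * h) powr \<alpha> t / (\<alpha> t * Gamma (\<alpha> t)))"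
            using kap c G by (intro mult_mono) auto
          then show ?thesis unfolding D' using True by (simp add: mult_ac)
        next
          case False
          then show ?thesis unfolding D' using kap a[OF t01(1)] by (simp add: Gamma_real_pos less_imp_le)
        qed
      next
        case False
        moreover have "?H \<subseteq> ?I l" using h by auto
        ultimately have "t \<notin> ?H" by blast
        with False show ?thesis by simp
      qed
    qed
    also have "\<dots> = sgn c * (Y x l - Y x' l)"
    proof -
      have "(\<integral>t. indicator (?I l) t * D t \<partial>M)
          = (\<integral>t. sgn c * (indicator (?I l) t * RL_op \<alpha> (f x) t - indicator (?I l) t * RL_op \<alpha> (f x') t) \<partial>M)"
        by (simp add: D_def algebra_simps)
      also have "\<dots> = sgn c * (Y x l - Y x' l)"
        unfolding Y_def using intR x by (subst integral_mult_right_zero, subst Bochner_Integration.integral_diff) (auto intro!: intI)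
      finally show ?thesis .
    qed
    also have "\<dots> \<le> \<bar>Y x l - Y x' l\<bar>" using c by (auto simp: sgn_if)
    finally show ?thesis .
  qed
  have near: "(\<Sum>l<n. \<bar>Y x l - z j l\<bar>) \<le> r powr (1 - v) * \<epsilon>"
    if x: "x \<in> X" and j: "j \<in> {1..2^(n-1)}" and in_ball: "RL_op \<alpha> (f x) \<in> Lp_cball M q (y j) \<epsilon>" for x j
  proof -
    define g where "g t = RL_op \<alpha> (f x) t - y j t" for t
    have yj: "integrable M (y j)" using y j int by blast
    have gi: "integrable M g" unfolding g_def using intR[OF x] yj by auto
    have "g = (\<lambda>t. RL_op \<alpha> (f x) t - y j t)" by (simp add: g_def fun_eq_iff)
    then have "Lp_norm M q g \<le> ennreal \<epsilon>" using in_ball by (simp add: Lp_cball_def)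
    then have "Lq_le M v g \<epsilon>"
      using Lp_norm_le_iff[OF borel_measurable_integrable[OF gi] q, of \<epsilon>] \<epsilon> by (simp add: v_def)
    then have gr: "Lq_le (lebesgue_on {0..r}) v g \<epsilon>"
      unfolding M_def using r \<epsilon> uv by (elim Lq_le_lebesgue_on_subset[rotated -1]) auto
    have gm: "g \<in> borel_measurable (lebesgue_on {0..r})"
      using r by (intro measurable_restrict_mono[OF borel_measurable_integrable[OF gi[unfolded M_def]]]) auto
    have "(\<Sum>l<n. \<bar>Y x l - z j l\<bar>) = (\<Sum>l<n. \<bar>\<integral>t. indicator (?I l) t * g t \<partial>M\<bar>)"
      unfolding Y_def z_def g_def right_diff_distrib
      using intR[OF x] yj by (subst Bochner_Integration.integral_diff) (auto intro!: intI)
    also have "\<dots> \<le> (\<integral>t. \<bar>g t\<bar> \<partial>lebesgue_on {0..r})"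
      unfolding M_def using gi h r by (intro sum_cell_integrals_le) (auto simp: M_def)
    also have "\<dots> \<le> \<epsilon> * r powr (1 - v)"
      using gm gr uv \<epsilon> r emeasure_lebesgue_on_interval[of 0 r] by (intro Lq_le_imp_integrable(2)) auto
    finally show ?thesis by (simp add: mult_ac)
  qed
  have "real n * d \<le> r powr (1 - v) * \<epsilon>"
  proof (rule ccontr)
    assume "\<not> ?thesis"
    then have lt: "r powr (1 - v) * \<epsilon> \<le> real n * d" by simp
    \<comment> \<open>Each ball contains the images of at most \<open>12 ^ n\<close> test functions, so that \<open>2 ^ (n - 1)\<close> balls cover
      fewer than \<open>32 ^ n\<close> of them.\<close>
    let ?S = "\<lambda>j. {x \<in> X. (\<Sum>l<n. \<bar>Y x l - z j l\<bar>) \<le> real n * d}"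
    have finX: "finite X" unfolding X_def by (intro finite_PiE) auto
    have Xext: "X \<subseteq> extensional {..<n}" unfolding X_def PiE_def by (rule Int_lower2)
    have "X \<subseteq> (\<Union>j\<in>{1..2^(n-1)::nat}. ?S j)"
    proof
      fix x assume x: "x \<in> X"
      then obtain j where "j \<in> {1..2^(n-1)}" "RL_op \<alpha> (f x) \<in> Lp_cball M q (y j) \<epsilon>" using covered by blast
      then show "x \<in> (\<Union>j\<in>{1..2^(n-1)}. ?S j)" using near[OF x, of j] lt x by force
    qed
    then have "card X \<le> card (\<Union>j\<in>{1..2^(n-1)::nat}. ?S j)" using finX by (intro card_mono) auto
    also have "\<dots> \<le> (\<Sum>j\<in>{1..2^(n-1)::nat}. card (?S j))" by (rule card_UN_le) auto
    also have "\<dots> \<le> (\<Sum>j\<in>{1..2^(n-1)::nat}. 12 ^ n)"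
      by (intro sum_mono card_triangular_near_le[OF finX Xext d tri])
    also have "\<dots> = 2 ^ (n - 1) * 12 ^ n" by simp
    also have "\<dots> \<le> 2 ^ n * 12 ^ n" by (intro mult_right_mono power_increasing) auto
    also have "\<dots> = 24 ^ n" by (simp add: power_mult_distrib[symmetric])
    also have "\<dots> < (32::nat) ^ n" using n by (intro power_strict_mono) auto
    also have "\<dots> = card X" by (simp add: X_def card_PiE)
    finally show False by simp
  qed
  then show ?thesis by (simp add: d_def \<kappa>_def u_def v_def)
qed

text \<open>
  The length \<open>r\<close> is the solution of \<open>n powr (r powr \<gamma>) = 2\<close>; the factor \<open>ln 2\<close> keeps it at most 1 down to \<open>n = 2\<close>. The fourth
  bound says that \<open>r / (2 n)\<close> is at least a fixed negative power of \<open>n\<close>.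
\<close>

lemma critical_length_bounds:
  fixes \<gamma> :: real
  assumes n: "2 \<le> n" and g: "0 < \<gamma>"
  defines "r \<equiv> (ln 2 / ln (real n)) powr (1 / \<gamma>)"
  shows "0 < r" "r \<le> 1" "r powr \<gamma> * ln (real n) = ln 2" "- (2 / \<gamma> + 2) * ln (real n) \<le> ln (r / (2 * real n))"
    "r powr x = ln 2 powr (x / \<gamma>) / ln (real n) powr (x / \<gamma>)"
proof -
  have ln: "0 < ln (2::real)" "ln 2 \<le> ln (real n)" "0 < ln (real n)" using n by auto
  show r: "0 < r" using ln by (simp add: r_def)
  show "r \<le> 1" using ln g unfolding r_def by (intro powr_le1) auto
  show "r powr \<gamma> * ln (real n) = ln 2" using ln g by (simp add: r_def powr_powr)
  show "r powr x = ln 2 powr (x / \<gamma>) / ln (real n) powr (x / \<gamma>)"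
    using ln by (simp add: r_def powr_powr powr_divide)
  have "ln (1 / 2) \<le> ln (ln (2::real))" using ln_2_ge_half ln by (subst ln_le_cancel_iff) auto
  then have "- ln (real n) \<le> ln (ln 2)" using ln by (simp add: ln_div)
  moreover have "ln (ln (real n)) \<le> ln (real n)" using ln by (intro ln_bound)
  ultimately have "- (2 * ln (real n)) \<le> ln (ln 2) - ln (ln (real n))" by linarith
  then have "1 / \<gamma> * (- (2 * ln (real n))) \<le> 1 / \<gamma> * (ln (ln 2) - ln (ln (real n)))"
    using g by (intro mult_left_mono) auto
  also have "\<dots> = ln r" using ln by (simp add: r_def ln_powr ln_div)
  finally have "- (2 / \<gamma>) * ln (real n) \<le> ln r" by simp
  moreover have "ln (r / (2 * real n)) = ln r - ln 2 - ln (real n)" using r n by (simp add: ln_div ln_mult)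
  ultimately show "- (2 / \<gamma> + 2) * ln (real n) \<le> ln (r / (2 * real n))" using ln by (simp add: algebra_simps)
qed

lemma entropy_number_lower_bound:
  fixes p q :: ennreal and lam \<gamma> \<alpha>\<^sub>0 :: real and \<alpha> :: "real \<Rightarrow> real"
  assumes p: "1 \<le> p" and q: "1 \<le> q" and lam: "lam > 0" and g: "\<gamma> > 0" and a0: "\<alpha>\<^sub>0 > 0"
    and \<alpha>: "\<And>t. t \<in> {0..1} \<Longrightarrow> \<alpha> t = \<alpha>\<^sub>0 + lam * t powr \<gamma>"
  shows "\<exists>c>0. \<forall>n::nat. n \<ge> 2 \<longrightarrow>
    ennreal (c * real n powr (- \<alpha>\<^sub>0) / (ln (real n)) powr ((\<alpha>\<^sub>0 + recip q - recip p) / \<gamma>))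
      \<le> entropy_number (lebesgue_on {0..1}) p (lebesgue_on {0..1}) q (RL_op \<alpha>) n"
proof -
  obtain U where U: "0 < U" "\<And>x. x \<in> {\<alpha>\<^sub>0..\<alpha>\<^sub>0 + lam} \<Longrightarrow> Gamma x \<le> U"
    using Gamma_bounds_on_interval[OF a0] by metis
  define G where "G = 1 / ((\<alpha>\<^sub>0 + lam) * U)"
  have G: "0 < G" using U a0 lam by (simp add: G_def)
  define k where "k = \<alpha>\<^sub>0 + recip q - recip p"
  define c where "c = G / 32 * (2 powr (- \<alpha>\<^sub>0 - 1)) * exp (- lam * ln 2 * (2 / \<gamma> + 2)) * ln 2 powr (k / \<gamma>)"
  show ?thesis
  proof (intro exI[of _ c] conjI allI impI)
    show "c > 0" using G by (simp add: c_def)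
    fix n :: nat assume n: "n \<ge> 2"
    define r where "r = (ln 2 / ln (real n)) powr (1 / \<gamma>)"
    note r = critical_length_bounds[OF n g, folded r_def]
    define h where "h = r / real n"
    have h: "0 < h" using r n by (simp add: h_def)
    define E where "E = \<alpha>\<^sub>0 + lam * r powr \<gamma>"
    have a: "\<alpha>\<^sub>0 \<le> \<alpha> t" "\<alpha> t \<le> \<alpha>\<^sub>0 + lam" if "t \<in> {0..1}" for t
      using that \<alpha>[OF that] lam g by (auto simp: powr_le1)
    have aE: "\<alpha> t \<le> E" if "t \<in> {0..r}" for t
    proof -
      have "t powr \<gamma> \<le> r powr \<gamma>" using that g by (intro powr_mono2) auto
      then show ?thesis using that r(2) lam \<alpha>[of t] by (simp add: E_def)
    qed
    have aG: "G \<le> 1 / (\<alpha> t * Gamma (\<alpha> t))" if "t \<in> {0..r}" for t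
    proof -
      have t: "t \<in> {0..1}" using that r(2) by auto
      have "\<alpha> t * Gamma (\<alpha> t) \<le> (\<alpha>\<^sub>0 + lam) * U"
        using a[OF t] a0 lam U by (intro mult_mono) (auto intro!: Gamma_real_pos less_imp_le)
      moreover have "0 < \<alpha> t * Gamma (\<alpha> t)" using a[OF t] a0 by (intro mult_pos_pos Gamma_real_pos) auto
      ultimately show ?thesis unfolding G_def by (intro divide_left_mono) (auto intro!: mult_pos_pos simp: a0 lam U)
    qed
    show "ennreal (c * real n powr (- \<alpha>\<^sub>0) / (ln (real n)) powr ((\<alpha>\<^sub>0 + recip q - recip p) / \<gamma>))
      \<le> entropy_number (lebesgue_on {0..1}) p (lebesgue_on {0..1}) q (RL_op \<alpha>) n"
      unfolding entropy_number_def
    proof (rule Inf_greatest, safe)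
      fix \<epsilon> :: real and y :: "nat \<Rightarrow> real \<Rightarrow> real"
      assume \<epsilon>: "0 < \<epsilon>" and y: "\<forall>j\<in>{1..2^(n-1)}. y j \<in> Lp_space (lebesgue_on {0..1}) q"
        and cover: "RL_op \<alpha> ` Lp_cball (lebesgue_on {0..1}) p (\<lambda>_. 0) 1
          \<subseteq> (\<Union>j\<in>{1..2^(n-1)}. Lp_cball (lebesgue_on {0..1}) q (y j) \<epsilon>)"
      have 1: "real n * (r powr (- recip p) / 32 * G * (h / 2) powr E * (h / 2)) \<le> r powr (1 - recip q) * \<epsilon>"
        unfolding h_def using n a a0 r(1,2)
        by (intro covering_radius_lower_bound[OF p q _ r(1,2) _ G aG aE \<epsilon> y cover]) (auto intro: less_le_trans)
      \<comment> \<open>Over the interval \<open>[0, r]\<close> the excess order costs only a constant factor.\<close>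
      have 2: "exp (- lam * ln 2 * (2 / \<gamma> + 2)) \<le> (h / 2) powr (lam * r powr \<gamma>)"
      proof -
        have "lam * r powr \<gamma> * (- (2 / \<gamma> + 2) * ln (real n)) \<le> lam * r powr \<gamma> * ln (r / (2 * real n))"
          using r(4) lam by (intro mult_left_mono) auto
        also have "lam * r powr \<gamma> * (- (2 / \<gamma> + 2) * ln (real n)) = - lam * (r powr \<gamma> * ln (real n)) * (2 / \<gamma> + 2)"
          by (simp add: algebra_simps)
        also have "\<dots> = - lam * ln 2 * (2 / \<gamma> + 2)" unfolding r(3) ..
        finally have "- lam * ln 2 * (2 / \<gamma> + 2) \<le> lam * r powr \<gamma> * ln (h / 2)" by (simp add: h_def mult.commute)
        then have "exp (- lam * ln 2 * (2 / \<gamma> + 2)) \<le> exp (lam * r powr \<gamma> * ln (h / 2))" by simp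
        also have "\<dots> = (h / 2) powr (lam * r powr \<gamma>)" using h by (simp add: powr_def)
        finally show ?thesis .
      qed
      have 3: "r powr (1 - recip q) * (c * real n powr (- \<alpha>\<^sub>0) / ln (real n) powr (k / \<gamma>))
          \<le> real n * (r powr (- recip p) / 32 * G * (h / 2) powr E * (h / 2))"
      proof -
        have "r powr (1 - recip q) * (c * real n powr (- \<alpha>\<^sub>0) / ln (real n) powr (k / \<gamma>))
          = r powr (1 - recip q) * (G / 32 * (2 powr (- \<alpha>\<^sub>0 - 1)) * real n powr (- \<alpha>\<^sub>0) * r powr k)
             * exp (- lam * ln 2 * (2 / \<gamma> + 2))"
          by (simp add: c_def r(5))
        also have "\<dots> \<le> r powr (1 - recip q) * (G / 32 * (2 powr (- \<alpha>\<^sub>0 - 1)) * real n powr (- \<alpha>\<^sub>0) * r powr k)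
             * (h / 2) powr (lam * r powr \<gamma>)"
          using 2 G by (intro mult_left_mono) auto
        also have "\<dots> = G / 32 * (r powr (1 - recip q) * r powr k * (2 powr (- \<alpha>\<^sub>0 - 1) * real n powr (- \<alpha>\<^sub>0)))
             * (h / 2) powr (lam * r powr \<gamma>)" by simp
        also have "r powr (1 - recip q) * r powr k = r powr (- recip p) * r powr (\<alpha>\<^sub>0 + 1)"
          by (simp add: powr_add[symmetric] k_def algebra_simps)
        also have "r powr (- recip p) * r powr (\<alpha>\<^sub>0 + 1) * (2 powr (- \<alpha>\<^sub>0 - 1) * real n powr (- \<alpha>\<^sub>0))
            = r powr (- recip p) * (real n * (h / 2) powr (\<alpha>\<^sub>0 + 1))"
        proof -
          have "- \<alpha>\<^sub>0 = 1 - (\<alpha>\<^sub>0 + 1)" "- \<alpha>\<^sub>0 - 1 = - (\<alpha>\<^sub>0 + 1)" by auto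
          then have "2 powr (- \<alpha>\<^sub>0 - 1) * real n powr (- \<alpha>\<^sub>0) = real n / (2 * real n) powr (\<alpha>\<^sub>0 + 1)"
            using n by (simp only: powr_diff powr_minus powr_mult) (simp add: divide_simps)
          then show ?thesis by (simp add: h_def powr_divide mult.commute)
        qed
        also have "G / 32 * (r powr (- recip p) * (real n * (h / 2) powr (\<alpha>\<^sub>0 + 1))) * (h / 2) powr (lam * r powr \<gamma>)
            = real n * (r powr (- recip p) / 32 * G * (h / 2) powr E * (h / 2))"
        proof -
          have "(h / 2) powr (\<alpha>\<^sub>0 + 1) * (h / 2) powr (lam * r powr \<gamma>) = (h / 2) powr (E + 1)"
            by (simp add: powr_add[symmetric] E_def add_ac)
          also have "\<dots> = (h / 2) powr E * (h / 2)" using h by (simp add: powr_add)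
          finally have e: "(h / 2) powr (\<alpha>\<^sub>0 + 1) * (h / 2) powr (lam * r powr \<gamma>) = (h / 2) powr E * (h / 2)" .
          have "G / 32 * (r powr (- recip p) * (real n * (h / 2) powr (\<alpha>\<^sub>0 + 1))) * (h / 2) powr (lam * r powr \<gamma>)
            = real n * (r powr (- recip p) / 32 * G * ((h / 2) powr (\<alpha>\<^sub>0 + 1) * (h / 2) powr (lam * r powr \<gamma>)))" by simp
          then show ?thesis unfolding e by (simp only: mult.assoc)
        qed
        finally show ?thesis .
      qed
      have "r powr (1 - recip q) * (c * real n powr (- \<alpha>\<^sub>0) / ln (real n) powr (k / \<gamma>)) \<le> r powr (1 - recip q) * \<epsilon>"
        using 3 1 by (rule order_trans)
      then have "c * real n powr (- \<alpha>\<^sub>0) / ln (real n) powr (k / \<gamma>) \<le> \<epsilon>"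
        using r(1) by (simp only: mult_le_cancel_left_pos powr_gt_zero)
      then show "ennreal (c * real n powr (- \<alpha>\<^sub>0) / (ln (real n)) powr ((\<alpha>\<^sub>0 + recip q - recip p) / \<gamma>)) \<le> ennreal \<epsilon>"
        unfolding k_def by (rule ennreal_leI)
    qed
  qed
qed


section \<open>Whitney decomposition of the half-line to the left of a point\<close>

text \<open>
  Level \<open>i\<close> uses the dyadic intervals of length \<open>2 powr (- i - 1)\<close>, so that the parents of its cells, of length \<open>2 powr (- i)\<close>,
  exist already for \<open>i = 0\<close>.
\<close>

definition mesh :: "nat \<Rightarrow> real" where "mesh i = (1 / 2) ^ (i + 1)"

definition cell :: "nat \<Rightarrow> real \<Rightarrow> nat" where "cell i t = nat \<lfloor>t / mesh i\<rfloor>"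

text \<open>
  The points to the left of the left neighbour of cell \<open>a\<close>, but not to the left of the left neighbour of
  its parent \<open>a div 2\<close>. They are far enough from the cell for a Taylor expansion at level \<open>i\<close>, but were not so at the level
  before.
\<close>

definition whitney :: "nat \<Rightarrow> nat \<Rightarrow> real set" where
  "whitney i a = {(real (a div 2) - 1) * (2 * mesh i)..<(real a - 1) * mesh i}"

definition ctr :: "nat \<Rightarrow> nat \<Rightarrow> real" where
  "ctr i a = (2 * real (a div 2) + real a - 3) * mesh i / 2"

definition rad :: "nat \<Rightarrow> nat \<Rightarrow> real" where
  "rad i a = (real a - 2 * real (a div 2) + 1) * mesh i / 2"

text \<open>
  The left end of the left neighbour of the dyadic interval of length \<open>2 powr (- i)\<close> that contains \<open>t\<close>.
\<close>

definition left_end :: "nat \<Rightarrow> real \<Rightarrow> real" where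
  "left_end i t = (real (nat \<lfloor>t * 2 ^ i\<rfloor>) - 1) / 2 ^ i"

lemma mesh_pos [simp]: "0 < mesh i" "0 \<le> mesh i" "mesh i \<noteq> 0" and mesh_le_1: "mesh i \<le> 1"
proof -
  show "0 < mesh i" "0 \<le> mesh i" "mesh i \<noteq> 0" by (auto simp: mesh_def)
  show "mesh i \<le> 1" unfolding mesh_def by (rule power_le_one) auto
qed

lemma cell_bounds:
  assumes "0 \<le> t"
  shows "real (cell i t) * mesh i \<le> t" "t < (real (cell i t) + 1) * mesh i"
  using cell_index_iff[OF mesh_pos(1), of t "cell i t" i] assms by (auto simp: cell_def algebra_simps)

lemma div2_real: "real a = 2 * real (a div 2) + real (a mod 2)"
  by (metis mult_div_mod_eq of_nat_add of_nat_mult of_nat_numeral)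

lemma mod2_real_cases: "real (a mod 2) = 0 \<or> real (a mod 2) = 1"
  by (cases "even a") (auto simp: odd_iff_mod_2_eq_one even_iff_mod_2_eq_zero)

lemma rad_bounds: "mesh i / 2 \<le> rad i a" "rad i a \<le> mesh i" "0 < rad i a"
proof -
  have "rad i a = (real (a mod 2) + 1) * mesh i / 2" unfolding rad_def using div2_real[of a] by simp
  then show "mesh i / 2 \<le> rad i a" "rad i a \<le> mesh i" "0 < rad i a"
    using mod2_real_cases[of a] mesh_pos(1)[of i] by (auto simp del: mesh_pos)
qed

lemma whitney_eq_ball: "whitney i a = {ctr i a - rad i a..<ctr i a + rad i a}"
  unfolding whitney_def ctr_def rad_def by (auto simp: field_simps)

lemma measure_whitney: "emeasure lebesgue (whitney i a) = ennreal (2 * rad i a)"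
  using rad_bounds[of i a] by (simp add: whitney_eq_ball)

lemma whitney_sets [simp, measurable]: "whitney i a \<in> sets lebesgue" "whitney i a \<in> sets borel"
  by (auto simp: whitney_eq_ball)

text \<open>
  Even and odd cells differ: the Whitney set consists of one or of two cells. In both cases its radius is at most
  half of the distance from \<open>t\<close> to its centre, which is the ratio of the Taylor series.
\<close>

lemma ctr_dist:
  assumes "0 \<le> t" "a = cell i t"
  shows "3 / 2 * mesh i \<le> t - ctr i a" "t - ctr i a \<le> 3 * mesh i" "2 * rad i a \<le> t - ctr i a"
proof -
  have c: "real a * mesh i - ctr i a = (real (a mod 2) + 3) * mesh i / 2"
    unfolding ctr_def using div2_real[of a] by (simp add: field_simps)
  have r: "rad i a = (real (a mod 2) + 1) * mesh i / 2" unfolding rad_def using div2_real[of a] by simp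
  have t: "real a * mesh i \<le> t" "t < real a * mesh i + mesh i"
    using cell_bounds[OF assms(1), of i] assms(2) by (auto simp: algebra_simps)
  show "3 / 2 * mesh i \<le> t - ctr i a" "t - ctr i a \<le> 3 * mesh i" "2 * rad i a \<le> t - ctr i a"
    using mod2_real_cases[of a] c r t mesh_pos(1)[of i] by auto
qed

lemma whitney_dist:
  assumes "s \<in> whitney i a" "0 \<le> t" "a = cell i t"
  shows "mesh i / 2 \<le> t - s" "t - s \<le> 4 * mesh i" "\<bar>ctr i a - s\<bar> \<le> rad i a"
  using ctr_dist[OF assms(2,3)] assms(1) rad_bounds[of i a] unfolding whitney_eq_ball by auto

lemma cell_div_2:
  assumes "0 \<le> t"
  shows "cell i t div 2 = nat \<lfloor>t * 2 ^ i\<rfloor>"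
proof -
  have "\<lfloor>t * 2 ^ i\<rfloor> = \<lfloor>t / mesh i / real_of_int 2\<rfloor>" by (simp add: mesh_def field_simps power_divide)
  also have "\<dots> = \<lfloor>t / mesh i\<rfloor> div 2" by (rule floor_divide_real_eq_div) simp
  finally show ?thesis using assms by (simp add: cell_def nat_div_distrib)
qed

lemma whitney_cell:
  assumes "0 \<le> t"
  shows "whitney i (cell i t) = {left_end i t..<left_end (Suc i) t}"
proof -
  have "cell i t = nat \<lfloor>t * 2 ^ Suc i\<rfloor>" by (simp add: cell_def mesh_def power_divide)
  moreover have "x * mesh i = x / 2 ^ Suc i" "x * (2 * mesh i) = x / 2 ^ i" for x
    by (simp_all add: mesh_def power_divide)
  ultimately show ?thesis unfolding whitney_def cell_div_2[OF assms] left_end_def by (simp only:)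
qed

lemma left_end_props:
  assumes "0 \<le> t"
  shows "left_end i t \<le> left_end (Suc i) t" "left_end i t < t" "t - 2 / 2 ^ i < left_end i t" "-1 \<le> left_end i t"
proof -
  have "ctr i (cell i t) - rad i (cell i t) < ctr i (cell i t) + rad i (cell i t)" using rad_bounds(3) by simp
  then have "whitney i (cell i t) \<noteq> {}" unfolding whitney_eq_ball by (simp add: atLeastLessThan_empty_iff)
  then show "left_end i t \<le> left_end (Suc i) t" unfolding whitney_cell[OF assms] by simp
  have f: "real (nat \<lfloor>t * 2 ^ i\<rfloor>) \<le> t * 2 ^ i" "t * 2 ^ i < real (nat \<lfloor>t * 2 ^ i\<rfloor>) + 1"
  proof -
    have "real (nat \<lfloor>t * 2 ^ i\<rfloor>) = real_of_int \<lfloor>t * 2 ^ i\<rfloor>" using assms by (simp add: of_nat_nat)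
    then show "real (nat \<lfloor>t * 2 ^ i\<rfloor>) \<le> t * 2 ^ i" "t * 2 ^ i < real (nat \<lfloor>t * 2 ^ i\<rfloor>) + 1" by linarith+
  qed
  then have "left_end i t \<le> (t * 2 ^ i - 1) / 2 ^ i" unfolding left_end_def by (intro divide_right_mono) auto
  also have "\<dots> = t - 1 / 2 ^ i" by (simp add: diff_divide_distrib)
  finally have "left_end i t \<le> t - 1 / 2 ^ i" .
  moreover have "0 < 1 / (2::real) ^ i" by simp
  ultimately show "left_end i t < t" by linarith
  have "(t * 2 ^ i - 2) / 2 ^ i < left_end i t" unfolding left_end_def 
  proof (intro divide_strict_right_mono)
    show "t * 2 ^ i - 2 < real (nat \<lfloor>t * 2 ^ i\<rfloor>) - 1" using f by linarith
  qed simp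
  then show "t - 2 / 2 ^ i < left_end i t" by (simp add: diff_divide_distrib)
  have "- 1 / 2 ^ i \<le> left_end i t" unfolding left_end_def by (intro divide_right_mono) auto
  moreover have "-1 \<le> - 1 / (2::real) ^ i" by simp
  ultimately show "-1 \<le> left_end i t" by linarith
qed

lemma left_end_tendsto:
  assumes "0 \<le> t"
  shows "(\<lambda>i. left_end i t) \<longlonglongrightarrow> t"
proof (rule tendsto_sandwich)
  have "(\<lambda>i. t - 2 * (1 / 2) ^ i) \<longlonglongrightarrow> t - 2 * 0" by (intro tendsto_intros LIMSEQ_power_zero) auto
  then show "(\<lambda>i. t - 2 / 2 ^ i) \<longlonglongrightarrow> t" by (simp add: power_divide)
  show "\<forall>\<^sub>F i in sequentially. t - 2 / 2 ^ i \<le> left_end i t" "\<forall>\<^sub>F i in sequentially. left_end i t \<le> t"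
    using left_end_props[OF assms] by (auto intro!: always_eventually less_imp_le)
qed simp

text \<open>
  By \<open>whitney_cell\<close> the Whitney sets of \<open>t\<close> are consecutive intervals, and their ends tend to \<open>t\<close>.
\<close>

lemma sums_whitney_integrals:
  fixes H :: "real \<Rightarrow> real"
  assumes t: "0 \<le> t" "t \<le> 1" and H: "set_integrable lebesgue {0..t} H" and neg: "\<And>s. s < 0 \<Longrightarrow> H s = 0"
  shows "(\<lambda>i. LINT s:whitney i (cell i t)|lebesgue. H s) sums (LINT s:{0..t}|lebesgue. H s)"
    "set_integrable lebesgue (whitney i (cell i t)) H"
proof -
  \<comment> \<open>The first \<open>n\<close> Whitney sets fill up the interval from \<open>left_end 0 t \<le> 0\<close> to \<open>left_end n t\<close>. Starting at \<open>-1\<close> is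
    harmless, as \<open>H\<close> vanishes on the negative axis.\<close>
  let ?A = "\<lambda>n. {-1..<left_end n t}"
  have "set_integrable lebesgue {0..t} H \<longleftrightarrow> set_integrable lebesgue {-1..t} H"
    unfolding set_integrable_def using neg
    by (intro Bochner_Integration.integrable_cong refl) (auto simp: indicator_def)
  then have H1: "set_integrable lebesgue {-1..t} H" using H by simp
  have sub: "set_integrable lebesgue A H" if "A \<in> sets lebesgue" "A \<subseteq> {-1..t}" for A
    using H1 that by (rule set_integrable_subset)
  have wsub: "whitney i (cell i t) \<subseteq> {-1..t}" for i
    unfolding whitney_cell[OF t(1)] using left_end_props(4)[OF t(1), of i] left_end_props(2)[OF t(1), of "Suc i"] by auto
  show "set_integrable lebesgue (whitney i (cell i t)) H" by (intro sub wsub) simp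
  have U: "(\<Union>n. ?A n) = {-1..<t}"
  proof
    show "(\<Union>n. ?A n) \<subseteq> {-1..<t}" by (auto intro: less_trans[OF _ left_end_props(2)[OF t(1)]])
    show "{-1..<t} \<subseteq> (\<Union>n. ?A n)"
    proof
      fix s assume s: "s \<in> {-1..<t}"
      then have "\<forall>\<^sub>F n in sequentially. s < left_end n t" using left_end_tendsto[OF t(1)] by (intro order_tendstoD) auto
      then show "s \<in> (\<Union>n. ?A n)" using s by (auto simp: eventually_sequentially)
    qed
  qed
  have "(\<lambda>n. LINT s:?A n|lebesgue. H s) \<longlonglongrightarrow> (LINT s:(\<Union>n. ?A n)|lebesgue. H s)"
  proof (rule set_integral_cont_up)
    show "incseq ?A" using left_end_props(1)[OF t(1)] by (intro incseq_SucI) (simp add: order_trans)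
    show "set_integrable lebesgue (\<Union>n. ?A n) H" unfolding U by (intro sub) auto
  qed simp
  also have "(LINT s:(\<Union>n. ?A n)|lebesgue. H s) = (LINT s:{0..t}|lebesgue. H s)"
    unfolding U set_lebesgue_integral_def
  proof (rule integral_cong_AE)
    have "(AE s in lebesgue. s \<noteq> t)" by (rule AE_completion[OF AE_lborel_singleton])
    then show "AE s in lebesgue. indicat_real {-1..<t} s *\<^sub>R H s = indicat_real {0..t} s *\<^sub>R H s"
      by eventually_elim (use neg in \<open>auto simp: indicator_def\<close>)
    show "(\<lambda>s. indicat_real {-1..<t} s *\<^sub>R H s) \<in> borel_measurable lebesgue"
    proof -
      have "set_integrable lebesgue {-1..<t} H" by (intro sub) auto
      then show ?thesis unfolding set_integrable_def by (rule borel_measurable_integrable)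
    qed
    show "(\<lambda>s. indicat_real {0..t} s *\<^sub>R H s) \<in> borel_measurable lebesgue"
      using H unfolding set_integrable_def by (rule borel_measurable_integrable)
  qed
  also have "(\<lambda>n. LINT s:?A n|lebesgue. H s) = (\<lambda>n. \<Sum>i<n. LINT s:whitney i (cell i t)|lebesgue. H s)"
  proof
    fix n
    show "(LINT s:?A n|lebesgue. H s) = (\<Sum>i<n. LINT s:whitney i (cell i t)|lebesgue. H s)"
    proof (induction n)
      case 0
      have "left_end 0 t \<le> 0" using t by (simp add: left_end_def le_diff_eq nat_le_iff floor_le_iff)
      then have "(\<lambda>s. indicat_real (?A 0) s *\<^sub>R H s) = (\<lambda>_. 0)" using neg by (auto simp: indicator_def fun_eq_iff)
      then show ?case unfolding set_lebesgue_integral_def by simp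
    next
      case (Suc n)
      have "?A (Suc n) = ?A n \<union> whitney n (cell n t)"
        unfolding whitney_cell[OF t(1)] using left_end_props(1,4)[OF t(1), of n] by auto
      moreover have "?A n \<inter> whitney n (cell n t) = {}" unfolding whitney_cell[OF t(1)] by auto
      moreover have "?A n \<subseteq> {-1..t}" using left_end_props(2)[OF t(1), of n] by auto
      ultimately show ?case using wsub by (simp add: set_integral_Un sub Suc)
    qed
  qed
  finally show "(\<lambda>i. LINT s:whitney i (cell i t)|lebesgue. H s) sums (LINT s:{0..t}|lebesgue. H s)"
    unfolding sums_def .
qed

lemma exists_whitney:
  assumes "0 \<le> s" "s < t" "t \<le> 1"
  shows "\<exists>i. s \<in> whitney i (cell i t)"
proof -
  have t: "0 \<le> t" using assms by simp
  have "\<forall>\<^sub>F n in sequentially. s < left_end n t" using left_end_tendsto[OF t] assms by (intro order_tendstoD) auto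
  then obtain n where n: "s < left_end n t" by (auto simp: eventually_sequentially)
  define m where "m = (LEAST n. s < left_end n t)"
  have m: "s < left_end m t" unfolding m_def by (rule LeastI[of _ n]) (rule n)
  have "left_end 0 t \<le> 0" using assms t by (simp add: left_end_def nat_le_iff floor_le_iff)
  then have "m \<noteq> 0" using m assms by (intro notI) simp
  then obtain i where i: "m = Suc i" using not0_implies_Suc by blast
  have "\<not> s < left_end i t" using not_less_Least[of i "\<lambda>n. s < left_end n t"] i by (simp add: m_def)
  then show ?thesis using m i unfolding whitney_cell[OF t] by (intro exI[of _ i]) (auto simp: whitney_cell[OF t])
qed

lemma kernel_le_on_whitney:
  assumes s: "s \<in> whitney i (cell i t)" and t: "0 \<le> t" and \<beta>: "b0 \<le> \<beta>" "\<bar>\<beta>\<bar> \<le> real B" "-1 \<le> \<beta>" "1 \<le> B"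
  shows "(t - s) powr \<beta> \<le> 4 ^ B * mesh i powr b0"
proof -
  define y where "y = (t - s) / mesh i"
  have y: "1 / 2 \<le> y" "y \<le> 4"
    using whitney_dist(1,2)[OF s t refl] mesh_pos(1)[of i] by (simp_all add: y_def field_simps)
  have "y powr \<beta> \<le> 4 ^ B"
  proof (cases "1 \<le> y")
    case True
    have "y powr \<beta> \<le> y powr real B" using True \<beta> by (intro powr_mono) auto
    also have "\<dots> \<le> 4 powr real B" using y by (intro powr_mono2) auto
    finally show ?thesis by (simp add: powr_realpow)
  next
    case False
    have "y powr \<beta> \<le> y powr (-1)" using False y \<beta> by (intro powr_mono') auto
    also have "\<dots> = 1 / y" using y by (simp add: powr_minus divide_simps)
    also have "\<dots> \<le> 4 ^ 1" using y by (simp add: divide_simps)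
    also have "\<dots> \<le> 4 ^ B" using \<beta> by (intro power_increasing) auto
    finally show ?thesis .
  qed
  moreover have "mesh i powr \<beta> \<le> mesh i powr b0" using \<beta> mesh_le_1 by (intro powr_mono') auto
  ultimately have "y powr \<beta> * mesh i powr \<beta> \<le> 4 ^ B * mesh i powr b0" by (intro mult_mono) auto
  moreover have "t - s = y * mesh i" by (simp add: y_def)
  ultimately show ?thesis by (simp only: powr_mult)
qed


section \<open>Taylor expansion of the kernel in the source variable\<close>

text \<open>
  The recursion for binomial coefficients grows no faster than \<open>(m + 1) ^ B\<close>, by Bernoulli's inequality. The bound is
  uniform in \<open>\<beta>\<close>, as it has to hold for all values of the order at once.
\<close>

lemma abs_gbinomial_le:
  fixes \<beta> :: real
  assumes "\<bar>\<beta>\<bar> \<le> real B" "1 \<le> B"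
  shows "\<bar>\<beta> gchoose m\<bar> \<le> (real m + 1) ^ B"
proof (induction m)
  case 0
  then show ?case by simp
next
  case (Suc m)
  have "(\<beta> gchoose Suc m) * (real m + 1) = (\<beta> gchoose m) * (\<beta> - real m)"
    using gbinomial_mult_1[of \<beta> m] by (simp add: algebra_simps)
  then have "\<bar>\<beta> gchoose Suc m\<bar> * (real m + 1) = \<bar>\<beta> gchoose m\<bar> * \<bar>\<beta> - real m\<bar>"
    by (metis abs_mult abs_of_nonneg of_nat_0_le_iff add_nonneg_nonneg zero_le_one)
  also have "\<dots> \<le> (real m + 1) ^ B * (real m + 1 + real B)"
    using Suc assms by (intro mult_mono) auto
  also have "\<dots> = (real m + 1) ^ B * (1 + real B * (1 / (real m + 1))) * (real m + 1)"
    by (simp add: field_simps)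
  also have "\<dots> \<le> (real m + 1) ^ B * (1 + 1 / (real m + 1)) ^ B * (real m + 1)"
  proof -
    have "-1 \<le> 1 / (real m + 1)" by (rule order_trans[of _ 0]) auto
    then have "1 + real B * (1 / (real m + 1)) \<le> (1 + 1 / (real m + 1)) ^ B" by (rule Bernoulli_inequality)
    then show ?thesis by (intro mult_right_mono mult_left_mono) auto
  qed
  also have "(real m + 1) ^ B * (1 + 1 / (real m + 1)) ^ B = (real (Suc m) + 1) ^ B"
    by (simp add: power_mult_distrib[symmetric] field_simps)
  finally show ?case by (simp add: mult_le_cancel_right)
qed

text \<open>
  The factor of the Taylor term of degree \<open>m\<close> that depends on the function, and on \<open>t\<close> only through its cell. Scaling by
  the radius bounds the power by 1.
\<close>

definition moment :: "nat \<Rightarrow> nat \<Rightarrow> (real \<Rightarrow> real) \<Rightarrow> nat \<Rightarrow> real" where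
  "moment i m g a = (LINT s:whitney i a|lebesgue. ((ctr i a - s) / rad i a) ^ m * g s)"

text \<open>
  The remaining factor of the Taylor term of degree \<open>m\<close>; it carries the whole dependence on the order.
\<close>

definition weight :: "(real \<Rightarrow> real) \<Rightarrow> nat \<Rightarrow> nat \<Rightarrow> real \<Rightarrow> real" where
  "weight \<alpha> i m t = (let a = cell i t in 1 / Gamma (\<alpha> t) * (t - ctr i a) powr (\<alpha> t - 1) *
     ((\<alpha> t - 1) gchoose m) * (rad i a / (t - ctr i a)) ^ m)"

lemma moment_integrable:
  fixes g :: "real \<Rightarrow> real"
  assumes g: "integrable lebesgue g"
  shows "set_integrable lebesgue (whitney i a) (\<lambda>s. ((ctr i a - s) / rad i a) ^ m * g s)"
    "\<bar>moment i m g a\<bar> \<le> (LINT s:whitney i a|lebesgue. \<bar>g s\<bar>)"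
proof -
  have gi: "set_integrable lebesgue (whitney i a) g"
    unfolding set_integrable_def using g by (intro integrable_mult_indicator) auto
  have le: "norm (indicat_real (whitney i a) s *\<^sub>R (((ctr i a - s) / rad i a) ^ m * g s)) \<le> norm (indicat_real (whitney i a) s *\<^sub>R g s)" for s
  proof (cases "s \<in> whitney i a")
    case True
    then have "\<bar>(ctr i a - s) / rad i a\<bar> \<le> 1" using rad_bounds(3)[of i a] by (auto simp: whitney_eq_ball abs_le_iff)
    then have "\<bar>(ctr i a - s) / rad i a\<bar> ^ m * \<bar>g s\<bar> \<le> 1 * \<bar>g s\<bar>" by (intro mult_right_mono power_le_one) auto
    then show ?thesis using True by (simp add: abs_mult power_abs)
  qed simp
  show 1: "set_integrable lebesgue (whitney i a) (\<lambda>s. ((ctr i a - s) / rad i a) ^ m * g s)"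
    unfolding set_integrable_def
  proof (rule Bochner_Integration.integrable_bound[OF gi[unfolded set_integrable_def]])
    have [measurable]: "g \<in> borel_measurable lebesgue" using g by auto
    have "(\<lambda>s::real. s) \<in> borel_measurable lebesgue" using id_borel_measurable_lebesgue by (simp add: id_def)
    then show "(\<lambda>s. indicat_real (whitney i a) s *\<^sub>R (((ctr i a - s) / rad i a) ^ m * g s)) \<in> borel_measurable lebesgue"
      by measurable
  qed (use le in auto)
  have "\<bar>moment i m g a\<bar> \<le> (\<integral>s. norm (indicat_real (whitney i a) s *\<^sub>R (((ctr i a - s) / rad i a) ^ m * g s)) \<partial>lebesgue)"
    unfolding moment_def set_lebesgue_integral_def real_norm_def[symmetric] by (rule integral_norm_bound)
  also have "\<dots> \<le> (\<integral>s. norm (indicat_real (whitney i a) s *\<^sub>R g s) \<partial>lebesgue)"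
    using gi 1 le by (intro integral_mono) (auto simp: set_integrable_def intro: integrable_norm)
  also have "\<dots> = (LINT s:whitney i a|lebesgue. \<bar>g s\<bar>)"
    unfolding set_lebesgue_integral_def by (intro Bochner_Integration.integral_cong) (auto simp: indicator_def)
  finally show "\<bar>moment i m g a\<bar> \<le> (LINT s:whitney i a|lebesgue. \<bar>g s\<bar>)" .
qed

lemma abs_weight_le:
  assumes t: "0 \<le> t" and a: "0 < \<alpha> t" "\<bar>\<alpha> t - 1\<bar> \<le> real B" "1 \<le> B" and U: "1 / Gamma (\<alpha> t) \<le> U"
  shows "\<bar>weight \<alpha> i m t\<bar> \<le> U * 3 ^ B * mesh i powr (\<alpha> t - 1) * (real m + 1) ^ B * (1 / 2) ^ m"
proof -
  let ?a = "cell i t"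
  let ?d = "t - ctr i ?a"
  note d = ctr_dist[OF t refl, of i]
  have d0: "0 < ?d" using d(1) mesh_pos(1)[of i] by linarith
  have 1: "?d powr (\<alpha> t - 1) \<le> 3 ^ B * mesh i powr (\<alpha> t - 1)"
  proof -
    define y where "y = ?d / mesh i"
    have y: "1 \<le> y" "y \<le> 3"
      using d(1,2) mesh_pos(1)[of i] unfolding y_def by (simp_all add: field_simps)
    have "y powr (\<alpha> t - 1) \<le> y powr real B" using y a by (intro powr_mono) auto
    also have "\<dots> \<le> 3 powr real B" using y by (intro powr_mono2) auto
    also have "\<dots> = 3 ^ B" by (simp add: powr_realpow)
    finally have "y powr (\<alpha> t - 1) * mesh i powr (\<alpha> t - 1) \<le> 3 ^ B * mesh i powr (\<alpha> t - 1)" by (intro mult_right_mono) auto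
    moreover have "?d = y * mesh i" by (simp add: y_def)
    ultimately show ?thesis by (simp only: powr_mult)
  qed
  have 2: "\<bar>rad i ?a / ?d\<bar> ^ m \<le> (1 / 2) ^ m"
    using d(3) d0 rad_bounds(3)[of i ?a] by (intro power_mono) (auto simp: field_simps)
  have G: "0 < Gamma (\<alpha> t)" using a by (intro Gamma_real_pos)
  have "\<bar>weight \<alpha> i m t\<bar> = 1 / Gamma (\<alpha> t) * ?d powr (\<alpha> t - 1) * \<bar>(\<alpha> t - 1) gchoose m\<bar> * \<bar>rad i ?a / ?d\<bar> ^ m"
    using G by (simp add: weight_def Let_def abs_mult power_abs)
  also have "\<dots> \<le> U * (3 ^ B * mesh i powr (\<alpha> t - 1)) * (real m + 1) ^ B * (1 / 2) ^ m"
    using G 1 2 U abs_gbinomial_le[OF a(2,3), of m] order_trans[OF _ U, of 0]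
    by (intro mult_mono mult_nonneg_nonneg) auto
  also have "\<dots> = U * 3 ^ B * mesh i powr (\<alpha> t - 1) * (real m + 1) ^ B * (1 / 2) ^ m" by (simp only: mult.assoc)
  finally show ?thesis .
qed

text \<open>
  Covers the decay in all three parameters of a block: \<open>\<gamma> = 1\<close> gives geometric decay, and the block number
  decays with the exponent \<open>\<gamma>\<close> of the order function.
\<close>

lemma summable_poly_stretched_exp:
  fixes a c \<gamma> :: real
  assumes a: "0 \<le> a" and c: "0 < c" and g: "0 < \<gamma>"
  shows "summable (\<lambda>k::nat. (real k + 1) powr a * exp (- c * real k powr \<gamma>))"
proof -
  define c' where "c' = c / 2 powr \<gamma>"
  define K where "K = ((a + 2) / \<gamma> / c') powr ((a + 2) / \<gamma>)"
  have c': "0 < c'" using c by (simp add: c'_def)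
  have le: "(real k + 1) powr a * exp (- c * real k powr \<gamma>) \<le> K * exp c * inverse (real (Suc k) ^ 2)" for k :: nat
  proof -
    let ?y = "(real k + 1) powr \<gamma>"
    have "c' * ?y \<le> c * real k powr \<gamma> + c"
    proof (cases "k = 0")
      case True
      then show ?thesis using c g by (simp add: c'_def divide_le_eq ge_one_powr_ge_zero mult_le_cancel_left1)
    next
      case False
      have "?y \<le> (2 * real k) powr \<gamma>" using False g by (intro powr_mono2) auto
      then have "c * (?y / 2 powr \<gamma>) \<le> c * real k powr \<gamma>"
        using c by (intro mult_left_mono) (auto simp: powr_mult field_simps)
      then show ?thesis using c by (simp add: c'_def)
    qed
    then have e: "exp (- c * real k powr \<gamma>) \<le> exp c * exp (- (c' * ?y))" by (simp add: exp_add[symmetric])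
    have "?y powr ((a + 2) / \<gamma>) \<le> K * exp (c' * ?y)"
      unfolding K_def using a g c' by (intro powr_le_exp) auto
    then have "(real k + 1) powr (a + 2) * exp (- (c' * ?y)) \<le> K * exp (c' * ?y) * exp (- (c' * ?y))"
      using g by (intro mult_right_mono) (auto simp: powr_powr)
    also have "\<dots> = K" by (simp add: exp_minus)
    finally have K: "(real k + 1) powr (a + 2) * exp (- (c' * ?y)) \<le> K" .
    have "(real k + 1) powr a * exp (- c * real k powr \<gamma>) \<le> (real k + 1) powr a * (exp c * exp (- (c' * ?y)))"
      using e by (intro mult_left_mono) auto
    also have "\<dots> = exp c * ((real k + 1) powr (a + 2) * exp (- (c' * ?y))) * (real k + 1) powr (- 2)"
    proof -
      have "(real k + 1) powr a = (real k + 1) powr (a + 2) * (real k + 1) powr (- 2)" by (simp add: powr_add[symmetric])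
      then show ?thesis by (simp only: mult_ac)
    qed
    also have "\<dots> \<le> exp c * K * (real k + 1) powr (- 2)"
      using K by (intro mult_right_mono mult_left_mono) auto
    also have "(real k + 1) powr (- 2) = inverse (real (Suc k) ^ 2)"
      by (simp only: powr_minus of_nat_Suc add.commute[of 1]) (simp add: powr_numeral)
    finally show ?thesis by (simp add: mult_ac)
  qed
  have "summable (\<lambda>k. K * exp c * inverse (real (Suc k) ^ 2))"
    using inverse_power_summable[of 2] by (intro summable_mult) (simp only: summable_Suc_iff[of "\<lambda>n. inverse (real n ^ 2)"], simp)
  then show ?thesis
  proof (rule summable_comparison_test'[where N = 0])
    fix k :: nat
    show "norm ((real k + 1) powr a * exp (- c * real k powr \<gamma>)) \<le> K * exp c * inverse (real (Suc k) ^ 2)"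
      using le[of k] by (simp only: real_norm_def abs_mult abs_of_nonneg[OF powr_ge_zero] abs_exp_cancel)
  qed
qed

lemma summable_poly_geometric: "summable (\<lambda>m. (real m + 1) ^ B * (1 / 2) ^ m)"
proof -
  have "summable (\<lambda>m::nat. (real m + 1) powr real B * exp (- ln 2 * real m powr 1))"
    by (rule summable_poly_stretched_exp) auto
  moreover have "(real m + 1) powr real B * exp (- ln 2 * real m powr 1) = (real m + 1) ^ B * (1 / 2) ^ m" for m :: nat
  proof -
    have "exp (- ln 2 * real m powr 1) = (2::real) powr (- real m)" by (simp add: powr_def mult.commute)
    also have "\<dots> = (1 / 2) ^ m" by (simp add: powr_minus powr_realpow power_one_over inverse_eq_divide)
    finally show ?thesis by (simp add: powr_realpow)
  qed
  ultimately show ?thesis by simp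
qed

text \<open>
  The binomial series in \<open>z = (c - s) / (t - c)\<close>, where \<open>c\<close> is the centre of the Whitney set. It may be
  integrated termwise because \<open>\<bar>z\<bar> \<le> 1/2\<close>.
\<close>

lemma weight_moment_sums:
  fixes g :: "real \<Rightarrow> real"
  assumes t: "0 \<le> t" and a: "0 < \<alpha> t" "\<bar>\<alpha> t - 1\<bar> \<le> real B" "1 \<le> B" and g: "integrable lebesgue g"
  shows "(\<lambda>m. weight \<alpha> i m t * moment i m g (cell i t)) sums
     (1 / Gamma (\<alpha> t) * (LINT s:whitney i (cell i t)|lebesgue. (t - s) powr (\<alpha> t - 1) * g s))"
proof -
  let ?a = "cell i t" let ?W = "whitney i ?a" let ?d = "t - ctr i ?a" let ?b = "\<alpha> t - 1"
  define f where "f m s = indicat_real ?W s * (weight \<alpha> i m t * (((ctr i ?a - s) / rad i ?a) ^ m * g s))" for m s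
  note d = ctr_dist[OF t refl, of i]
  have d0: "0 < ?d" using d(1) mesh_pos(1)[of i] by linarith
  note rad0 = rad_bounds(3)[of i ?a]
  define C where "C = 1 / Gamma (\<alpha> t) * 3 ^ B * mesh i powr (\<alpha> t - 1)"
  have wt: "\<bar>weight \<alpha> i m t\<bar> \<le> C * ((real m + 1) ^ B * (1 / 2) ^ m)" for m
    using abs_weight_le[where \<alpha> = \<alpha> and i = i and m = m, OF t a order_refl] unfolding C_def by (simp only: mult.assoc)
  have sumw: "summable (\<lambda>m. \<bar>weight \<alpha> i m t\<bar>)"
    by (rule summable_comparison_test'[OF summable_mult[OF summable_poly_geometric[of B], of C], where N=0])
      (use wt in simp)
  have mi: "integrable lebesgue (\<lambda>s. indicat_real ?W s * (((ctr i ?a - s) / rad i ?a) ^ m * g s))" for m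
    using moment_integrable(1)[OF g, of i ?a m] by (simp add: set_integrable_def)
  have f_eq: "f m = (\<lambda>s. weight \<alpha> i m t * (indicat_real ?W s * (((ctr i ?a - s) / rad i ?a) ^ m * g s)))" for m
    by (simp only: f_def fun_eq_iff mult.left_commute) simp
  have fi: "integrable lebesgue (f m)" for m
    unfolding f_eq by (rule integrable_mult_right[OF mi])
  have fle: "\<bar>f m s\<bar> \<le> \<bar>weight \<alpha> i m t\<bar> * \<bar>g s\<bar>" for m s
  proof (cases "s \<in> ?W")
    case True
    then have "\<bar>(ctr i ?a - s) / rad i ?a\<bar> \<le> 1" using rad0 by (auto simp: whitney_eq_ball abs_le_iff)
    then have "\<bar>weight \<alpha> i m t\<bar> * (\<bar>(ctr i ?a - s) / rad i ?a\<bar> ^ m * \<bar>g s\<bar>) \<le> \<bar>weight \<alpha> i m t\<bar> * (1 * \<bar>g s\<bar>)"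
      by (intro mult_left_mono mult_right_mono power_le_one) auto
    then show ?thesis using True by (simp add: f_def abs_mult power_abs)
  qed (simp add: f_def)
  have "(\<lambda>m. integral\<^sup>L lebesgue (f m)) sums (\<integral>s. (\<Sum>m. f m s) \<partial>lebesgue)"
  proof (rule sums_integral[OF fi])
    show "AE s in lebesgue. summable (\<lambda>m. norm (f m s))"
      by (intro AE_I2, rule summable_comparison_test'[OF summable_mult2[OF sumw], where N=0]) (use fle in simp)
    show "summable (\<lambda>m. \<integral>s. norm (f m s) \<partial>lebesgue)"
    proof (rule summable_comparison_test'[OF summable_mult2[OF sumw, of "\<integral>s. \<bar>g s\<bar> \<partial>lebesgue"], where N=0])
      fix m
      have "(\<integral>s. norm (f m s) \<partial>lebesgue) \<le> (\<integral>s. \<bar>weight \<alpha> i m t\<bar> * \<bar>g s\<bar> \<partial>lebesgue)"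
        using fle g fi by (intro integral_mono) auto
      then show "norm (\<integral>s. norm (f m s) \<partial>lebesgue) \<le> \<bar>weight \<alpha> i m t\<bar> * (\<integral>s. \<bar>g s\<bar> \<partial>lebesgue)"
        by simp
    qed
  qed
  moreover have "integral\<^sup>L lebesgue (f m) = weight \<alpha> i m t * moment i m g ?a" for m
  proof -
    have "integral\<^sup>L lebesgue (f m) = (\<integral>s. weight \<alpha> i m t * (indicat_real ?W s * (((ctr i ?a - s) / rad i ?a) ^ m * g s)) \<partial>lebesgue)"
      by (simp only: f_eq)
    also have "\<dots> = weight \<alpha> i m t * moment i m g ?a"
      unfolding moment_def set_lebesgue_integral_def using mi by simp
    finally show ?thesis .
  qed
  moreover have "(\<Sum>m. f m s) = indicat_real ?W s * (1 / Gamma (\<alpha> t) * ((t - s) powr ?b * g s))" for s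
  proof (cases "s \<in> ?W")
    case True
    \<comment> \<open>Here \<open>t - s = (t - c) * (1 + z)\<close> for the centre \<open>c\<close> of the Whitney set.\<close>
    define z where "z = (ctr i ?a - s) / ?d"
    have "2 * \<bar>ctr i ?a - s\<bar> \<le> 2 * rad i ?a" using whitney_dist(3)[OF True t refl] by simp
    also have "\<dots> \<le> ?d" by (rule d(3))
    finally have "2 * \<bar>ctr i ?a - s\<bar> \<le> ?d" .
    then have "\<bar>z\<bar> \<le> 1 / 2" using d0 by (simp add: z_def abs_divide field_simps)
    then have "(\<lambda>m. (?b gchoose m) * z ^ m) sums (1 + z) powr ?b" by (intro gen_binomial_real) auto
    then have "(\<lambda>m. 1 / Gamma (\<alpha> t) * ?d powr ?b * g s * ((?b gchoose m) * z ^ m)) sums (1 / Gamma (\<alpha> t) * ?d powr ?b * g s * (1 + z) powr ?b)"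
      by (intro sums_mult)
    moreover have "f m s = 1 / Gamma (\<alpha> t) * ?d powr ?b * g s * ((?b gchoose m) * z ^ m)" for m
    proof -
      have "(rad i ?a / ?d) ^ m * ((ctr i ?a - s) / rad i ?a) ^ m = z ^ m"
        using rad0 d0 by (simp add: z_def power_mult_distrib[symmetric])
      moreover have "f m s = 1 / Gamma (\<alpha> t) * ?d powr ?b * g s * ((?b gchoose m) * ((rad i ?a / ?d) ^ m * ((ctr i ?a - s) / rad i ?a) ^ m))"
        using True by (simp add: f_def weight_def Let_def mult_ac)
      ultimately show ?thesis by simp
    qed
    ultimately have "(\<Sum>m. f m s) = 1 / Gamma (\<alpha> t) * ?d powr ?b * g s * (1 + z) powr ?b" by (simp add: sums_iff)
    also have "\<dots> = 1 / Gamma (\<alpha> t) * (?d * (1 + z)) powr ?b * g s" by (simp add: powr_mult)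
    also have "?d * (1 + z) = t - s" using d0 by (simp add: z_def field_simps)
    finally show ?thesis using True by simp
  qed (simp add: f_def)
  ultimately have "(\<lambda>m. weight \<alpha> i m t * moment i m g ?a) sums (\<integral>s. indicat_real ?W s * (1 / Gamma (\<alpha> t) * ((t - s) powr ?b * g s)) \<partial>lebesgue)"
    by simp
  also have "(\<integral>s. indicat_real ?W s * (1 / Gamma (\<alpha> t) * ((t - s) powr ?b * g s)) \<partial>lebesgue)
      = (\<integral>s. 1 / Gamma (\<alpha> t) * (indicat_real ?W s * ((t - s) powr ?b * g s)) \<partial>lebesgue)"
    by (intro Bochner_Integration.integral_cong) auto
  also have "\<dots> = 1 / Gamma (\<alpha> t) * (LINT s:?W|lebesgue. (t - s) powr ?b * g s)"
    unfolding set_lebesgue_integral_def by (subst integral_mult_right_zero) simp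
  finally show ?thesis .
qed


section \<open>Norms of moments and of functions governed by cells\<close>

lemma measurable_cell [measurable]: "cell i \<in> borel \<rightarrow>\<^sub>M count_space UNIV"
  unfolding cell_def[abs_def] by measurable

lemma borel_imp_lebesgue_on:
  assumes "f \<in> borel_measurable borel"
  shows "f \<in> borel_measurable (lebesgue_on S)"
  using assms by (intro measurable_restrict_space1 measurable_completion) simp

lemma nn_integral_cell:
  fixes \<Psi> :: "nat \<Rightarrow> ennreal"
  shows "(\<integral>\<^sup>+t. \<Psi> (cell i t) * indicator {0..} t \<partial>lebesgue) = (\<Sum>a. \<Psi> a * ennreal (mesh i))"
proof -
  let ?I = "\<lambda>a. {real a * mesh i..<real (Suc a) * mesh i}"
  have "\<Psi> (cell i t) * indicator {0..} t = (\<Sum>a. \<Psi> a * indicator (?I a) t)" for t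
  proof (cases "0 \<le> t")
    case True
    have "(\<Sum>a. \<Psi> a * indicator (?I a) t) = (\<Sum>a\<in>{cell i t}. \<Psi> a * indicator (?I a) t)"
      using cell_index_iff[OF mesh_pos(1), of t _ i] True
      by (intro suminf_finite) (auto simp: cell_def indicator_def simp del: atLeastLessThan_iff)
    also have "\<dots> = \<Psi> (cell i t)"
      using cell_index_iff[OF mesh_pos(1), of t "cell i t" i] True by (simp add: cell_def indicator_def del: atLeastLessThan_iff)
    finally show ?thesis using True by simp
  next
    case False
    have "t \<notin> ?I a" for a using cell_index_iff[OF mesh_pos(1), of t a i] False by blast
    then show ?thesis using False by (simp add: indicator_def del: atLeastLessThan_iff)
  qed
  then have "(\<integral>\<^sup>+t. \<Psi> (cell i t) * indicator {0..} t \<partial>lebesgue) = (\<integral>\<^sup>+t. (\<Sum>a. \<Psi> a * indicator (?I a) t) \<partial>lebesgue)"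
    by simp
  also have "\<dots> = (\<Sum>a. \<integral>\<^sup>+t. \<Psi> a * indicator (?I a) t \<partial>lebesgue)" 
    by (intro nn_integral_suminf borel_measurable_times_ennreal borel_measurable_const borel_measurable_indicator) simp
  also have "(\<lambda>a. \<integral>\<^sup>+t. \<Psi> a * indicator (?I a) t \<partial>lebesgue) = (\<lambda>a. \<Psi> a * ennreal (mesh i))"
    by (intro ext, subst nn_integral_cmult_indicator) (auto simp: algebra_simps)
  finally show ?thesis .
qed

text \<open>
  Whitney sets of neighbouring cells overlap, but at most twice.
\<close>

lemma suminf_indicator_whitney_le: "(\<Sum>a. indicator (whitney i a) s) \<le> (2::ennreal)"
proof -
  \<comment> \<open>If \<open>s\<close> lies in cell \<open>b\<close>, then only the Whitney sets of the cells \<open>b + 2\<close> and \<open>b + 3\<close> can contain it.\<close>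
  define b where "b = \<lfloor>s / mesh i\<rfloor>"
  let ?S = "{nat (b + 2), nat (b + 3)}"
  have S: "a \<in> ?S" if "s \<in> whitney i a" for a
  proof -
    have "s / mesh i < real a - 1" "2 * real (a div 2) - 2 \<le> s / mesh i"
      using that mesh_pos(1)[of i] by (auto simp: whitney_def field_simps)
    moreover have "real_of_int b \<le> s / mesh i" "s / mesh i < real_of_int b + 1" by (auto simp: b_def)
    ultimately have "real_of_int b < real_of_int (int a - 1)" "real_of_int (2 * int (a div 2) - 2) < real_of_int (b + 1)" by auto
    then have "b < int a - 1" "2 * int (a div 2) - 2 < b + 1" by (simp_all only: of_int_less_iff)
    then have "int a = b + 2 \<or> int a = b + 3" by linarith
    then show ?thesis by auto
  qed
  have "(\<Sum>a. indicator (whitney i a) s) = (\<Sum>a\<in>?S. indicator (whitney i a) s :: ennreal)"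
    using S by (intro suminf_finite) (auto simp: indicator_def)
  also have "\<dots> \<le> of_nat (card ?S) * 1" by (intro sum_bounded_above) (auto simp: indicator_def)
  also have "\<dots> \<le> 2" by (auto simp: card_insert_if)
  finally show ?thesis .
qed

lemma suminf_nn_integral_whitney_le:
  assumes [measurable]: "h \<in> borel_measurable lebesgue"
  shows "(\<Sum>a. \<integral>\<^sup>+s. h s * indicator (whitney i a) s \<partial>lebesgue) \<le> 2 * (\<integral>\<^sup>+s. h s \<partial>lebesgue)"
proof -
  have "(\<Sum>a. \<integral>\<^sup>+s. h s * indicator (whitney i a) s \<partial>lebesgue) = (\<integral>\<^sup>+s. (\<Sum>a. h s * indicator (whitney i a) s) \<partial>lebesgue)"
    by (intro nn_integral_suminf[symmetric]) simp
  also have "\<dots> \<le> (\<integral>\<^sup>+s. 2 * h s \<partial>lebesgue)"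
    using suminf_indicator_whitney_le by (intro nn_integral_mono) (auto simp: mult.commute[of 2] intro!: mult_left_mono)
  also have "\<dots> = 2 * (\<integral>\<^sup>+s. h s \<partial>lebesgue)" by (intro nn_integral_cmult) simp
  finally show ?thesis .
qed

text \<open>
  The map to the moments of one block, from \<open>L_p\<close> to \<open>l_p\<close>: a Whitney set has length at most \<open>2 * mesh i\<close>, which gives
  the factor \<open>mesh i powr (1 - u)\<close>.
\<close>

lemma moment_norm:
  fixes g :: "real \<Rightarrow> real"
  assumes g: "integrable lebesgue g" "Lq_le lebesgue u g 1" and u: "0 \<le> u" "u \<le> 1"
  shows "Lq_le (count_space {..<N}) u (\<lambda>j. moment i m g (k * N + j)) (2 * mesh i powr (1 - u))"
proof (cases "u = 0")
  case True
  have "\<bar>moment i m g a\<bar> \<le> 2 * mesh i" for a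
  proof -
    have "\<bar>moment i m g a\<bar> \<le> (LINT s:whitney i a|lebesgue. \<bar>g s\<bar>)" by (rule moment_integrable(2)[OF g(1)])
    also have "\<dots> \<le> (LINT s:whitney i a|lebesgue. 1)"
      unfolding set_lebesgue_integral_def
    proof (rule integral_mono_AE)
      have "integrable lebesgue (\<lambda>s. indicat_real (whitney i a) s *\<^sub>R g s)"
        using g(1) by (intro integrable_mult_indicator) auto
      then show "integrable lebesgue (\<lambda>s. indicat_real (whitney i a) s *\<^sub>R \<bar>g s\<bar>)"
        using integrable_norm by (fastforce simp: abs_mult)
      show "integrable lebesgue (\<lambda>s. indicat_real (whitney i a) s *\<^sub>R 1)"
        by (simp add: measure_whitney less_top[symmetric] integrable_indicator_iff)
      show "AE s in lebesgue. indicat_real (whitney i a) s *\<^sub>R \<bar>g s\<bar> \<le> indicat_real (whitney i a) s *\<^sub>R 1"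
        using g(2) True by (auto simp: Lq_le_def indicator_def elim!: eventually_mono)
    qed
    also have "\<dots> = 2 * rad i a" using rad_bounds(3)[of i a] by (simp add: set_lebesgue_integral_def measure_def measure_whitney)
    also have "\<dots> \<le> 2 * mesh i" using rad_bounds(2)[of i a] by simp
    finally show ?thesis .
  qed
  then show ?thesis using True by (simp add: Lq_le_count_space)
next
  case False
  define s where "s = 1 / u"
  have s: "1 \<le> s" "u * s = 1" using u False by (auto simp: s_def)
  have gm[measurable]: "g \<in> borel_measurable lebesgue" using g(1) by auto
  let ?I = "\<lambda>a. \<integral>\<^sup>+x. ennreal (\<bar>g x\<bar> powr s) * indicator (whitney i a) x \<partial>lebesgue"
  \<comment> \<open>Jensen on each Whitney set; the sum over the cells then counts every point at most twice.\<close>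
  have mom: "ennreal (\<bar>moment i m g a\<bar> powr s) \<le> ennreal ((2 * mesh i) powr (s - 1)) * ?I a" for a
  proof -
    let ?L = "lebesgue_on (whitney i a)"
    have em: "emeasure ?L (space ?L) = ennreal (2 * rad i a)" by (simp add: emeasure_restrict_space measure_whitney)
    have "ennreal (\<bar>moment i m g a\<bar> powr s) \<le> ennreal ((2 * rad i a) powr (s - 1)) * (\<integral>\<^sup>+x. ennreal (\<bar>g x\<bar> powr s) \<partial>?L)"
    proof (rule jensen_powr[OF _ _ s(1) em])
      show "(\<lambda>x. \<bar>g x\<bar>) \<in> borel_measurable ?L" by (intro measurable_restrict_space1) simp
      have gi: "integrable lebesgue (\<lambda>x. indicat_real (whitney i a) x * \<bar>g x\<bar>)"
        using integrable_mult_indicator[of "whitney i a" lebesgue "\<lambda>x. \<bar>g x\<bar>"] g(1) by simp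
      have "ennreal \<bar>moment i m g a\<bar> \<le> ennreal (\<integral>x. indicat_real (whitney i a) x * \<bar>g x\<bar> \<partial>lebesgue)"
        using moment_integrable(2)[OF g(1), of i m a] by (intro ennreal_leI) (simp add: set_lebesgue_integral_def)
      also have "\<dots> = (\<integral>\<^sup>+x. ennreal (indicat_real (whitney i a) x * \<bar>g x\<bar>) \<partial>lebesgue)"
        by (intro nn_integral_eq_integral[symmetric] gi) auto
      also have "\<dots> = (\<integral>\<^sup>+x. ennreal \<bar>g x\<bar> \<partial>?L)"
        by (subst nn_integral_restrict_space) (auto intro!: nn_integral_cong simp: indicator_def)
      finally show "ennreal \<bar>moment i m g a\<bar> \<le> (\<integral>\<^sup>+x. ennreal \<bar>g x\<bar> \<partial>?L)" .
    qed (use rad_bounds(3) in auto)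
    also have "(\<integral>\<^sup>+x. ennreal (\<bar>g x\<bar> powr s) \<partial>?L) = ?I a" by (subst nn_integral_restrict_space) auto
    also have "ennreal ((2 * rad i a) powr (s - 1)) * ?I a \<le> ennreal ((2 * mesh i) powr (s - 1)) * ?I a"
      using rad_bounds[of i a] s by (intro mult_right_mono ennreal_leI powr_mono2) auto
    finally show ?thesis .
  qed
  have "ennreal (\<Sum>j<N. \<bar>moment i m g (k * N + j)\<bar> powr s) = (\<Sum>j<N. ennreal (\<bar>moment i m g (k * N + j)\<bar> powr s))"
    by (simp add: sum_ennreal)
  also have "\<dots> \<le> (\<Sum>j<N. ennreal ((2 * mesh i) powr (s - 1)) * ?I (k * N + j))" by (intro sum_mono mom)
  also have "\<dots> = ennreal ((2 * mesh i) powr (s - 1)) * (\<Sum>j<N. ?I (k * N + j))" by (rule sum_distrib_left[symmetric])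
  also have "\<dots> \<le> ennreal ((2 * mesh i) powr (s - 1)) * (2 * ennreal 1)"
  proof (rule mult_left_mono)
    have "(\<Sum>j<N. ?I (k * N + j)) = (\<Sum>a\<in>(\<lambda>j. k * N + j) ` {..<N}. ?I a)" by (subst sum.reindex) (auto simp: inj_on_def)
    also have "\<dots> \<le> (\<Sum>a. ?I a)" by (intro sum_le_suminf) auto
    also have "\<dots> \<le> 2 * (\<integral>\<^sup>+x. ennreal (\<bar>g x\<bar> powr s) \<partial>lebesgue)"
      by (intro suminf_nn_integral_whitney_le) simp
    also have "\<dots> \<le> 2 * ennreal 1"
      using g(2) False by (intro mult_left_mono) (auto simp: Lq_le_def s_def)
    finally show "(\<Sum>j<N. ?I (k * N + j)) \<le> 2 * ennreal 1" .
  qed simp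
  also have "ennreal ((2 * mesh i) powr (s - 1)) * (2 * ennreal 1) = ennreal ((2 * mesh i powr (1 - u)) powr s)"
  proof -
    have "(2 * mesh i) powr (s - 1) * 2 = 2 powr s * mesh i powr (s - 1)" by (simp add: powr_mult powr_diff)
    also have "mesh i powr (s - 1) = (mesh i powr (1 - u)) powr s" using s by (simp add: powr_powr algebra_simps)
    finally have "(2 * mesh i) powr (s - 1) * 2 = (2 * mesh i powr (1 - u)) powr s" by (simp only: powr_mult)
    moreover have "ennreal ((2 * mesh i) powr (s - 1)) * (2 * ennreal 1) = ennreal ((2 * mesh i) powr (s - 1)) * ennreal 2" by simp
    moreover have "\<dots> = ennreal ((2 * mesh i) powr (s - 1) * 2)" by (rule ennreal_mult[symmetric]) auto
    ultimately show ?thesis by (simp only:)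
  qed
  finally have "(\<Sum>j<N. \<bar>moment i m g (k * N + j)\<bar> powr s) \<le> (2 * mesh i powr (1 - u)) powr s" by simp
  then show ?thesis using False by (simp add: Lq_le_count_space s_def)
qed

text \<open>
  The map from sequences to functions, from \<open>l_q\<close> to \<open>L_q\<close>: each cell has length \<open>mesh i\<close>.
\<close>

lemma step_norm:
  assumes F: "\<And>t. t \<in> {0..1} \<Longrightarrow> \<bar>F t\<bar> \<le> (if cell i t div N = k then K * \<bar>d (cell i t - k * N)\<bar> else 0)"
    and N: "1 \<le> N" and K: "0 \<le> K" and v: "0 \<le> v" and e: "0 \<le> e" and d: "Lq_le (count_space {..<N}) v d e"
  shows "Lq_le (lebesgue_on {0..1}) v F (K * mesh i powr v * e)"
proof (cases "v = 0")
  case True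
  have "\<bar>F t\<bar> \<le> K * e" if t: "t \<in> {0..1}" for t
  proof (cases "cell i t div N = k")
    case k: True
    have "cell i t - k * N < N" using k N by (metis minus_div_mult_eq_mod mod_less_divisor less_le_trans zero_less_one)
    then have "K * \<bar>d (cell i t - k * N)\<bar> \<le> K * e" using d True K by (intro mult_left_mono) (auto simp: Lq_le_count_space)
    then show ?thesis using F[OF t] k by simp
  next
    case False
    then show ?thesis using F[OF t] K e by (auto intro: order_trans)
  qed
  then have "AE t in lebesgue_on {0..1}. \<bar>F t\<bar> \<le> K * e" by (intro AE_I2) simp
  then show ?thesis using True by (simp add: Lq_le_def)
next
  case False
  define s where "s = 1 / v"
  have s: "0 < s" "v * s = 1" using v False by (auto simp: s_def)
  define \<Psi> where "\<Psi> a = (if a div N = k then ennreal (K powr s * \<bar>d (a - k * N)\<bar> powr s) else 0)" for a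
  have "(\<integral>\<^sup>+t. ennreal (\<bar>F t\<bar> powr s) \<partial>lebesgue_on {0..1}) = (\<integral>\<^sup>+t. ennreal (\<bar>F t\<bar> powr s) * indicator {0..1} t \<partial>lebesgue)"
    by (subst nn_integral_restrict_space) auto
  also have "\<dots> \<le> (\<integral>\<^sup>+t. \<Psi> (cell i t) * indicator {0..} t \<partial>lebesgue)"
  proof (intro nn_integral_mono)
    fix t
    have "ennreal (\<bar>F t\<bar> powr s) \<le> \<Psi> (cell i t)" if t: "t \<in> {0..1}"
    proof -
      have "\<bar>F t\<bar> powr s \<le> (if cell i t div N = k then K * \<bar>d (cell i t - k * N)\<bar> else 0) powr s"
        using F[OF t] s by (intro powr_mono2) auto
      then show ?thesis using K by (auto simp: \<Psi>_def powr_mult intro!: ennreal_leI split: if_splits)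
    qed
    then show "ennreal (\<bar>F t\<bar> powr s) * indicator {0..1} t \<le> \<Psi> (cell i t) * indicator {0..} t"
      by (auto simp: indicator_def)
  qed
  also have "\<dots> = (\<Sum>a. \<Psi> a * ennreal (mesh i))" by (rule nn_integral_cell)
  also have "\<dots> = (\<Sum>a\<in>(\<lambda>j. k * N + j) ` {..<N}. \<Psi> a * ennreal (mesh i))"
  proof (rule suminf_finite)
    fix a assume a: "a \<notin> (\<lambda>j. k * N + j) ` {..<N}"
    have "a div N \<noteq> k"
    proof
      assume "a div N = k"
      then have "a = k * N + a mod N" "a mod N < N" using N by auto
      then show False using a by blast
    qed
    then show "\<Psi> a * ennreal (mesh i) = 0" by (simp add: \<Psi>_def)
  qed simp
  also have "\<dots> = (\<Sum>j<N. \<Psi> (k * N + j) * ennreal (mesh i))" by (subst sum.reindex) (auto simp: inj_on_def)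
  also have "\<dots> = (\<Sum>j<N. ennreal (K powr s * mesh i * \<bar>d j\<bar> powr s))"
    using N by (intro sum.cong refl) (simp add: \<Psi>_def ennreal_mult[symmetric] mult_ac div_mult_self4)
  also have "\<dots> = ennreal (\<Sum>j<N. K powr s * mesh i * \<bar>d j\<bar> powr s)" by (rule sum_ennreal) simp
  also have "\<dots> \<le> ennreal (K powr s * mesh i * e powr s)"
    unfolding sum_distrib_left[symmetric] using d False
    by (intro ennreal_leI mult_left_mono) (auto simp: Lq_le_count_space s_def)
  also have "K powr s * mesh i * e powr s = (K * mesh i powr v * e) powr s"
    using K e s by (simp add: powr_mult powr_powr)
  finally show ?thesis unfolding Lq_le_def s_def[symmetric] if_not_P[OF False] .
qed


section \<open>The operator as a series of blocks\<close>

lemma mesh_powr_sums: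
  assumes "0 < a"
  shows "summable (\<lambda>i. mesh i powr a)"
proof -
  have "mesh i powr a = (1 / 2) powr a * ((1 / 2) powr a) ^ i" for i
  proof -
    have "mesh i = (1 / 2) powr (real i + 1)" by (simp add: mesh_def powr_add powr_realpow)
    then have "mesh i powr a = (1 / 2) powr (a + a * real i)" by (simp add: powr_powr algebra_simps)
    also have "\<dots> = (1 / 2) powr a * ((1 / 2) powr a) powr real i" by (simp add: powr_add powr_powr)
    finally show ?thesis by (simp add: powr_realpow)
  qed
  moreover have "(1 / 2) powr a < (1::real)" using assms unfolding powr_def by (simp add: ln_div)
  ultimately show ?thesis by (auto intro!: summable_mult summable_geometric)
qed

text \<open>
  Uses completeness of Lebesgue measure.
\<close>

lemma borel_measurable_lebesgue_on_AE:
  fixes f h :: "real \<Rightarrow> real"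
  assumes S: "S \<in> sets lebesgue" and f: "f \<in> borel_measurable (lebesgue_on S)" and ae: "AE x in lebesgue_on S. f x = h x"
  shows "h \<in> borel_measurable (lebesgue_on S)"
proof -
  let ?f = "\<lambda>x. indicator S x *\<^sub>R f x" and ?h = "\<lambda>x. indicator S x *\<^sub>R h x"
  have f': "?f \<in> borel_measurable lebesgue" using f S by (subst (asm) borel_measurable_restrict_space_iff) auto
  have ae': "AE x in lebesgue. ?f x = ?h x"
    using ae S by (subst (asm) AE_restrict_space_iff) (auto elim!: eventually_mono simp: indicator_def)
  have "?h \<in> borel_measurable lebesgue"
  proof (rule measurableI)
    fix A :: "real set" assume "A \<in> sets borel"
    then have "?f -` A \<inter> space lebesgue \<in> sets lebesgue" using f' by (rule measurable_sets[rotated])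
    moreover have "AE x in lebesgue. x \<in> ?f -` A \<inter> space lebesgue \<longleftrightarrow> x \<in> ?h -` A \<inter> space lebesgue"
      using ae' by eventually_elim (simp only: vimage_eq Int_iff)
    ultimately show "?h -` A \<inter> space lebesgue \<in> sets lebesgue"
      using completion.in_sets_AE by blast
  qed simp
  then show ?thesis using S by (subst borel_measurable_restrict_space_iff) auto
qed

text \<open>
  The reciprocal Gamma function is entire.
\<close>

lemma rGamma_measurable: "(\<lambda>x::real. 1 / Gamma x) \<in> borel_measurable borel"
proof -
  have "(\<lambda>x::real. 1 / Gamma x) = rGamma" by (simp add: Gamma_def fun_eq_iff divide_inverse)
  moreover have "continuous_on UNIV (rGamma :: real \<Rightarrow> real)" by (intro continuous_on_rGamma continuous_on_id)
  ultimately show ?thesis by (simp add: borel_measurable_continuous_onI)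
qed

text \<open>
  With values in \<open>ennreal\<close> the bound makes sense also when \<open>X - y\<close> is not absolutely summable.
\<close>

lemma suminf_diff_bound:
  fixes X y :: "nat \<Rightarrow> real"
  assumes "X sums S" and "\<And>n. n \<ge> N \<Longrightarrow> y n = 0"
  shows "ennreal \<bar>S - (\<Sum>n<N. y n)\<bar> \<le> (\<Sum>n. ennreal \<bar>X n - y n\<bar>)"
proof -
  have "y sums (\<Sum>n<N. y n)" using assms(2) by (intro sums_finite) auto
  then have "(\<lambda>n. X n - y n) sums (S - (\<Sum>n<N. y n))" using assms(1) by (rule sums_diff[rotated])
  then have "(\<lambda>n. \<Sum>k<n. X k - y k) \<longlonglongrightarrow> S - (\<Sum>n<N. y n)" by (simp only: sums_def)
  then have lim: "(\<lambda>n. ennreal \<bar>\<Sum>k<n. X k - y k\<bar>) \<longlonglongrightarrow> ennreal \<bar>S - (\<Sum>n<N. y n)\<bar>"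
    by (intro tendsto_ennrealI tendsto_rabs)
  have "ennreal \<bar>\<Sum>k<n. X k - y k\<bar> \<le> (\<Sum>n. ennreal \<bar>X n - y n\<bar>)" for n
  proof -
    have "ennreal \<bar>\<Sum>k<n. X k - y k\<bar> \<le> ennreal (\<Sum>k<n. \<bar>X k - y k\<bar>)" by (intro ennreal_leI sum_abs)
    also have "\<dots> = (\<Sum>k<n. ennreal \<bar>X k - y k\<bar>)" by (rule sum_ennreal[symmetric]) simp
    also have "\<dots> \<le> (\<Sum>n. ennreal \<bar>X n - y n\<bar>)" by (intro sum_le_suminf) auto
    finally show ?thesis .
  qed
  then show ?thesis by (intro LIMSEQ_le_const2[OF lim]) blast
qed

context
  fixes \<alpha> :: "real \<Rightarrow> real" and \<alpha>\<^sub>0 :: real and B :: nat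
  assumes a0: "0 < \<alpha>\<^sub>0" and alpha: "\<And>t. t \<in> {0..1} \<Longrightarrow> \<alpha>\<^sub>0 \<le> \<alpha> t" "\<And>t. t \<in> {0..1} \<Longrightarrow> \<bar>\<alpha> t - 1\<bar> \<le> real B" "1 \<le> B"
    and alpha_meas: "\<alpha> \<in> borel_measurable (lebesgue_on {0..1})"
begin

text \<open>
  For small \<open>\<alpha>\<^sub>0\<close> the integral need not converge at every \<open>t\<close>. The kernel is comparable to a constant on each Whitney
  set, and the resulting series converges in \<open>L_1\<close>.
\<close>

lemma kernel_integrable_AE:
  fixes g :: "real \<Rightarrow> real"
  assumes g: "integrable lebesgue g"
  shows "AE t in lebesgue_on {0..1}. set_integrable lebesgue {0..t} (\<lambda>s. (t - s) powr (\<alpha> t - 1) * g s)"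
proof -
  have gm[measurable]: "g \<in> borel_measurable lebesgue" using g by auto
  define I where "I i a = (\<integral>\<^sup>+s. ennreal \<bar>g s\<bar> * indicator (whitney i a) s \<partial>lebesgue)" for i a
  \<comment> \<open>Up to the factor \<open>4 ^ B\<close>, \<open>h t\<close> bounds \<open>\<integral>\<bar>kernel * g\<bar>\<close> by summing over the levels, and \<open>h\<close> is integrable because the
    level \<open>i\<close> contributes \<open>mesh i powr \<alpha>\<^sub>0\<close>.\<close>
  define h where "h t = (\<Sum>i. ennreal (mesh i powr (\<alpha>\<^sub>0 - 1)) * I i (cell i t))" for t
  have Im: "(\<lambda>t. I i (cell i t)) \<in> borel_measurable (lebesgue_on {0..1})" for i
    by (intro borel_imp_lebesgue_on measurable_compose[OF measurable_cell]) simp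
  have hm: "h \<in> borel_measurable (lebesgue_on {0..1})"
    unfolding h_def[abs_def] using Im by (intro borel_measurable_suminf_order borel_measurable_times_ennreal) auto
  have gfin: "(\<integral>\<^sup>+s. ennreal \<bar>g s\<bar> \<partial>lebesgue) < \<infinity>" using g by (simp add: integrable_iff_bounded)
  have "(\<integral>\<^sup>+t. h t \<partial>lebesgue_on {0..1}) = (\<Sum>i. \<integral>\<^sup>+t. ennreal (mesh i powr (\<alpha>\<^sub>0 - 1)) * I i (cell i t) \<partial>lebesgue_on {0..1})"
    unfolding h_def using Im by (intro nn_integral_suminf borel_measurable_times_ennreal) auto
  also have "\<dots> \<le> (\<Sum>i. ennreal (mesh i powr \<alpha>\<^sub>0) * (2 * (\<integral>\<^sup>+s. ennreal \<bar>g s\<bar> \<partial>lebesgue)))"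
  proof (intro suminf_le summableI)
    fix i
    have "(\<integral>\<^sup>+t. I i (cell i t) \<partial>lebesgue_on {0..1}) = (\<integral>\<^sup>+t. I i (cell i t) * indicator {0..1} t \<partial>lebesgue)"
      by (subst nn_integral_restrict_space) auto
    also have "\<dots> \<le> (\<integral>\<^sup>+t. I i (cell i t) * indicator {0..} t \<partial>lebesgue)"
      by (intro nn_integral_mono mult_left_mono) (auto simp: indicator_def)
    also have "\<dots> = (\<Sum>a. I i a) * ennreal (mesh i)" unfolding nn_integral_cell by simp
    also have "\<dots> \<le> 2 * (\<integral>\<^sup>+s. ennreal \<bar>g s\<bar> \<partial>lebesgue) * ennreal (mesh i)"
      unfolding I_def by (intro mult_right_mono suminf_nn_integral_whitney_le) auto
    finally have "ennreal (mesh i powr (\<alpha>\<^sub>0 - 1)) * (\<integral>\<^sup>+t. I i (cell i t) \<partial>lebesgue_on {0..1})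
        \<le> ennreal (mesh i powr (\<alpha>\<^sub>0 - 1)) * (2 * (\<integral>\<^sup>+s. ennreal \<bar>g s\<bar> \<partial>lebesgue) * ennreal (mesh i))"
      by (intro mult_left_mono) auto
    also have "\<dots> = (ennreal (mesh i powr (\<alpha>\<^sub>0 - 1)) * ennreal (mesh i)) * (2 * (\<integral>\<^sup>+s. ennreal \<bar>g s\<bar> \<partial>lebesgue))"
      by (simp only: mult_ac)
    also have "ennreal (mesh i powr (\<alpha>\<^sub>0 - 1)) * ennreal (mesh i) = ennreal (mesh i powr \<alpha>\<^sub>0)"
      by (subst ennreal_mult[symmetric]) (auto simp: powr_diff)
    finally show "(\<integral>\<^sup>+t. ennreal (mesh i powr (\<alpha>\<^sub>0 - 1)) * I i (cell i t) \<partial>lebesgue_on {0..1})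
        \<le> ennreal (mesh i powr \<alpha>\<^sub>0) * (2 * (\<integral>\<^sup>+s. ennreal \<bar>g s\<bar> \<partial>lebesgue))"
      using Im by (simp add: nn_integral_cmult)
  qed
  also have "\<dots> = ennreal (\<Sum>i. mesh i powr \<alpha>\<^sub>0) * (2 * (\<integral>\<^sup>+s. ennreal \<bar>g s\<bar> \<partial>lebesgue))"
    using mesh_powr_sums[OF a0] by (simp add: suminf_ennreal2)
  also have "\<dots> < \<infinity>" using gfin by (simp add: ennreal_mult_less_top)
  finally have "AE t in lebesgue_on {0..1}. h t \<noteq> \<infinity>" by (intro nn_integral_noteq_infinite hm) simp
  then have "AE t in lebesgue_on {0..1}. h t \<noteq> \<infinity> \<and> t \<in> {0..1}" by (auto simp: AE_restrict_space_iff elim!: eventually_mono)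
  then show ?thesis
  proof eventually_elim
    case (elim t)
    then have t: "0 \<le> t" "t \<le> 1" "t \<in> {0..1}" by auto
    let ?K = "\<lambda>s. (t - s) powr (\<alpha> t - 1)"
    have id: "(\<lambda>s::real. s) \<in> borel_measurable lebesgue" using id_borel_measurable_lebesgue by (simp add: id_def)
    have m: "(\<lambda>s. ?K s * g s) \<in> borel_measurable lebesgue" using id by measurable
    have "(\<integral>\<^sup>+s. ennreal (norm (indicat_real {0..t} s *\<^sub>R (?K s * g s))) \<partial>lebesgue)
      \<le> (\<integral>\<^sup>+s. (\<Sum>i. ennreal (4 ^ B * mesh i powr (\<alpha>\<^sub>0 - 1)) * (ennreal \<bar>g s\<bar> * indicator (whitney i (cell i t)) s)) \<partial>lebesgue)"
    proof (intro nn_integral_mono)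
      fix s :: real
      let ?f = "\<lambda>i. ennreal (4 ^ B * mesh i powr (\<alpha>\<^sub>0 - 1)) * (ennreal \<bar>g s\<bar> * indicator (whitney i (cell i t)) s)"
      show "ennreal (norm (indicat_real {0..t} s *\<^sub>R (?K s * g s))) \<le> (\<Sum>i. ?f i)"
      proof (cases "0 \<le> s \<and> s < t")
        case True
        then obtain i where i: "s \<in> whitney i (cell i t)" using exists_whitney[of s t] t by blast
        have "?K s * \<bar>g s\<bar> \<le> 4 ^ B * mesh i powr (\<alpha>\<^sub>0 - 1) * \<bar>g s\<bar>"
          using alpha(1,2)[of t] alpha(3) t a0 by (intro mult_right_mono kernel_le_on_whitney[OF i t(1)]) auto
        then have "ennreal (norm (indicat_real {0..t} s *\<^sub>R (?K s * g s))) \<le> ?f i"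
          using True i by (simp add: abs_mult ennreal_mult[symmetric] ennreal_leI)
        also have "\<dots> = (\<Sum>j\<in>{i}. ?f j)" by simp
        also have "\<dots> \<le> (\<Sum>i. ?f i)" by (intro sum_le_suminf) auto
        finally show ?thesis .
      next
        case False
        then show ?thesis by (cases "s = t") (auto simp: indicator_def)
      qed
    qed
    also have "\<dots> = (\<Sum>i. \<integral>\<^sup>+s. ennreal (4 ^ B * mesh i powr (\<alpha>\<^sub>0 - 1)) * (ennreal \<bar>g s\<bar> * indicator (whitney i (cell i t)) s) \<partial>lebesgue)"
      by (intro nn_integral_suminf) simp
    also have "\<dots> = (\<Sum>i. ennreal (4 ^ B) * (ennreal (mesh i powr (\<alpha>\<^sub>0 - 1)) * I i (cell i t)))"
      unfolding I_def by (intro suminf_cong) (simp add: nn_integral_cmult ennreal_mult mult.assoc)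
    also have "\<dots> = ennreal (4 ^ B) * h t" unfolding h_def by (rule ennreal_suminf_cmult)
    also have "\<dots> < \<infinity>" using elim by (auto simp: ennreal_mult_less_top less_top)
    finally show "set_integrable lebesgue {0..t} (\<lambda>s. ?K s * g s)"
      unfolding set_integrable_def
      by (intro integrableI_bounded borel_measurable_scaleR borel_measurable_indicator m) simp_all
  qed
qed

lemma RL_op_whitney_sums:
  fixes g :: "real \<Rightarrow> real"
  assumes g: "integrable lebesgue g" "\<And>s. s < 0 \<Longrightarrow> g s = 0" and t: "t \<in> {0..1}"
    and good: "set_integrable lebesgue {0..t} (\<lambda>s. (t - s) powr (\<alpha> t - 1) * g s)"
  shows "(\<lambda>i. \<Sum>m. weight \<alpha> i m t * moment i m g (cell i t)) sums RL_op \<alpha> g t"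
    "(\<lambda>m. weight \<alpha> i m t * moment i m g (cell i t)) sums (\<Sum>m. weight \<alpha> i m t * moment i m g (cell i t))"
proof -
  have t': "0 \<le> t" "t \<le> 1" "0 < \<alpha> t" using t alpha(1)[OF t] a0 by auto
  note s = weight_moment_sums[where \<alpha> = \<alpha> and t = t, OF t'(1,3) alpha(2)[OF t] alpha(3) g(1)]
  show "(\<lambda>m. weight \<alpha> i m t * moment i m g (cell i t)) sums (\<Sum>m. weight \<alpha> i m t * moment i m g (cell i t))"
    using s[of i] by (simp add: sums_iff)
  have "(\<Sum>m. weight \<alpha> i m t * moment i m g (cell i t))
      = 1 / Gamma (\<alpha> t) * (LINT s:whitney i (cell i t)|lebesgue. (t - s) powr (\<alpha> t - 1) * g s)" for i
    using s[of i] by (simp add: sums_iff)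
  moreover have "(\<lambda>i. 1 / Gamma (\<alpha> t) * (LINT s:whitney i (cell i t)|lebesgue. (t - s) powr (\<alpha> t - 1) * g s)) sums RL_op \<alpha> g t"
    unfolding RL_op_set_integral by (intro sums_mult sums_whitney_integrals(1)[OF t'(1,2) good]) (simp add: g(2))
  ultimately show "(\<lambda>i. \<Sum>m. weight \<alpha> i m t * moment i m g (cell i t)) sums RL_op \<alpha> g t" by simp
qed

lemma weight_measurable: "weight \<alpha> i m \<in> borel_measurable (lebesgue_on {0..1})"
proof -
  note [measurable] = alpha_meas
  have "(\<lambda>t::real. t) \<in> borel_measurable (lebesgue_on {0..1})" by (rule borel_imp_lebesgue_on) simp
  note [measurable] = this
  have [measurable]: "(\<lambda>t. ctr i (cell i t)) \<in> borel_measurable (lebesgue_on {0..1})"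
    "(\<lambda>t. rad i (cell i t)) \<in> borel_measurable (lebesgue_on {0..1})"
    by (intro borel_imp_lebesgue_on measurable_compose[OF measurable_cell]; simp)+
  have [measurable]: "(\<lambda>t. 1 / Gamma (\<alpha> t)) \<in> borel_measurable (lebesgue_on {0..1})"
    by (rule measurable_compose[OF alpha_meas rGamma_measurable])
  show ?thesis unfolding weight_def[abs_def] Let_def gbinomial_prod_rev by measurable
qed

lemma weight_moment_measurable:
  "(\<lambda>t. weight \<alpha> i m t * moment i m g (cell i t)) \<in> borel_measurable (lebesgue_on {0..1})"
  by (intro borel_measurable_times weight_measurable borel_imp_lebesgue_on measurable_compose[OF measurable_cell]) simp

text \<open>
  By \<open>RL_op_whitney_sums\<close> the image is almost everywhere the limit of measurable functions.
\<close>

lemma RL_op_measurable: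
  fixes g :: "real \<Rightarrow> real"
  assumes g: "integrable lebesgue g" "\<And>s. s < 0 \<Longrightarrow> g s = 0"
  shows "RL_op \<alpha> g \<in> borel_measurable (lebesgue_on {0..1})"
proof (rule borel_measurable_lebesgue_on_AE)
  let ?T = "\<lambda>i t. \<Sum>m. weight \<alpha> i m t * moment i m g (cell i t)"
  have "?T i \<in> borel_measurable (lebesgue_on {0..1})" for i
    using weight_moment_measurable by (intro borel_measurable_suminf) auto
  then have "(\<lambda>t. \<Sum>i<n. ?T i t) \<in> borel_measurable (lebesgue_on {0..1})" for n by (intro borel_measurable_sum) auto
  then show "(\<lambda>t. lim (\<lambda>n. \<Sum>i<n. ?T i t)) \<in> borel_measurable (lebesgue_on {0..1})"
    by (rule borel_measurable_lim_metric)
  have "AE t in lebesgue_on {0..1}. t \<in> {0..1}" by (intro AE_I2) simp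
  with kernel_integrable_AE[OF g(1)] show "AE t in lebesgue_on {0..1}. lim (\<lambda>n. \<Sum>i<n. ?T i t) = RL_op \<alpha> g t"
  proof eventually_elim
    case (elim t)
    then show ?case using RL_op_whitney_sums(1)[OF g elim(2,1)] by (intro limI) (simp only: sums_def)
  qed
qed simp

text \<open>
  The part of the Taylor term of level \<open>i\<close> and degree \<open>m\<close> that lives on the \<open>k\<close>-th group of \<open>N i\<close> consecutive cells.
\<close>

definition block_term :: "(nat \<Rightarrow> nat) \<Rightarrow> nat \<times> nat \<times> nat \<Rightarrow> (real \<Rightarrow> real) \<Rightarrow> real \<Rightarrow> real" where
  "block_term N = (\<lambda>(i, m, k) g t. if cell i t div N i = k then weight \<alpha> i m t * moment i m g (cell i t) else 0)"

lemma block_term_measurable: "block_term N \<tau> g \<in> borel_measurable (lebesgue_on {0..1})"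
proof -
  obtain i m k where \<tau>: "\<tau> = (i, m, k)" by (cases \<tau>)
  have "(\<lambda>t. if cell i t div N i = k then 1 else 0 :: real) \<in> borel_measurable (lebesgue_on {0..1})"
    by (intro borel_imp_lebesgue_on measurable_compose[OF measurable_cell, where g="\<lambda>a. if a div N i = k then 1 else 0"]) simp
  then have "(\<lambda>t. weight \<alpha> i m t * moment i m g (cell i t) * (if cell i t div N i = k then 1 else 0)) \<in> borel_measurable (lebesgue_on {0..1})"
    by (rule borel_measurable_times[OF weight_moment_measurable])
  moreover have "block_term N \<tau> g = (\<lambda>t. weight \<alpha> i m t * moment i m g (cell i t) * (if cell i t div N i = k then 1 else 0))"
    by (auto simp: \<tau> block_term_def)
  ultimately show ?thesis by simp
qed

text \<open>
  For fixed \<open>t\<close>, \<open>i\<close> and \<open>m\<close> only one block number \<open>k\<close> contributes. The integral with respect to the counting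
  measure serves as the triple sum in Minkowski's inequality.
\<close>

lemma RL_op_approx_pointwise:
  fixes g :: "real \<Rightarrow> real" and y :: "nat \<times> nat \<times> nat \<Rightarrow> real \<Rightarrow> real"
  assumes g: "integrable lebesgue g" "\<And>s. s < 0 \<Longrightarrow> g s = 0" and t: "t \<in> {0..1}"
    and good: "set_integrable lebesgue {0..t} (\<lambda>s. (t - s) powr (\<alpha> t - 1) * g s)"
    and y: "\<And>i m k. i \<ge> n \<or> m \<ge> n \<or> k \<ge> n \<Longrightarrow> y (i, m, k) t = 0"
    and yb: "\<And>i m k. cell i t div N i \<noteq> k \<Longrightarrow> y (i, m, k) t = 0"
  shows "ennreal \<bar>RL_op \<alpha> g t - (\<Sum>\<tau>\<in>{..<n} \<times> {..<n} \<times> {..<n}. y \<tau> t)\<bar>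
    \<le> (\<integral>\<^sup>+\<tau>. ennreal \<bar>block_term N \<tau> g t - y \<tau> t\<bar> \<partial>count_space UNIV)"
proof -
  let ?x = "\<lambda>i m. weight \<alpha> i m t * moment i m g (cell i t)"
  let ?k = "\<lambda>i. cell i t div N i"
  have yk: "(\<Sum>k<n. y (i, m, k) t) = y (i, m, ?k i) t" for i m
  proof -
    have "(\<Sum>k<n. y (i, m, k) t) = (\<Sum>k<n. if k = ?k i then y (i, m, ?k i) t else 0)"
    proof (rule sum.cong[OF refl])
      fix k
      show "y (i, m, k) t = (if k = ?k i then y (i, m, ?k i) t else 0)" using yb[of i k m] by (cases "k = ?k i") simp_all
    qed
    also have "\<dots> = y (i, m, ?k i) t" using y[of i m "?k i"] by (cases "?k i < n") (simp_all add: sum.delta)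
    finally show ?thesis .
  qed
  have "(\<Sum>\<tau>\<in>{..<n} \<times> {..<n} \<times> {..<n}. y \<tau> t) = (\<Sum>i<n. \<Sum>m<n. y (i, m, ?k i) t)"
    unfolding yk[symmetric] by (simp add: sum.cartesian_product)
  also have "ennreal \<bar>RL_op \<alpha> g t - (\<Sum>i<n. \<Sum>m<n. y (i, m, ?k i) t)\<bar>
      \<le> (\<Sum>i. ennreal \<bar>(\<Sum>m. ?x i m) - (\<Sum>m<n. y (i, m, ?k i) t)\<bar>)"
    by (intro suminf_diff_bound RL_op_whitney_sums(1)[OF g t good] sum.neutral ballI y disjI1)
  also have "\<dots> \<le> (\<Sum>i. \<Sum>m. ennreal \<bar>?x i m - y (i, m, ?k i) t\<bar>)"
    by (intro suminf_le summableI suminf_diff_bound RL_op_whitney_sums(2)[OF g t good] y disjI2 disjI1)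
  also have "\<dots> \<le> (\<Sum>i. \<Sum>m. \<Sum>k. ennreal \<bar>block_term N (i, m, k) g t - y (i, m, k) t\<bar>)"
  proof (intro suminf_le summableI)
    fix i m
    let ?f = "\<lambda>k. ennreal \<bar>block_term N (i, m, k) g t - y (i, m, k) t\<bar>"
    have "ennreal \<bar>?x i m - y (i, m, ?k i) t\<bar> = (\<Sum>k\<in>{?k i}. ?f k)" by (simp add: block_term_def)
    also have "\<dots> \<le> (\<Sum>k. ?f k)" by (intro sum_le_suminf) auto
    finally show "ennreal \<bar>?x i m - y (i, m, ?k i) t\<bar> \<le> (\<Sum>k. ?f k)" .
  qed
  also have "\<dots> = (\<integral>\<^sup>+\<tau>. ennreal \<bar>block_term N \<tau> g t - y \<tau> t\<bar> \<partial>count_space UNIV)"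
  proof -
    define G where "G \<tau> = ennreal \<bar>block_term N \<tau> g t - y \<tau> t\<bar>" for \<tau>
    have "(\<Sum>i. \<Sum>m. \<Sum>k. G (i, m, k)) = (\<integral>\<^sup>+\<tau>. G \<tau> \<partial>count_space UNIV)"
      unfolding nn_integral_count_space_nat[symmetric] nn_integral_fst_count_space[of "\<lambda>mk. G (i, mk)" for i]
      by (rule nn_integral_fst_count_space)
    then show ?thesis by (simp add: G_def)
  qed
  finally show ?thesis .
qed

text \<open>
  Each block factors as \<open>L_p \<rightarrow> l_p \<rightarrow> l_q \<rightarrow> L_q\<close> with the norms from \<open>moment_norm\<close> and \<open>step_norm\<close>, so that a net of the
  unit ball of \<open>l_p\<close> in \<open>l_q\<close> becomes a net for the images of the unit ball under the block.
\<close>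

lemma block_net:
  assumes K: "0 \<le> K" "\<And>t. t \<in> {0..1} \<Longrightarrow> cell i t div N i = k \<Longrightarrow> \<bar>weight \<alpha> i m t\<bar> \<le> K"
    and uv: "0 \<le> u" "u \<le> 1" "0 \<le> v" and N: "1 \<le> N i" and e: "0 \<le> e" and net: "net_exists u v (N i) \<nu> e"
  shows "\<exists>Y. finite Y \<and> card Y \<le> 2 ^ nat \<lfloor>\<nu>\<rfloor> \<and> (\<nu> < 1 \<longrightarrow> Y = {\<lambda>_. 0}) \<and>
    (\<forall>y\<in>Y. y \<in> borel_measurable (lebesgue_on {0..1}) \<and> (\<exists>b. \<forall>t\<in>{0..1}. \<bar>y t\<bar> \<le> b) \<and> (\<forall>t. cell i t div N i \<noteq> k \<longrightarrow> y t = 0)) \<and>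
    (\<forall>g. integrable lebesgue g \<and> Lq_le lebesgue u g 1 \<longrightarrow>
      (\<exists>y\<in>Y. Lq_le (lebesgue_on {0..1}) v (\<lambda>t. block_term N (i, m, k) g t - y t) (K * mesh i powr v * (2 * mesh i powr (1 - u) * e))))"
proof -
  \<comment> \<open>By the bound on moments, dividing by \<open>\<kappa>\<close> brings the moments of one block into the unit ball.\<close>
  define \<kappa> where "\<kappa> = 2 * mesh i powr (1 - u)"
  have kap: "0 < \<kappa>" by (simp add: \<kappa>_def)
  obtain Z where Z: "finite Z" "card Z \<le> 2 ^ nat \<lfloor>\<nu>\<rfloor>" "\<nu> < 1 \<Longrightarrow> Z = {\<lambda>_. 0}"
    and near: "\<And>x. Lq_le (count_space {..<N i}) u x 1 \<Longrightarrow> \<exists>z\<in>Z. Lq_le (count_space {..<N i}) v (\<lambda>j. x j - z j) e"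
    using net unfolding net_exists_def by (elim exE conjE) simp
  define Yf where "Yf z t = (if cell i t div N i = k then weight \<alpha> i m t * (\<kappa> * z (cell i t - k * N i)) else 0)" for z t
  have idx: "cell i t - k * N i < N i" "k * N i + (cell i t - k * N i) = cell i t" if "cell i t div N i = k" for t
  proof -
    have "cell i t = k * N i + cell i t mod N i" using that div_mult_mod_eq[of "cell i t" "N i"] by simp
    moreover have "cell i t mod N i < N i" using N by simp
    ultimately show "cell i t - k * N i < N i" "k * N i + (cell i t - k * N i) = cell i t" by linarith+
  qed
  have 1: "Yf z \<in> borel_measurable (lebesgue_on {0..1})" for z
  proof -
    have [measurable]: "(\<lambda>t. if cell i t div N i = k then \<kappa> * z (cell i t - k * N i) else 0) \<in> borel_measurable (lebesgue_on {0..1})"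
      by (intro borel_imp_lebesgue_on measurable_compose[OF measurable_cell, where g="\<lambda>a. if a div N i = k then \<kappa> * z (a - k * N i) else 0"]) simp
    note [measurable] = weight_measurable
    have "Yf z = (\<lambda>t. weight \<alpha> i m t * (if cell i t div N i = k then \<kappa> * z (cell i t - k * N i) else 0))"
      by (auto simp: Yf_def)
    then show ?thesis by simp
  qed
  have 2: "\<exists>b. \<forall>t\<in>{0..1}. \<bar>Yf z t\<bar> \<le> b" for z
  proof (intro exI ballI)
    fix t :: real assume t: "t \<in> {0..1}"
    show "\<bar>Yf z t\<bar> \<le> K * (\<kappa> * (\<Sum>j<N i. \<bar>z j\<bar>))"
    proof (cases "cell i t div N i = k")
      case True
      have "\<bar>z (cell i t - k * N i)\<bar> \<le> (\<Sum>j<N i. \<bar>z j\<bar>)" using idx(1)[OF True] by (intro member_le_sum) auto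
      then have "\<bar>weight \<alpha> i m t\<bar> * (\<kappa> * \<bar>z (cell i t - k * N i)\<bar>) \<le> K * (\<kappa> * (\<Sum>j<N i. \<bar>z j\<bar>))"
        using K t True kap by (intro mult_mono) (auto intro: sum_nonneg)
      then show ?thesis using True kap by (simp add: Yf_def abs_mult)
    next
      case False
      then show ?thesis using K kap by (simp add: Yf_def sum_nonneg)
    qed
  qed
  have 3: "\<exists>y\<in>Yf ` Z. Lq_le (lebesgue_on {0..1}) v (\<lambda>t. block_term N (i, m, k) g t - y t) (K * mesh i powr v * (\<kappa> * e))"
    if g: "integrable lebesgue g" "Lq_le lebesgue u g 1" for g
  proof -
    let ?x = "\<lambda>j. moment i m g (k * N i + j)"
    have "Lq_le (count_space {..<N i}) u (\<lambda>j. (1 / \<kappa>) * ?x j) (\<bar>1 / \<kappa>\<bar> * \<kappa>)"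
      unfolding \<kappa>_def by (intro Lq_le_scale moment_norm g uv) auto
    then have "Lq_le (count_space {..<N i}) u (\<lambda>j. (1 / \<kappa>) * ?x j) 1" using kap by simp
    from near[OF this] obtain z where z: "z \<in> Z" "Lq_le (count_space {..<N i}) v (\<lambda>j. (1 / \<kappa>) * ?x j - z j) e" by blast
    have "Lq_le (count_space {..<N i}) v (\<lambda>j. \<kappa> * ((1 / \<kappa>) * ?x j - z j)) (\<bar>\<kappa>\<bar> * e)"
      using z(2) e uv by (intro Lq_le_scale) auto
    then have d: "Lq_le (count_space {..<N i}) v (\<lambda>j. ?x j - \<kappa> * z j) (\<kappa> * e)" using kap by (simp add: right_diff_distrib)
    have "Lq_le (lebesgue_on {0..1}) v (\<lambda>t. block_term N (i, m, k) g t - Yf z t) (K * mesh i powr v * (\<kappa> * e))"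
    proof (rule step_norm[OF _ N K(1) uv(3) _ d])
      fix t :: real assume t: "t \<in> {0..1}"
      show "\<bar>block_term N (i, m, k) g t - Yf z t\<bar>
        \<le> (if cell i t div N i = k then K * \<bar>?x (cell i t - k * N i) - \<kappa> * z (cell i t - k * N i)\<bar> else 0)"
      proof (cases "cell i t div N i = k")
        case True
        have "block_term N (i, m, k) g t - Yf z t = weight \<alpha> i m t * (?x (cell i t - k * N i) - \<kappa> * z (cell i t - k * N i))"
          using True idx(2)[OF True] by (simp add: block_term_def Yf_def right_diff_distrib)
        then show ?thesis using True K(2)[OF t True] by (simp add: abs_mult mult_right_mono)
      next
        case False
        then show ?thesis by (simp add: block_term_def Yf_def)
      qed
    qed (use kap e in simp)
    then show ?thesis using z(1) by blast
  qed
  show ?thesis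
  proof (intro exI[of _ "Yf ` Z"] conjI)
    show "finite (Yf ` Z)" using Z(1) by simp
    show "card (Yf ` Z) \<le> 2 ^ nat \<lfloor>\<nu>\<rfloor>" using card_image_le[OF Z(1), of Yf] Z(2) by linarith
    show "\<nu> < 1 \<longrightarrow> Yf ` Z = {\<lambda>_. 0}" using Z(3) by (auto simp: Yf_def fun_eq_iff)
    show "\<forall>y\<in>Yf ` Z. y \<in> borel_measurable (lebesgue_on {0..1}) \<and> (\<exists>b. \<forall>t\<in>{0..1}. \<bar>y t\<bar> \<le> b) \<and> (\<forall>t. cell i t div N i \<noteq> k \<longrightarrow> y t = 0)"
      using 1 2 by (simp add: Yf_def)
    show "\<forall>g. integrable lebesgue g \<and> Lq_le lebesgue u g 1 \<longrightarrow>
      (\<exists>y\<in>Yf ` Z. Lq_le (lebesgue_on {0..1}) v (\<lambda>t. block_term N (i, m, k) g t - y t) (K * mesh i powr v * (2 * mesh i powr (1 - u) * e)))"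
    proof (intro allI impI, elim conjE)
      fix g :: "real \<Rightarrow> real" assume "integrable lebesgue g" "Lq_le lebesgue u g 1"
      then show "\<exists>y\<in>Yf ` Z. Lq_le (lebesgue_on {0..1}) v (\<lambda>t. block_term N (i, m, k) g t - y t) (K * mesh i powr v * (2 * mesh i powr (1 - u) * e))"
        unfolding \<kappa>_def[symmetric] by (rule 3)
    qed
  qed
qed

end


section \<open>Coverings from nets for the blocks\<close>

lemma finite_set_enumeration:
  assumes "finite A" "card A \<le> m"
  shows "\<exists>y. A \<subseteq> y ` {1..m} \<and> (\<forall>j. y j \<in> insert z A)"
proof -
  obtain h where h: "bij_betw h {1..card A} A" using ex_bij_betw_nat_finite_1[OF assms(1)] by blast
  define y where "y j = (if j \<in> {1..card A} then h j else z)" for j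
  have "A = h ` {1..card A}" using h by (simp add: bij_betw_def)
  also have "\<dots> = y ` {1..card A}" by (intro image_cong) (auto simp: y_def)
  also have "\<dots> \<subseteq> y ` {1..m}" using assms(2) by (intro image_mono) auto
  finally have "A \<subseteq> y ` {1..m}" .
  moreover have "y j \<in> insert z A" for j using bij_betwE[OF h] by (auto simp: y_def)
  ultimately show ?thesis by blast
qed

text \<open>
  If the blocks have nets of at most \<open>2 powr \<nu> \<tau>\<close> elements with radii at most \<open>b \<tau>\<close> and the \<open>\<nu> \<tau>\<close> add up to at most \<open>n - 1\<close>, then
  the sums of net elements form a covering with \<open>2 ^ (n - 1)\<close> balls of radius \<open>\<Sum>\<tau>. b \<tau>\<close>.
\<close>

lemma covering_from_nets:
  fixes p q :: ennreal and \<alpha> :: "real \<Rightarrow> real" and \<nu> b :: "nat \<times> nat \<times> nat \<Rightarrow> real"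
  assumes p: "1 \<le> p" and q: "1 \<le> q" and n: "1 \<le> n"
    and a: "0 < \<alpha>\<^sub>0" "\<And>t. t \<in> {0..1} \<Longrightarrow> \<alpha>\<^sub>0 \<le> \<alpha> t" "\<And>t. t \<in> {0..1} \<Longrightarrow> \<bar>\<alpha> t - 1\<bar> \<le> real B" "1 \<le> B"
      "\<alpha> \<in> borel_measurable (lebesgue_on {0..1})"
    and N: "\<And>i. 1 \<le> N i" and K: "\<And>\<tau>. 0 \<le> K \<tau>"
      "\<And>i m k t. t \<in> {0..1} \<Longrightarrow> cell i t div N i = k \<Longrightarrow> \<bar>weight \<alpha> i m t\<bar> \<le> K (i, m, k)"
    and e: "\<And>\<tau>. 0 \<le> e \<tau>" "\<And>i m k. net_exists (recip p) (recip q) (N i) (\<nu> (i, m, k)) (e (i, m, k))"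
    and b: "\<And>\<tau>. 0 < b \<tau>" "\<And>i m k. K (i, m, k) * mesh i powr recip q * (2 * mesh i powr (1 - recip p) * e (i, m, k)) \<le> b (i, m, k)"
      "(\<integral>\<^sup>+\<tau>. ennreal (b \<tau>) \<partial>count_space UNIV) \<le> ennreal \<epsilon>"
    and \<nu>: "\<And>\<tau>. 0 \<le> \<nu> \<tau>" "\<And>i m k. i \<ge> n' \<or> m \<ge> n' \<or> k \<ge> n' \<Longrightarrow> \<nu> (i, m, k) < 1"
      "(\<Sum>\<tau>\<in>{..<n'} \<times> {..<n'} \<times> {..<n'}. \<nu> \<tau>) \<le> real n - 1"
    and \<epsilon>: "0 < \<epsilon>"
  shows "entropy_number (lebesgue_on {0..1}) p (lebesgue_on {0..1}) q (RL_op \<alpha>) n \<le> ennreal \<epsilon>"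
proof -
  let ?M = "lebesgue_on {0..1::real}"
  define u where "u = recip p"
  define v where "v = recip q"
  have uv: "0 \<le> u" "u \<le> 1" "0 \<le> v" "v \<le> 1" using recip_bounds(1,2) p q by (auto simp: u_def v_def)
  let ?box = "{..<n'} \<times> {..<n'} \<times> {..<n'}"
  let ?T = "block_term \<alpha> N"
  define good where "good \<tau> Y \<longleftrightarrow> finite Y \<and> card Y \<le> 2 ^ nat \<lfloor>\<nu> \<tau>\<rfloor> \<and> (\<nu> \<tau> < 1 \<longrightarrow> Y = {\<lambda>_. 0}) \<and>
    (\<forall>y\<in>Y. y \<in> borel_measurable ?M \<and> (\<exists>b. \<forall>t\<in>{0..1}. \<bar>y t\<bar> \<le> b) \<and> (\<forall>t. cell (fst \<tau>) t div N (fst \<tau>) \<noteq> snd (snd \<tau>) \<longrightarrow> y t = 0)) \<and>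
    (\<forall>g. integrable lebesgue g \<and> Lq_le lebesgue u g 1 \<longrightarrow> (\<exists>y\<in>Y. Lq_le ?M v (\<lambda>t. ?T \<tau> g t - y t) (b \<tau>)))"
    for \<tau> :: "nat \<times> nat \<times> nat" and Y :: "(real \<Rightarrow> real) set"
  have "\<exists>Y. good \<tau> Y" for \<tau>
  proof -
    obtain i m k where \<tau>: "\<tau> = (i, m, k)" by (cases \<tau>)
    have K': "0 \<le> K (i, m, k)" "\<And>t. t \<in> {0..1} \<Longrightarrow> cell i t div N i = k \<Longrightarrow> \<bar>weight \<alpha> i m t\<bar> \<le> K (i, m, k)"
      using K by auto
    obtain Y where Y: "finite Y \<and> card Y \<le> 2 ^ nat \<lfloor>\<nu> (i, m, k)\<rfloor> \<and> (\<nu> (i, m, k) < 1 \<longrightarrow> Y = {\<lambda>_. 0}) \<and>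
      (\<forall>y\<in>Y. y \<in> borel_measurable ?M \<and> (\<exists>b. \<forall>t\<in>{0..1}. \<bar>y t\<bar> \<le> b) \<and> (\<forall>t. cell i t div N i \<noteq> k \<longrightarrow> y t = 0)) \<and>
      (\<forall>g. integrable lebesgue g \<and> Lq_le lebesgue u g 1 \<longrightarrow> (\<exists>y\<in>Y. Lq_le ?M v (\<lambda>t. ?T (i, m, k) g t - y t)
        (K (i, m, k) * mesh i powr v * (2 * mesh i powr (1 - u) * e (i, m, k)))))"
      using block_net[where i = i and m = m and k = k and \<nu> = "\<nu> (i, m, k)" and e = "e (i, m, k)" and N = N,
          OF a K' uv(1-3) N e(1) e(2)[folded u_def v_def]] by blast
    have le: "K (i, m, k) * mesh i powr v * (2 * mesh i powr (1 - u) * e (i, m, k)) \<le> b (i, m, k)"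
      using b(2) by (simp add: u_def v_def)
    have nn: "0 \<le> K (i, m, k) * mesh i powr v * (2 * mesh i powr (1 - u) * e (i, m, k))"
      by (intro mult_nonneg_nonneg K(1) e(1)) simp_all
    have "\<exists>y\<in>Y. Lq_le ?M v (\<lambda>t. ?T (i, m, k) g t - y t) (b (i, m, k))" if "integrable lebesgue g" "Lq_le lebesgue u g 1" for g
    proof -
      from Y that have "\<exists>y\<in>Y. Lq_le ?M v (\<lambda>t. ?T (i, m, k) g t - y t)
        (K (i, m, k) * mesh i powr v * (2 * mesh i powr (1 - u) * e (i, m, k)))" by simp
      then obtain y where y: "y \<in> Y" "Lq_le ?M v (\<lambda>t. ?T (i, m, k) g t - y t)
        (K (i, m, k) * mesh i powr v * (2 * mesh i powr (1 - u) * e (i, m, k)))" ..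
      show ?thesis by (rule bexI[OF _ y(1)], rule Lq_le_mono[OF y(2) le uv(3) nn])
    qed
    with Y have "good \<tau> Y" unfolding good_def \<tau> fst_conv snd_conv by simp
    then show ?thesis ..
  qed
  then obtain Y where Y: "\<And>\<tau>. good \<tau> (Y \<tau>)" by metis
  have Yout: "Y (i, m, k) = {\<lambda>_. 0}" if "i \<ge> n' \<or> m \<ge> n' \<or> k \<ge> n'" for i m k
    using Y[of "(i, m, k)"] \<nu>(2)[OF that] by (simp add: good_def)
  \<comment> \<open>Choosing one net element for each block in the box and adding them up gives the centres; blocks
    outside of the box have too few bits for anything but the zero function.\<close>
  define S where "S \<eta> t = (\<Sum>\<tau>\<in>?box. \<eta> \<tau> t)" for \<eta> :: "nat \<times> nat \<times> nat \<Rightarrow> real \<Rightarrow> real" and t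
  define Ctr where "Ctr = S ` (PiE ?box Y)"
  have fin: "finite (PiE ?box Y)" using Y by (intro finite_PiE) (auto simp: good_def)
  have card: "card Ctr \<le> 2 ^ (n - 1)"
  proof -
    have "card Ctr \<le> card (PiE ?box Y)" unfolding Ctr_def by (rule card_image_le[OF fin])
    also have "\<dots> = (\<Prod>\<tau>\<in>?box. card (Y \<tau>))" by (rule card_PiE) simp
    also have "\<dots> \<le> (\<Prod>\<tau>\<in>?box. 2 ^ nat \<lfloor>\<nu> \<tau>\<rfloor>)" using Y by (intro prod_mono) (auto simp: good_def)
    also have "\<dots> = 2 ^ (\<Sum>\<tau>\<in>?box. nat \<lfloor>\<nu> \<tau>\<rfloor>)" by (rule power_sum[symmetric])
    also have "\<dots> \<le> 2 ^ (n - 1)"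
    proof (rule power_increasing)
      have "real (\<Sum>\<tau>\<in>?box. nat \<lfloor>\<nu> \<tau>\<rfloor>) \<le> (\<Sum>\<tau>\<in>?box. \<nu> \<tau>)"
        unfolding of_nat_sum using \<nu>(1) by (intro sum_mono) (simp add: of_nat_nat)
      also have "\<dots> \<le> real (n - 1)" using \<nu>(3) n by (simp add: of_nat_diff)
      finally show "(\<Sum>\<tau>\<in>?box. nat \<lfloor>\<nu> \<tau>\<rfloor>) \<le> n - 1" by (simp only: of_nat_le_iff)
    qed simp
    finally show ?thesis .
  qed
  have Ctr_bounded: "c \<in> borel_measurable ?M \<and> (\<exists>b>0. Lq_le ?M v c b)" if cC: "c \<in> Ctr" for c
  proof -
    obtain \<eta> where \<eta>: "\<eta> \<in> PiE ?box Y" "c = S \<eta>" using cC unfolding Ctr_def by blast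
    have \<eta>Y: "\<eta> \<tau> \<in> borel_measurable ?M" "\<exists>b. \<forall>t\<in>{0..1}. \<bar>\<eta> \<tau> t\<bar> \<le> b" if "\<tau> \<in> ?box" for \<tau>
      using Y[of \<tau>] PiE_mem[OF \<eta>(1) that] by (auto simp: good_def)
    then obtain bb where bb: "\<And>\<tau> t. \<tau> \<in> ?box \<Longrightarrow> t \<in> {0..1} \<Longrightarrow> \<bar>\<eta> \<tau> t\<bar> \<le> bb \<tau>" by metis
    have m: "c \<in> borel_measurable ?M" unfolding \<eta>(2) S_def[abs_def] using \<eta>Y(1) by (intro borel_measurable_sum) auto
    have "\<bar>c t\<bar> \<le> (\<Sum>\<tau>\<in>?box. \<bar>bb \<tau>\<bar>) + 1" if "t \<in> {0..1}" for t
    proof -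
      have "\<bar>c t\<bar> \<le> (\<Sum>\<tau>\<in>?box. \<bar>\<eta> \<tau> t\<bar>)" unfolding \<eta>(2) S_def by (rule sum_abs)
      also have "\<dots> \<le> (\<Sum>\<tau>\<in>?box. \<bar>bb \<tau>\<bar>)" using bb that by (intro sum_mono) (auto intro: order_trans[OF _ abs_ge_self])
      finally show ?thesis by simp
    qed
    moreover have "0 < (\<Sum>\<tau>\<in>?box. \<bar>bb \<tau>\<bar>) + 1" by (intro add_nonneg_pos sum_nonneg) auto
    ultimately show ?thesis using m uv by (auto intro!: exI[of _ "(\<Sum>\<tau>\<in>?box. \<bar>bb \<tau>\<bar>) + 1"] bounded_imp_Lq_le)
  qed
  have Ctr_Lp: "c \<in> Lp_space ?M q" if "c \<in> Ctr" for c
    using Ctr_bounded[OF that] unfolding v_def by (auto intro: Lq_le_imp_Lp_space[OF q] less_imp_le)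
  have "Lq_le ?M v (\<lambda>_. 0) 0" using uv by (intro bounded_imp_Lq_le) auto
  then have zero_Lp: "(\<lambda>_. 0) \<in> Lp_space ?M q" unfolding v_def by (intro Lq_le_imp_Lp_space[OF q]) auto
  have near: "\<exists>c\<in>Ctr. RL_op \<alpha> f \<in> Lp_cball ?M q c \<epsilon>" if f: "f \<in> Lp_cball ?M p (\<lambda>_. 0) 1" for f
  proof -
    have fm: "f \<in> borel_measurable ?M" and "Lp_norm ?M p f \<le> ennreal 1" using f by (auto simp: Lp_cball_def Lp_space_def)
    then have f1: "Lq_le ?M u f 1" using Lp_norm_le_iff[OF fm p, of 1] by (simp add: u_def)
    define g where "g s = indicator {0..1} s * f s" for s
    have gL: "Lq_le lebesgue u g 1" using f1 unfolding g_def by (subst (asm) Lq_le_lebesgue_on_iff) auto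
    have "integrable ?M f"
      using fm f1 uv emeasure_lebesgue_on_interval[of 0 1] by (intro Lq_le_imp_integrable(1)[where v = u and b = 1 and \<mu> = 1]) auto
    then have gi: "integrable lebesgue g" unfolding g_def by (subst (asm) integrable_restrict_space) auto
    have g0: "g s = 0" if "s < 0" for s using that by (simp add: g_def)
    have "\<exists>y. y \<in> Y \<tau> \<and> Lq_le ?M v (\<lambda>t. ?T \<tau> g t - y t) (b \<tau>)" for \<tau>
      using Y[of \<tau>] gi gL unfolding good_def by blast
    then obtain y where y: "\<And>\<tau>. y \<tau> \<in> Y \<tau>" "\<And>\<tau>. Lq_le ?M v (\<lambda>t. ?T \<tau> g t - y \<tau> t) (b \<tau>)" by metis
    have ym: "y \<tau> \<in> borel_measurable ?M" for \<tau> using Y[of \<tau>] y(1)[of \<tau>] by (auto simp: good_def)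
    have y0: "y (i, m, k) t = 0" if "i \<ge> n' \<or> m \<ge> n' \<or> k \<ge> n'" for i m k t using y(1)[of "(i, m, k)"] Yout[OF that] by simp
    have yb: "y (i, m, k) t = 0" if "cell i t div N i \<noteq> k" for i m k t
      using Y[of "(i, m, k)"] y(1)[of "(i, m, k)"] that by (auto simp: good_def)
    define c where "c = S (restrict y ?box)"
    have cC: "c \<in> Ctr" unfolding c_def Ctr_def using y(1) by (intro imageI) auto
    have c_eq: "c t = (\<Sum>\<tau>\<in>?box. y \<tau> t)" for t unfolding c_def S_def by (intro sum.cong) auto
    have cm: "c \<in> borel_measurable ?M" using Ctr_bounded[OF cC] by simp
    have Rm: "RL_op \<alpha> g \<in> borel_measurable ?M" by (rule RL_op_measurable[OF a gi g0])
    have RL_eq: "RL_op \<alpha> f t = RL_op \<alpha> g t" if "t \<in> {0..1}" for t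
      using that RL_op_indicator[of t \<alpha> f] by (simp add: g_def[abs_def])
    have Rfm: "RL_op \<alpha> f \<in> borel_measurable ?M"
      using Rm RL_eq by (subst measurable_cong[of _ _ "RL_op \<alpha> g"]) auto
    have main: "Lq_le ?M v (\<lambda>t. RL_op \<alpha> g t - c t) \<epsilon>"
    proof (rule Lq_le_countable_sum[OF _ _ uv(3,4) b(1) b(3) y(2)])
      show "(\<lambda>t. ?T \<tau> g t - y \<tau> t) \<in> borel_measurable ?M" for \<tau>
        by (intro borel_measurable_diff block_term_measurable[OF a] ym)
      show "(\<lambda>t. RL_op \<alpha> g t - c t) \<in> borel_measurable ?M" using Rm cm by simp
      have "AE t in ?M. t \<in> {0..1}" by (intro AE_I2) simp
      moreover have "AE t in ?M. set_integrable lebesgue {0..t} (\<lambda>s. (t - s) powr (\<alpha> t - 1) * g s)"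
        by (rule kernel_integrable_AE[OF a gi])
      ultimately show "AE t in ?M. ennreal \<bar>RL_op \<alpha> g t - c t\<bar> \<le> (\<integral>\<^sup>+\<tau>. ennreal \<bar>?T \<tau> g t - y \<tau> t\<bar> \<partial>count_space UNIV)"
      proof eventually_elim
        case (elim t)
        show ?case unfolding c_eq by (rule RL_op_approx_pointwise[OF a gi g0 elim]) (simp_all add: y0 yb)
      qed
    qed
    have main': "Lq_le ?M v (\<lambda>t. RL_op \<alpha> f t - c t) \<epsilon>"
      by (rule Lq_le_cong_AE[OF _ main uv(3)]) (simp add: AE_restrict_space_iff RL_eq)
    obtain bc where bc: "0 < bc" "Lq_le ?M v c bc" using Ctr_bounded[OF cC] by blast
    have "Lq_le ?M v (\<lambda>t. (RL_op \<alpha> f t - c t) + c t) (\<epsilon> + bc)"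
      using Rfm cm main' bc uv \<epsilon> by (intro Lq_le_add) auto
    then have "RL_op \<alpha> f \<in> Lp_space ?M q"
      using Rfm bc \<epsilon> unfolding v_def by (intro Lq_le_imp_Lp_space[OF q]) auto
    moreover have "Lp_norm ?M q (\<lambda>t. RL_op \<alpha> f t - c t) \<le> ennreal \<epsilon>"
      using main' Rfm cm \<epsilon> by (subst Lp_norm_le_iff[OF _ q]) (auto simp: v_def)
    ultimately show ?thesis using cC by (auto simp: Lp_cball_def)
  qed
  have "finite Ctr" unfolding Ctr_def using fin by simp
  then obtain y where y: "Ctr \<subseteq> y ` {1..2 ^ (n - 1) :: nat}" "\<And>j. y j \<in> insert (\<lambda>_. 0) Ctr"
    using finite_set_enumeration[OF _ card, of "\<lambda>_. 0"] by blast
  show ?thesis unfolding entropy_number_def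
  proof (rule Inf_lower, intro CollectI exI conjI)
    show "\<forall>j\<in>{1..2 ^ (n - 1) :: nat}. y j \<in> Lp_space ?M q"
    proof
      fix j :: nat
      from y(2)[of j] show "y j \<in> Lp_space ?M q"
      proof
        assume "y j = (\<lambda>_. 0)"
        then show ?thesis using zero_Lp by simp
      qed (rule Ctr_Lp)
    qed
    show "RL_op \<alpha> ` Lp_cball ?M p (\<lambda>_. 0) 1 \<subseteq> (\<Union>j\<in>{1..2 ^ (n - 1) :: nat}. Lp_cball ?M q (y j) \<epsilon>)"
    proof safe
      fix f assume "f \<in> Lp_cball ?M p (\<lambda>_. 0) 1"
      then obtain c where "c \<in> Ctr" "RL_op \<alpha> f \<in> Lp_cball ?M q c \<epsilon>" using near by blast
      then show "RL_op \<alpha> f \<in> (\<Union>j\<in>{1..2 ^ (n - 1) :: nat}. Lp_cball ?M q (y j) \<epsilon>)" using y(1) by blast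
    qed
  qed (use \<epsilon> in simp_all)
qed


section \<open>Distribution of bits and the upper bound\<close>

lemma sum_inverse_squares_le: "(\<Sum>j<N. 1 / (real j + 1)\<^sup>2) \<le> 2"
proof -
  have "(\<Sum>j<Suc N. 1 / (real j + 1)\<^sup>2) \<le> 2 - 1 / (real N + 1)" for N
  proof (induction N)
    case 0
    then show ?case by simp
  next
    case (Suc N)
    have "1 / (real N + 2)\<^sup>2 \<le> 1 / ((real N + 1) * (real N + 2))"
      by (intro divide_left_mono) (auto simp: power2_eq_square intro!: mult_right_mono)
    also have "\<dots> = 1 / (real N + 1) - 1 / (real N + 2)" by (simp add: field_simps)
    finally show ?case using Suc by (simp add: add_ac)
  qed
  from this[of N] have "(\<Sum>j<Suc N. 1 / (real j + 1)\<^sup>2) \<le> 2" by (rule order_trans) simp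
  moreover have "(\<Sum>j<N. 1 / (real j + 1)\<^sup>2) \<le> (\<Sum>j<Suc N. 1 / (real j + 1)\<^sup>2)" by simp
  ultimately show ?thesis by linarith
qed

definition level_gap :: "nat \<Rightarrow> nat \<Rightarrow> nat" where
  "level_gap i0 i = (if i0 \<le> i then i - i0 else i0 - i)"

text \<open>
  Every distance from \<open>i0\<close> is attained by at most two levels.
\<close>

lemma suminf_level_gap_le:
  fixes x :: "nat \<Rightarrow> ennreal"
  shows "(\<Sum>i. x (level_gap i0 i)) \<le> 2 * (\<Sum>d. x d)"
proof -
  have "(\<Sum>i. x (level_gap i0 i)) = (\<Sum>i. x (level_gap i0 (i + i0))) + (\<Sum>i<i0. x (level_gap i0 i))"
    by (rule suminf_offset) (rule summableI)
  also have "(\<Sum>i. x (level_gap i0 (i + i0))) = (\<Sum>d. x d)" by (simp add: level_gap_def)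
  also have "(\<Sum>i<i0. x (level_gap i0 i)) = (\<Sum>d\<in>(\<lambda>i. i0 - i) ` {..<i0}. x d)"
    by (subst sum.reindex) (auto simp: inj_on_def level_gap_def)
  also have "\<dots> \<le> (\<Sum>d. x d)" by (intro sum_le_suminf) auto
  finally show ?thesis by (simp add: mult_2)
qed

lemma sum_level_gap_le:
  "(\<Sum>i<M. 1 / (real (level_gap i0 i) + 1)\<^sup>2) \<le> 4"
proof -
  let ?s = "\<lambda>j. 1 / (real j + 1)\<^sup>2"
  have "ennreal (\<Sum>i<M. ?s (level_gap i0 i)) = (\<Sum>i<M. ennreal (?s (level_gap i0 i)))" by (rule sum_ennreal[symmetric]) simp
  also have "\<dots> \<le> (\<Sum>i. ennreal (?s (level_gap i0 i)))" by (intro sum_le_suminf) auto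
  also have "\<dots> \<le> 2 * (\<Sum>d. ennreal (?s d))" by (rule suminf_level_gap_le)
  also have "\<dots> \<le> 2 * ennreal 2"
  proof (intro mult_left_mono suminf_le_const[OF summableI])
    fix d
    have "(\<Sum>j<d. ennreal (?s j)) = ennreal (\<Sum>j<d. ?s j)" by (rule sum_ennreal) simp
    then show "(\<Sum>j<d. ennreal (?s j)) \<le> ennreal 2" using sum_inverse_squares_le[of d] by (simp only: ennreal_leI)
  qed simp
  also have "2 * ennreal 2 = ennreal 4" by simp
  finally have "ennreal (\<Sum>i<M. ?s (level_gap i0 i)) \<le> ennreal 4" .
  then show ?thesis by (rule ennreal_le_iff[THEN iffD1, rotated]) simp
qed

lemma suminf_ennreal_finite:
  assumes "summable f" "\<And>n. 0 \<le> f n"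
  shows "(\<Sum>n. ennreal (f n)) = ennreal (suminf f)"
  using assms by (intro suminf_ennreal2) auto

lemma nn_integral_triple_product:
  fixes f g h :: "nat \<Rightarrow> real"
  assumes "\<And>i. 0 \<le> f i" "\<And>i. 0 \<le> g i" "\<And>i. 0 \<le> h i"
  shows "(\<integral>\<^sup>+\<tau>. ennreal (case \<tau> of (i, m, k) \<Rightarrow> f i * g m * h k) \<partial>count_space UNIV)
    = (\<Sum>i. ennreal (f i)) * (\<Sum>i. ennreal (g i)) * (\<Sum>i. ennreal (h i))"
proof -
  define G where "G \<tau> = ennreal (case \<tau> of (i, m, k) \<Rightarrow> f i * g m * h k)" for \<tau>
  have "(\<integral>\<^sup>+\<tau>. G \<tau> \<partial>count_space UNIV) = (\<Sum>i. \<Sum>m. \<Sum>k. G (i, m, k))"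
    unfolding nn_integral_count_space_nat[symmetric] nn_integral_fst_count_space[of "\<lambda>mk. G (i, mk)" for i]
    by (rule nn_integral_fst_count_space[symmetric])
  also have "\<dots> = (\<Sum>i. \<Sum>m. \<Sum>k. ennreal (f i) * (ennreal (g m) * ennreal (h k)))"
    using assms by (simp add: G_def ennreal_mult mult.assoc)
  also have "\<dots> = (\<Sum>i. ennreal (f i) * ((\<Sum>m. ennreal (g m)) * (\<Sum>k. ennreal (h k))))"
    by (simp add: ennreal_suminf_cmult ennreal_suminf_multc)
  also have "\<dots> = (\<Sum>i. ennreal (f i)) * ((\<Sum>m. ennreal (g m)) * (\<Sum>k. ennreal (h k)))"
    by (rule ennreal_suminf_multc)
  finally show ?thesis by (simp add: G_def mult.assoc)
qed

text \<open>
  The critical level: the first one at which \<open>[0, r]\<close> has at least \<open>n\<close> cells.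
\<close>

lemma exists_level:
  assumes "2 \<le> n" "0 < r" "r \<le> 1"
  shows "\<exists>i. real n * mesh i \<le> r \<and> r \<le> 2 * real n * mesh i"
proof -
  obtain j where "(1 / 2) ^ j < r / real n" using real_arch_pow_inv[of "r / real n" "1 / 2"] assms by auto
  moreover have "mesh j \<le> (1 / 2) ^ j" by (simp add: mesh_def)
  ultimately have "mesh j < r / real n" by (rule le_less_trans[rotated])
  then have j: "real n * mesh j \<le> r" using assms by (simp add: field_simps)
  define i where "i = (LEAST i. real n * mesh i \<le> r)"
  have i: "real n * mesh i \<le> r" unfolding i_def by (rule LeastI[of _ j]) (rule j)
  have "r \<le> 2 * real n * mesh i"
  proof (cases i)
    case 0
    then show ?thesis using assms by (simp add: mesh_def)
  next
    case (Suc i')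
    then have "\<not> real n * mesh i' \<le> r" using not_less_Least[of i' "\<lambda>i. real n * mesh i \<le> r"] by (simp add: i_def)
    moreover have "mesh i' = 2 * mesh i" using Suc by (simp add: mesh_def)
    ultimately show ?thesis by simp
  qed
  with i show ?thesis by blast
qed

lemma mesh_shift: "mesh i = mesh j * 2 powr (real j - real i)"
proof -
  have "mesh l = 2 powr (- (real l + 1))" for l
  proof -
    have "2 powr (- (real l + 1)) = inverse (2 powr real (l + 1))" by (simp only: powr_minus of_nat_add of_nat_1)
    also have "inverse (2 powr real (l + 1)) = mesh l" unfolding mesh_def by (simp only: powr_realpow zero_less_numeral power_one_over inverse_eq_divide)
    finally show ?thesis ..
  qed
  then show ?thesis by (simp add: powr_add[symmetric] algebra_simps)
qed

text \<open>
  The radius of a block apart from the factors for \<open>m\<close> and \<open>k\<close>: the norms of the outer factors give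
  \<open>mesh i powr (\<alpha>\<^sub>0 + v - u)\<close>, the net gives the powers of \<open>N\<close>, and the factor with \<open>lam\<close> is the loss from comparing the decay over
  blocks at level \<open>i < i0\<close> with the one at level \<open>i0\<close>. At \<open>i = i0\<close> this is the claimed rate. Towards finer levels there
  is a gain of \<open>\<alpha>\<^sub>0 - A1\<close> per level, and \<open>A2\<close> is chosen so large that there is a gain towards coarser levels, too.
\<close>

lemma level_estimate:
  fixes \<alpha>\<^sub>0 lam u v A1 A2 c r n :: real and i i0 :: nat
  assumes n: "1 \<le> n" and r: "0 < r" and i0: "n * mesh i0 \<le> r" "r \<le> 2 * n * mesh i0"
    and c: "0 < c" "c \<le> n * r" and lam: "0 < lam" and uv: "\<bar>u - v\<bar> \<le> 1" and k: "0 < \<alpha>\<^sub>0 + v - u"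
    and A: "u - v < A1" "A1 < \<alpha>\<^sub>0" and A2: "A2 = 2 * (\<alpha>\<^sub>0 + lam) + 3"
  defines "N \<equiv> real (nat \<lceil>r / mesh i\<rceil>)" and "D \<equiv> real (level_gap i0 i)" and "\<delta> \<equiv> min (\<alpha>\<^sub>0 - A1) 1"
    and "A \<equiv> (if i0 \<le> i then A1 else A2)"
  shows "mesh i powr (\<alpha>\<^sub>0 + v - u) * (if i0 \<le> i then 1 else 2 powr (lam * D)) * (N powr (v - u) * (N / n) powr A)
    \<le> (3 + 1 / sqrt c) powr (A2 + 1) * (n powr (- \<alpha>\<^sub>0) * r powr (\<alpha>\<^sub>0 + v - u)) * 2 powr (- \<delta> * D)"
proof -
  \<comment> \<open>\<open>2 powr \<sigma>\<close> bounds \<open>N / n\<close> up to the factor \<open>C\<close>. On levels coarser than the critical one a block has about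
    \<open>n * 2 powr (- D)\<close> cells as long as this exceeds 1; the weaker exponent \<open>- D / 2\<close> also covers the levels where
    a block is a single cell.\<close>
  define \<sigma> where "\<sigma> = (if i0 \<le> i then D else - D / 2)"
  define C where "C = 3 + 1 / sqrt c"
  have C: "3 \<le> C" using c by (simp add: C_def)
  define \<theta> where "\<theta> = v - u + A"
  have \<theta>: "0 < \<theta>" "\<theta> \<le> A2 + 1" using A A2 lam uv by (auto simp: \<theta>_def A_def)
  have D: "0 \<le> D" "D = (if i0 \<le> i then real i - real i0 else real i0 - real i)"
    by (auto simp: D_def level_gap_def)
  have rm: "r / mesh i = r / mesh i0 * 2 powr (real i - real i0)"
    unfolding mesh_shift[of i i0] by (simp add: powr_diff)
  have r0: "r / mesh i0 \<le> 2 * n" "n \<le> r / mesh i0" using i0 by (simp_all add: field_simps)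
  have N1: "0 < r / mesh i" using r by simp
  have Npos: "1 \<le> N" unfolding N_def using N1 by (simp add: Suc_le_eq)
  have "N \<le> r / mesh i + 1" unfolding N_def using N1 by linarith
  also have "\<dots> \<le> C * n * 2 powr \<sigma>"
  proof (cases "i0 \<le> i")
    case True
    have "r / mesh i \<le> 2 * n * 2 powr \<sigma>"
      unfolding rm using r0 True D by (intro mult_mono) (auto simp: \<sigma>_def)
    moreover have "1 * 1 \<le> n * 2 powr \<sigma>" using n D True by (intro mult_mono ge_one_powr_ge_zero) (auto simp: \<sigma>_def)
    moreover have "3 * (n * 2 powr \<sigma>) \<le> C * (n * 2 powr \<sigma>)" using C n by (intro mult_right_mono) auto
    ultimately show ?thesis by (simp add: mult.assoc)
  next
    case False
    have "r / mesh i \<le> 2 * n * 2 powr \<sigma>"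
      unfolding rm using r0 False D by (intro mult_mono powr_mono) (auto simp: \<sigma>_def)
    moreover have "1 \<le> 1 / sqrt c * (n * 2 powr \<sigma>)"
    proof -
      \<comment> \<open>\<open>D \<le> i0\<close> and \<open>2 powr i0\<close> is at most \<open>n / r\<close>.\<close>
      have "2 powr D \<le> 2 powr real i0" using False D by (intro powr_mono) auto
      also have "\<dots> = 1 / (2 * mesh i0)" by (simp add: mesh_def powr_realpow power_one_over)
      also have "\<dots> \<le> n / r" using i0 r n by (simp add: field_simps)
      finally have "r / n \<le> 2 powr (- D)" using r n by (simp add: powr_minus field_simps)
      then have "sqrt (r / n) \<le> sqrt (2 powr (- D))" by (rule real_sqrt_le_mono)
      also have "\<dots> = 2 powr \<sigma>" using False by (simp add: powr_half_sqrt[symmetric] powr_powr \<sigma>_def)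
      finally have s: "n * sqrt (r / n) \<le> n * 2 powr \<sigma>" using n by (intro mult_left_mono) auto
      have "sqrt c \<le> sqrt (n * r)" using c by simp
      also have "\<dots> = sqrt (n * n * (r / n))" using n by simp
      also have "\<dots> = n * sqrt (r / n)" using n by (simp only: real_sqrt_mult real_sqrt_mult_self abs_of_nonneg[OF order_trans[OF zero_le_one n]])
      finally have "sqrt c \<le> n * 2 powr \<sigma>" using s by linarith
      then show ?thesis using c by (simp add: field_simps)
    qed
    moreover have "0 \<le> n * 2 powr \<sigma>" using n by simp
    ultimately have "r / mesh i + 1 \<le> 3 * (n * 2 powr \<sigma>) + 1 / sqrt c * (n * 2 powr \<sigma>)" by linarith
    also have "\<dots> = C * n * 2 powr \<sigma>" unfolding C_def by (simp add: distrib_right)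
    finally show ?thesis .
  qed
  finally have N: "N \<le> C * n * 2 powr \<sigma>" .
  have NA: "N powr (v - u) * (N / n) powr A \<le> C powr (A2 + 1) * n powr (v - u) * 2 powr (\<sigma> * \<theta>)"
  proof -
    have "N powr (v - u) * (N / n) powr A = N powr \<theta> * n powr (- A)"
      using Npos n by (simp add: \<theta>_def powr_add powr_divide powr_minus_divide)
    also have "\<dots> \<le> (C * n * 2 powr \<sigma>) powr \<theta> * n powr (- A)"
      using N Npos \<theta> by (intro mult_right_mono powr_mono2) auto
    also have "\<dots> = C powr \<theta> * (n powr \<theta> * n powr (- A)) * 2 powr (\<sigma> * \<theta>)"
      by (simp add: powr_mult powr_powr)
    also have "n powr \<theta> * n powr (- A) = n powr (v - u)" by (simp add: powr_add[symmetric] \<theta>_def)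
    also have "C powr \<theta> * n powr (v - u) * 2 powr (\<sigma> * \<theta>) \<le> C powr (A2 + 1) * n powr (v - u) * 2 powr (\<sigma> * \<theta>)"
      using C \<theta> by (intro mult_right_mono powr_mono) auto
    finally show ?thesis .
  qed
  have mi: "mesh i powr (\<alpha>\<^sub>0 + v - u) \<le> (r / n) powr (\<alpha>\<^sub>0 + v - u) * 2 powr ((real i0 - real i) * (\<alpha>\<^sub>0 + v - u))"
  proof -
    have "mesh i powr (\<alpha>\<^sub>0 + v - u) = mesh i0 powr (\<alpha>\<^sub>0 + v - u) * 2 powr ((real i0 - real i) * (\<alpha>\<^sub>0 + v - u))"
      unfolding mesh_shift[of i i0] by (simp add: powr_mult powr_powr)
    also have "\<dots> \<le> (r / n) powr (\<alpha>\<^sub>0 + v - u) * 2 powr ((real i0 - real i) * (\<alpha>\<^sub>0 + v - u))"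
      using i0 n k by (intro mult_right_mono powr_mono2) (auto simp: field_simps)
    finally show ?thesis .
  qed
  define \<Lambda> where "\<Lambda> = (if i0 \<le> i then 0 else lam * D)"
  have La: "(if i0 \<le> i then 1 else 2 powr (lam * D)) = 2 powr \<Lambda>" by (simp add: \<Lambda>_def)
  have "mesh i powr (\<alpha>\<^sub>0 + v - u) * 2 powr \<Lambda> * (N powr (v - u) * (N / n) powr A)
     \<le> (r / n) powr (\<alpha>\<^sub>0 + v - u) * 2 powr ((real i0 - real i) * (\<alpha>\<^sub>0 + v - u)) * 2 powr \<Lambda> *
        (C powr (A2 + 1) * n powr (v - u) * 2 powr (\<sigma> * \<theta>))"
    by (rule mult_mono[OF mult_right_mono[OF mi] NA]) auto
  also have "\<dots> = C powr (A2 + 1) * ((r / n) powr (\<alpha>\<^sub>0 + v - u) * n powr (v - u)) *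
      (2 powr ((real i0 - real i) * (\<alpha>\<^sub>0 + v - u)) * 2 powr \<Lambda> * 2 powr (\<sigma> * \<theta>))" by (simp only: mult_ac)
  also have "(r / n) powr (\<alpha>\<^sub>0 + v - u) * n powr (v - u) = n powr (- \<alpha>\<^sub>0) * r powr (\<alpha>\<^sub>0 + v - u)"
  proof -
    have "n powr (v - u) = n powr (- \<alpha>\<^sub>0) * n powr (\<alpha>\<^sub>0 + v - u)" by (simp add: powr_add[symmetric])
    then show ?thesis using n r by (simp add: powr_divide)
  qed
  also have "2 powr ((real i0 - real i) * (\<alpha>\<^sub>0 + v - u)) * 2 powr \<Lambda> * 2 powr (\<sigma> * \<theta>)
      = 2 powr ((real i0 - real i) * (\<alpha>\<^sub>0 + v - u) + \<Lambda> + \<sigma> * \<theta>)" by (simp only: powr_add)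
  also have "C powr (A2 + 1) * (n powr (- \<alpha>\<^sub>0) * r powr (\<alpha>\<^sub>0 + v - u)) * 2 powr ((real i0 - real i) * (\<alpha>\<^sub>0 + v - u) + \<Lambda> + \<sigma> * \<theta>)
      \<le> C powr (A2 + 1) * (n powr (- \<alpha>\<^sub>0) * r powr (\<alpha>\<^sub>0 + v - u)) * 2 powr (- \<delta> * D)"
  proof (intro mult_left_mono powr_mono)
    show "(real i0 - real i) * (\<alpha>\<^sub>0 + v - u) + \<Lambda> + \<sigma> * \<theta> \<le> - \<delta> * D"
    proof (cases "i0 \<le> i")
      case True
      then have d: "real i0 - real i = - D" using D by simp
      have "(real i0 - real i) * (\<alpha>\<^sub>0 + v - u) + \<Lambda> + \<sigma> * \<theta> = - ((\<alpha>\<^sub>0 - A1) * D)"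
        unfolding d using True by (simp add: \<Lambda>_def \<sigma>_def \<theta>_def A_def algebra_simps)
      also have "\<dots> \<le> - (\<delta> * D)" using D by (simp add: \<delta>_def mult_right_mono)
      finally show ?thesis by simp
    next
      case False
      then have d: "real i0 - real i = D" using D by simp
      have "(real i0 - real i) * (\<alpha>\<^sub>0 + v - u) + \<Lambda> + \<sigma> * \<theta> = (\<alpha>\<^sub>0 + lam + (v - u) / 2 - A2 / 2) * D"
        unfolding d using False by (simp add: \<Lambda>_def \<sigma>_def \<theta>_def A_def field_simps)
      also have "\<dots> \<le> (- \<delta>) * D"
      proof (rule mult_right_mono)
        have "v - u \<le> 1" using uv by linarith
        then have "\<alpha>\<^sub>0 + lam + (v - u) / 2 - A2 / 2 \<le> - 1" unfolding A2 by (simp add: field_simps)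
        moreover have "\<delta> \<le> 1" by (simp add: \<delta>_def)
        ultimately show "\<alpha>\<^sub>0 + lam + (v - u) / 2 - A2 / 2 \<le> - \<delta>" by linarith
      qed (use D in simp)
      finally show ?thesis .
    qed
  qed auto
  finally show ?thesis unfolding La C_def .
qed

text \<open>
  On the \<open>k\<close>-th block \<open>t \<ge> k * r\<close>, so that the excess order is at least \<open>lam * (k * r) powr \<gamma>\<close>. At the critical level,
  where \<open>mesh i0 \<le> 1 / n\<close>, this gives a factor \<open>2 powr (- lam * k powr \<gamma>)\<close>. On coarser levels the power of the mesh
  changes by a factor of at most \<open>2 powr lam\<close> per level, because \<open>k * r \<le> 1\<close> for nonempty blocks.
\<close>

lemma mesh_powr_block_le:
  fixes t r \<gamma> lam n \<alpha>\<^sub>0 :: real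
  assumes t: "t \<in> {0..1}" and k: "cell i t div nat \<lceil>r / mesh i\<rceil> = k" and r: "0 < r" and g: "0 < \<gamma>" and lam: "0 < lam"
    and n: "1 \<le> n" "n * mesh i0 \<le> r" "r \<le> 1" "r powr \<gamma> * ln n = ln 2"
  shows "mesh i powr (\<alpha>\<^sub>0 + lam * t powr \<gamma> - 1)
    \<le> mesh i powr (\<alpha>\<^sub>0 - 1) * ((if i0 \<le> i then 1 else 2 powr (lam * real (level_gap i0 i))) * exp (- lam * ln 2 * real k powr \<gamma>))"
proof -
  let ?N = "nat \<lceil>r / mesh i\<rceil>"
  have "r / mesh i \<le> real ?N" by linarith
  then have rN: "r \<le> real ?N * mesh i" by (simp add: field_simps)
  have "real k * r \<le> real k * (real ?N * mesh i)" using rN by (intro mult_left_mono) auto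
  also have "\<dots> = real (k * ?N) * mesh i" by simp
  also have "\<dots> \<le> real (cell i t) * mesh i"
    using k div_times_less_eq_dividend[of "cell i t" ?N] by (intro mult_right_mono of_nat_mono) auto
  also have "\<dots> \<le> t" using cell_bounds(1)[of t i] t by simp
  finally have kr: "real k * r \<le> t" .
  define x where "x = lam * (real k * r) powr \<gamma>"
  have "(real k * r) powr \<gamma> \<le> t powr \<gamma>" using kr r g by (intro powr_mono2) auto
  also have "t powr \<gamma> \<le> 1" using t g by (simp add: powr_le1)
  finally have x: "0 \<le> x" "x \<le> lam" using lam by (auto simp: x_def mult_le_cancel_left1)
  have xt: "x \<le> lam * t powr \<gamma>" unfolding x_def using kr r g lam by (intro mult_left_mono powr_mono2) auto
  have "mesh i0 \<le> r / n" using n by (simp add: field_simps)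
  also have "\<dots> \<le> 1 / n" using n by (intro divide_right_mono) auto
  finally have m0: "mesh i0 \<le> 1 / n" .
  \<comment> \<open>Here the choice of \<open>r\<close> enters: \<open>n powr (- lam * (k * r) powr \<gamma>) = 2 powr (- lam * k powr \<gamma>)\<close>.\<close>
  have "mesh i0 powr x \<le> (1 / n) powr x" using m0 x by (intro powr_mono2) auto
  also have "\<dots> = exp (- (x * ln n))" using n by (simp add: powr_def ln_div)
  also have "x * ln n = lam * real k powr \<gamma> * (r powr \<gamma> * ln n)" using r by (simp add: x_def powr_mult)
  also have "\<dots> = lam * ln 2 * real k powr \<gamma>" unfolding n(4) by simp
  finally have e: "mesh i0 powr x \<le> exp (- lam * ln 2 * real k powr \<gamma>)" by simp
  have "mesh i powr (\<alpha>\<^sub>0 + lam * t powr \<gamma> - 1) = mesh i powr (\<alpha>\<^sub>0 - 1) * mesh i powr (lam * t powr \<gamma>)"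
    by (simp add: powr_add[symmetric] algebra_simps)
  also have "\<dots> \<le> mesh i powr (\<alpha>\<^sub>0 - 1) * mesh i powr x"
    using xt mesh_le_1 by (intro mult_left_mono powr_mono') auto
  also have "mesh i powr x = mesh i0 powr x * 2 powr ((real i0 - real i) * x)"
    unfolding mesh_shift[of i i0] by (simp add: powr_mult powr_powr)
  also have "mesh i powr (\<alpha>\<^sub>0 - 1) * (mesh i0 powr x * 2 powr ((real i0 - real i) * x))
     \<le> mesh i powr (\<alpha>\<^sub>0 - 1) * (exp (- lam * ln 2 * real k powr \<gamma>) * (if i0 \<le> i then 1 else 2 powr (lam * real (level_gap i0 i))))"
  proof (intro mult_left_mono mult_mono e)
    show "2 powr ((real i0 - real i) * x) \<le> (if i0 \<le> i then 1 else 2 powr (lam * real (level_gap i0 i)))"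
    proof (cases "i0 \<le> i")
      case True
      then have "(real i0 - real i) * x \<le> 0" using x by (intro mult_nonpos_nonneg) auto
      then have "2 powr ((real i0 - real i) * x) \<le> 2 powr 0" by (intro powr_mono) auto
      then show ?thesis using True by simp
    next
      case False
      then have "(real i0 - real i) * x \<le> (real i0 - real i) * lam" using x by (intro mult_left_mono) auto
      then have "2 powr ((real i0 - real i) * x) \<le> 2 powr (lam * real (level_gap i0 i))"
        using False by (intro powr_mono) (auto simp: level_gap_def of_nat_diff mult.commute)
      then show ?thesis using False by simp
    qed
  qed auto
  finally show ?thesis by (simp only: mult.commute)
qed

text \<open>
  The radii of the blocks are bounded by a product of the claimed rate \<open>T\<close> and of summable sequences in the three
  parameters of a block.
\<close>

lemma entropy_number_upper_bound:
  fixes p q :: ennreal and lam \<gamma> \<alpha>\<^sub>0 :: real and \<alpha> :: "real \<Rightarrow> real"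
  assumes p: "1 \<le> p" and q: "1 \<le> q" and lam: "lam > 0" and g: "\<gamma> > 0" and a0: "\<alpha>\<^sub>0 > max (recip p - recip q) 0"
    and \<alpha>: "\<And>t. t \<in> {0..1} \<Longrightarrow> \<alpha> t = \<alpha>\<^sub>0 + lam * t powr \<gamma>"
  shows "\<exists>C>0. \<forall>n::nat. n \<ge> 2 \<longrightarrow>
    entropy_number (lebesgue_on {0..1}) p (lebesgue_on {0..1}) q (RL_op \<alpha>) n
      \<le> ennreal (C * real n powr (- \<alpha>\<^sub>0) / (ln (real n)) powr ((\<alpha>\<^sub>0 + recip q - recip p) / \<gamma>))"
proof -
  define u where "u = recip p"
  define v where "v = recip q"
  have uv: "0 \<le> u" "u \<le> 1" "0 \<le> v" "v \<le> 1" using recip_bounds(1,2) p q by (auto simp: u_def v_def)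
  have a0': "0 < \<alpha>\<^sub>0" "max 0 (u - v) < \<alpha>\<^sub>0" using a0 by (auto simp: u_def v_def)
  define \<kappa> where "\<kappa> = \<alpha>\<^sub>0 + v - u"
  have kap: "0 < \<kappa>" using a0' by (simp add: \<kappa>_def)
  obtain A1 Cn where A1: "max 0 (u - v) < A1" "A1 < \<alpha>\<^sub>0" and Cn: "0 < Cn"
    and net1: "\<And>N \<nu>. 1 \<le> N \<Longrightarrow> 0 < \<nu> \<Longrightarrow> net_exists u v N \<nu> (Cn * real N powr (v - u) * (N / \<nu>) powr A1)"
    and net2: "\<And>N \<nu>. 1 \<le> N \<Longrightarrow> 0 < \<nu> \<Longrightarrow> net_exists u v N \<nu> (Cn * real N powr (v - u) * (N / \<nu>) powr (2 * (\<alpha>\<^sub>0 + lam) + 3))"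
    using net_exponents[OF uv a0'(2) lam] by blast
  define A2 where "A2 = 2 * (\<alpha>\<^sub>0 + lam) + 3"
  define \<delta> where "\<delta> = min (\<alpha>\<^sub>0 - A1) 1"
  have del: "0 < \<delta>" using A1 by (simp add: \<delta>_def)
  have A12: "0 < A1" "A1 \<le> A2" "0 < A2" using A1 a0' lam by (auto simp: A2_def)
  define B where "B = nat \<lceil>\<alpha>\<^sub>0 + lam + 1\<rceil>"
  have B: "\<alpha>\<^sub>0 + lam + 1 \<le> real B" "1 \<le> B" using a0' lam by (auto simp: B_def le_nat_iff)
  have a: "\<alpha>\<^sub>0 \<le> \<alpha> t" "\<alpha> t \<le> \<alpha>\<^sub>0 + lam" if "t \<in> {0..1}" for t
    using that \<alpha>[OF that] lam g by (auto simp: powr_le1)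
  have aB: "\<bar>\<alpha> t - 1\<bar> \<le> real B" if "t \<in> {0..1}" for t using a[OF that] B a0' lam by linarith
  obtain L where L: "0 < L" "\<And>x. x \<in> {\<alpha>\<^sub>0..\<alpha>\<^sub>0 + lam} \<Longrightarrow> L \<le> Gamma x"
    using Gamma_bounds_on_interval[OF a0'(1)] by metis
  define U where "U = 1 / L"
  have U: "1 / Gamma (\<alpha> t) \<le> U" if "t \<in> {0..1}" for t
    unfolding U_def using L(1) L(2)[of "\<alpha> t"] a[OF that] by (intro divide_left_mono) auto
  have U0: "0 < U" using L by (simp add: U_def)
  have alpha_meas: "\<alpha> \<in> borel_measurable (lebesgue_on {0..1})"
  proof -
    have "(\<lambda>t. \<alpha>\<^sub>0 + lam * t powr \<gamma>) \<in> borel_measurable (lebesgue_on {0..1})" by (rule borel_imp_lebesgue_on) measurable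
    then show ?thesis using \<alpha> by (subst measurable_cong[of _ _ "\<lambda>t. \<alpha>\<^sub>0 + lam * t powr \<gamma>"]) auto
  qed
  \<comment> \<open>Decay of the radii in the distance to the critical level, in the Taylor degree and in the block
    number. The powers with exponent \<open>2 * A2\<close> come from the quadratic decrease of the bit budgets.\<close>
  define x where "x d = (real d + 1) powr (2 * A2) * 2 powr (- \<delta> * real d)" for d :: nat
  define z where "z m = (real m + 1) powr (2 * A2) * ((real m + 1) ^ B * (1 / 2) ^ m)" for m :: nat
  define y where "y k = (real k + 1) powr (2 * A2) * exp (- lam * ln 2 * real k powr \<gamma>)" for k :: nat
  have xyz0: "0 < x d" "0 < z d" "0 < y d" for d by (simp_all add: x_def y_def z_def)
  have sx: "summable x"
  proof -
    have "summable (\<lambda>k::nat. (real k + 1) powr (2 * A2) * exp (- (\<delta> * ln 2) * real k powr 1))"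
      using del A12 by (intro summable_poly_stretched_exp) auto
    moreover have "(real k + 1) powr (2 * A2) * exp (- (\<delta> * ln 2) * real k powr 1) = x k" for k
      by (simp add: x_def powr_def[of 2] mult_ac)
    ultimately show ?thesis by simp
  qed
  have sy: "summable y" unfolding y_def[abs_def] using summable_poly_stretched_exp[of "2 * A2" "lam * ln 2" \<gamma>] lam g A12 by simp
  have sz: "summable z"
  proof -
    have "summable (\<lambda>k::nat. (real k + 1) powr (2 * A2 + real B) * exp (- ln 2 * real k powr 1))"
      using A12 by (intro summable_poly_stretched_exp) auto
    moreover have "(real k + 1) powr (2 * A2 + real B) * exp (- ln 2 * real k powr 1) = z k" for k
    proof -
      have "exp (- ln 2 * real k powr 1) = (2::real) powr (- real k)" by (simp add: powr_def mult.commute)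
      also have "\<dots> = (1 / 2) ^ k" by (simp add: powr_minus powr_realpow power_one_over inverse_eq_divide)
      finally show ?thesis by (simp add: z_def powr_add powr_realpow mult.assoc)
    qed
    ultimately show ?thesis by simp
  qed
  define c6 where "c6 = (ln 2) powr (1 / \<gamma>) * \<gamma> powr (1 / \<gamma>)"
  have c6: "0 < c6" using g by (simp add: c6_def)
  define G where "G = 2 * U * 3 ^ B * Cn * 32 powr A2 * (3 + 1 / sqrt c6) powr (A2 + 1)"
  have c3: "0 < 3 + 1 / sqrt c6" using c6 by (intro add_pos_pos) auto
  have G: "0 < G" using U0 Cn c3 by (simp add: G_def)
  define Sum where "Sum = 2 * suminf x * suminf z * suminf y"
  have Sum: "0 < Sum" unfolding Sum_def using suminf_pos[OF sx] suminf_pos[OF sy] suminf_pos[OF sz] xyz0 by simp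
  define C where "C = G * Sum * ln 2 powr (\<kappa> / \<gamma>)"
  show ?thesis
  proof (intro exI[of _ C] conjI allI impI)
    show "0 < C" using G Sum by (simp add: C_def)
    fix n :: nat assume n: "n \<ge> 2"
    define r where "r = (ln 2 / ln (real n)) powr (1 / \<gamma>)"
    note r = critical_length_bounds[OF n g, folded r_def]
    have c6r: "c6 \<le> real n * r"
    proof -
      have "ln (real n) \<le> real n powr \<gamma> / \<gamma>" using n g by (intro ln_powr_bound) auto
      then have "ln (real n) powr (1 / \<gamma>) \<le> (real n powr \<gamma> / \<gamma>) powr (1 / \<gamma>)" using g n by (intro powr_mono2) auto
      also have "\<dots> = real n / \<gamma> powr (1 / \<gamma>)" using g by (simp add: powr_divide powr_powr)
      finally have "ln (real n) powr (1 / \<gamma>) * \<gamma> powr (1 / \<gamma>) \<le> real n" using g by (simp add: field_simps)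
      then have "ln 2 powr (1 / \<gamma>) * (ln (real n) powr (1 / \<gamma>) * \<gamma> powr (1 / \<gamma>)) \<le> ln 2 powr (1 / \<gamma>) * real n"
        by (intro mult_left_mono) auto
      then show ?thesis using n by (simp add: c6_def r_def powr_divide field_simps)
    qed
    \<comment> \<open>At the critical level \<open>i0\<close> the interval \<open>[0, r]\<close> consists of about \<open>n\<close> cells.\<close>
    obtain i0 where i0: "real n * mesh i0 \<le> r" "r \<le> 2 * real n * mesh i0" using exists_level[OF n r(1,2)] by blast
    define N where "N i = nat \<lceil>r / mesh i\<rceil>" for i
    have N: "1 \<le> N i" for i
    proof -
      have "0 < r / mesh i" using r(1) by simp
      then show ?thesis unfolding N_def by (simp add: Suc_le_eq)
    qed
    define D where "D = level_gap i0"
    \<comment> \<open>Small exponents \<open>A1 < \<alpha>\<^sub>0\<close> make the sum over the fine levels converge, the large one takes care of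
      the coarse levels.\<close>
    define A where "A i = (if i0 \<le> i then A1 else A2)" for i
    define \<Lambda> where "\<Lambda> i = (if i0 \<le> i then 1 else 2 powr (lam * real (D i)))" for i
    have A: "0 < A i" "A i \<le> A2" for i using A12 by (auto simp: A_def)
    define T where "T = real n powr (- \<alpha>\<^sub>0) * r powr \<kappa>"
    have T: "0 < T" using n r(1) by (simp add: T_def)
    define s where "s j = 1 / (real j + 1)\<^sup>2" for j :: nat
    \<comment> \<open>The three sums over \<open>s\<close> are at most 4, 2 and 2, so that all blocks together get at most
      \<open>n / 2 \<le> n - 1\<close> bits.\<close>
    define \<nu> where "\<nu> = (\<lambda>(i, m, k). real n / 32 * (s (D i) * s m * s k))"
    have s0: "0 < s j" "s j \<le> 1" for j
    proof -
      show "0 < s j" unfolding s_def by (intro divide_pos_pos zero_less_power) auto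
      show "s j \<le> 1" unfolding s_def by (simp add: divide_le_eq_1 one_le_power)
    qed
    have nu0: "0 < \<nu> (i, m, k)" for i m k unfolding \<nu>_def using n s0 by simp
    define K where "K = (\<lambda>(i, m, k). U * 3 ^ B * (mesh i powr (\<alpha>\<^sub>0 - 1) * (\<Lambda> i * exp (- lam * ln 2 * real k powr \<gamma>))) * (real m + 1) ^ B * (1 / 2) ^ m)"
    define e where "e = (\<lambda>(i, m, k). Cn * real (N i) powr (v - u) * (real (N i) / \<nu> (i, m, k)) powr A i)"
    define b where "b = (\<lambda>(i, m, k). (G * T * x (D i)) * z m * y k)"
    have La: "0 < \<Lambda> i" for i by (simp add: \<Lambda>_def)
    have Kw: "\<bar>weight \<alpha> i m t\<bar> \<le> K (i, m, k)" if t: "t \<in> {0..1}" and k: "cell i t div N i = k" for i m k t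
    proof -
      have t': "0 \<le> t" "0 < \<alpha> t" using t a[OF t] a0' by auto
      have mle: "mesh i powr (\<alpha> t - 1) \<le> mesh i powr (\<alpha>\<^sub>0 - 1) * (\<Lambda> i * exp (- lam * ln 2 * real k powr \<gamma>))"
        unfolding \<alpha>[OF t] \<Lambda>_def D_def
        using n k by (intro mesh_powr_block_le[OF t _ r(1) g lam _ i0(1) r(2,3)]) (auto simp: N_def)
      have "\<bar>weight \<alpha> i m t\<bar> \<le> U * 3 ^ B * mesh i powr (\<alpha> t - 1) * (real m + 1) ^ B * (1 / 2) ^ m"
        by (rule abs_weight_le[where \<alpha> = \<alpha> and t = t, OF t' aB[OF t] B(2) U[OF t]])
      also have "\<dots> \<le> K (i, m, k)" unfolding K_def prod.case
        using mle U0 by (intro mult_right_mono mult_left_mono) auto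
      finally show ?thesis .
    qed
    have bb: "K (i, m, k) * mesh i powr v * (2 * mesh i powr (1 - u) * e (i, m, k)) \<le> b (i, m, k)" for i m k
    proof -
      let ?P = "((real (D i) + 1) * (real m + 1) * (real k + 1)) powr (2 * A2)"
      have nu: "real (N i) / \<nu> (i, m, k) = real (N i) / real n * (32 * ((real (D i) + 1) * (real m + 1) * (real k + 1))\<^sup>2)"
        by (simp add: \<nu>_def s_def power_mult_distrib)
      have ge1: "1 \<le> (real (D i) + 1) * (real m + 1) * (real k + 1)"
      proof -
        have "1 * 1 * 1 \<le> (real (D i) + 1) * (real m + 1) * (real k + 1)" by (intro mult_mono) auto
        then show ?thesis by simp
      qed
      have NA: "(real (N i) / \<nu> (i, m, k)) powr A i \<le> (real (N i) / real n) powr A i * (32 powr A2 * ?P)"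
      proof -
        let ?w = "(real (D i) + 1) * (real m + 1) * (real k + 1)"
        have "(32 * ?w\<^sup>2) powr A i \<le> (32 * ?w\<^sup>2) powr A2"
        proof (rule powr_mono[OF A(2)])
          have "1 \<le> ?w\<^sup>2" using ge1 by (rule one_le_power)
          then show "1 \<le> 32 * ?w\<^sup>2" by linarith
        qed
        also have "\<dots> = 32 powr A2 * (?w powr 2) powr A2"
        proof -
          have "?w powr 2 = ?w\<^sup>2" using ge1 by (intro powr_numeral) linarith
          then show ?thesis by (simp only: powr_mult[of 32 "?w\<^sup>2"])
        qed
        also have "\<dots> = 32 powr A2 * ?P" by (simp only: powr_powr)
        finally show ?thesis unfolding nu by (simp only: powr_mult[of "real (N i) / real n"]) (intro mult_left_mono, auto)
      qed
      have lev: "mesh i powr \<kappa> * \<Lambda> i * (real (N i) powr (v - u) * (real (N i) / real n) powr A i)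
          \<le> (3 + 1 / sqrt c6) powr (A2 + 1) * T * 2 powr (- \<delta> * real (D i))"
        unfolding \<Lambda>_def N_def A_def D_def T_def \<delta>_def \<kappa>_def
        using n uv kap A1 A12 lam unfolding \<kappa>_def
        by (intro level_estimate[OF _ r(1) i0 c6 c6r lam]) (auto simp: A2_def abs_le_iff)
      have msh: "mesh i powr (\<alpha>\<^sub>0 - 1) * mesh i powr v * mesh i powr (1 - u) = mesh i powr \<kappa>"
        by (simp add: powr_add[symmetric] \<kappa>_def algebra_simps)
      let ?E = "exp (- lam * ln 2 * real k powr \<gamma>)" and ?M = "(real m + 1) ^ B * (1 / 2) ^ m"
      have "K (i, m, k) * mesh i powr v * (2 * mesh i powr (1 - u) * e (i, m, k))
        = 2 * U * 3 ^ B * Cn * ?E * ?M * ((mesh i powr (\<alpha>\<^sub>0 - 1) * mesh i powr v * mesh i powr (1 - u)) * \<Lambda> i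
            * real (N i) powr (v - u)) * (real (N i) / \<nu> (i, m, k)) powr A i"
        unfolding K_def e_def prod.case by (simp only: mult_ac)
      also have "\<dots> \<le> 2 * U * 3 ^ B * Cn * ?E * ?M * ((mesh i powr (\<alpha>\<^sub>0 - 1) * mesh i powr v * mesh i powr (1 - u)) * \<Lambda> i
            * real (N i) powr (v - u)) * ((real (N i) / real n) powr A i * (32 powr A2 * ?P))"
        using NA U0 Cn La[of i] by (intro mult_left_mono mult_nonneg_nonneg) auto
      also have "\<dots> = 2 * U * 3 ^ B * Cn * ?E * ?M * (32 powr A2 * ?P) *
          (mesh i powr \<kappa> * \<Lambda> i * (real (N i) powr (v - u) * (real (N i) / real n) powr A i))"
        unfolding msh by (simp only: mult_ac)
      also have "\<dots> \<le> 2 * U * 3 ^ B * Cn * ?E * ?M * (32 powr A2 * ?P) *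
          ((3 + 1 / sqrt c6) powr (A2 + 1) * T * 2 powr (- \<delta> * real (D i)))"
        using lev U0 Cn by (intro mult_left_mono mult_nonneg_nonneg) auto
      also have "\<dots> = b (i, m, k)"
        unfolding b_def G_def x_def y_def z_def prod.case powr_mult by (simp only: mult_ac)
      finally show ?thesis .
    qed
    define \<epsilon> where "\<epsilon> = G * T * Sum"
    have sum_b: "(\<integral>\<^sup>+\<tau>. ennreal (b \<tau>) \<partial>count_space UNIV) \<le> ennreal \<epsilon>"
    proof -
      have "(\<integral>\<^sup>+\<tau>. ennreal (b \<tau>) \<partial>count_space UNIV)
          = (\<Sum>i. ennreal (G * T * x (D i))) * (\<Sum>m. ennreal (z m)) * (\<Sum>k. ennreal (y k))"
        unfolding b_def using G T xyz0 by (intro nn_integral_triple_product) (auto intro!: mult_nonneg_nonneg less_imp_le)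
      also have "(\<Sum>i. ennreal (G * T * x (D i))) = ennreal (G * T) * (\<Sum>i. ennreal (x (D i)))"
        using G T xyz0 by (simp add: ennreal_mult less_imp_le ennreal_suminf_cmult)
      also have "ennreal (G * T) * (\<Sum>i. ennreal (x (D i))) * (\<Sum>m. ennreal (z m)) * (\<Sum>k. ennreal (y k))
          \<le> ennreal (G * T) * (2 * (\<Sum>d. ennreal (x d))) * (\<Sum>m. ennreal (z m)) * (\<Sum>k. ennreal (y k))"
        unfolding D_def
        by (rule mult_right_mono[OF mult_right_mono[OF mult_left_mono[OF suminf_level_gap_le[of "\<lambda>d. ennreal (x d)"]]]]) simp_all
      also have "\<dots> = ennreal (G * T) * (ennreal 2 * ennreal (suminf x)) * ennreal (suminf z) * ennreal (suminf y)"
        by (simp only: suminf_ennreal_finite[OF sx less_imp_le[OF xyz0(1)]] suminf_ennreal_finite[OF sz less_imp_le[OF xyz0(2)]]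
            suminf_ennreal_finite[OF sy less_imp_le[OF xyz0(3)]] ennreal_numeral)
      also have "\<dots> = ennreal (G * T * (2 * suminf x) * suminf z * suminf y)"
      proof -
        have "0 \<le> G * T" "0 \<le> suminf x" "0 \<le> suminf z" "0 \<le> suminf y"
          using G T suminf_nonneg[OF sx less_imp_le[OF xyz0(1)]] suminf_nonneg[OF sz less_imp_le[OF xyz0(2)]]
            suminf_nonneg[OF sy less_imp_le[OF xyz0(3)]] by simp_all
        then show ?thesis by (simp only: ennreal_mult mult_nonneg_nonneg zero_le_numeral)
      qed
      also have "G * T * (2 * suminf x) * suminf z * suminf y = \<epsilon>" by (simp add: \<epsilon>_def Sum_def)
      finally show ?thesis .
    qed
    have nu_lt1: "\<nu> (i, m, k) < 1" if "i \<ge> i0 + n \<or> m \<ge> i0 + n \<or> k \<ge> i0 + n" for i m k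
    proof -
      have sn: "s j \<le> 1 / real n" if "j \<ge> n" for j
      proof -
        have "real n * 1 \<le> (real j + 1) * (real j + 1)" using that by (intro mult_mono) auto
        then show ?thesis unfolding s_def power2_eq_square using n by (intro divide_left_mono) auto
      qed
      have "s (D i) * s m * s k \<le> 1 / real n"
      proof -
        from that consider "D i \<ge> n" | "m \<ge> n" | "k \<ge> n" by (auto simp: D_def level_gap_def)
        then show ?thesis
        proof cases
          case 1
          then have "s (D i) * s m * s k \<le> 1 / real n * 1 * 1" using sn s0 by (intro mult_mono) (auto intro: less_imp_le)
          then show ?thesis by simp
        next
          case 2
          then have "s (D i) * s m * s k \<le> 1 * (1 / real n) * 1" using sn s0 by (intro mult_mono) (auto intro: less_imp_le)
          then show ?thesis by simp
        next
          case 3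
          then have "s (D i) * s m * s k \<le> 1 * 1 * (1 / real n)" using sn s0 by (intro mult_mono) (auto intro: less_imp_le mult_le_one)
          then show ?thesis by simp
        qed
      qed
      then have "real n / 32 * (s (D i) * s m * s k) \<le> real n / 32 * (1 / real n)" by (intro mult_left_mono) auto
      also have "\<dots> < 1" using n by simp
      finally show ?thesis by (simp add: \<nu>_def)
    qed
    have nu_sum: "(\<Sum>\<tau>\<in>{..<i0 + n} \<times> {..<i0 + n} \<times> {..<i0 + n}. \<nu> \<tau>) \<le> real n - 1"
    proof -
      let ?I = "{..<i0 + n}"
      have "(\<Sum>\<tau>\<in>?I \<times> ?I \<times> ?I. \<nu> \<tau>) = (\<Sum>i\<in>?I. \<Sum>m\<in>?I. \<Sum>k\<in>?I. real n / 32 * (s (D i) * s m * s k))"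
        by (simp add: sum.cartesian_product \<nu>_def)
      also have "\<dots> = real n / 32 * ((\<Sum>i\<in>?I. s (D i)) * (\<Sum>m\<in>?I. s m) * (\<Sum>k\<in>?I. s k))"
        by (simp only: sum_distrib_left[symmetric] sum_distrib_right[symmetric])
      also have "\<dots> \<le> real n / 32 * (4 * 2 * 2)"
        using sum_level_gap_le[of i0 "i0 + n"] sum_inverse_squares_le[of "i0 + n"] s0
        by (intro mult_left_mono mult_mono) (auto simp: s_def D_def intro!: sum_nonneg mult_nonneg_nonneg)
      also have "\<dots> \<le> real n - 1" using n by simp
      finally show ?thesis .
    qed
    have eps: "0 < \<epsilon>" using G T Sum by (simp add: \<epsilon>_def)
    have "entropy_number (lebesgue_on {0..1}) p (lebesgue_on {0..1}) q (RL_op \<alpha>) n \<le> ennreal \<epsilon>"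
    proof (rule covering_from_nets[where N = N and K = K and e = e and b = b and \<nu> = \<nu> and n' = "i0 + n" and B = B,
          OF p q _ a0'(1) a(1) aB B(2) alpha_meas N _ Kw _ _ _ _ sum_b _ nu_lt1 nu_sum eps])
      show "1 \<le> n" using n by simp
      show "0 \<le> K \<tau>" for \<tau>
        unfolding K_def using U0 La by (cases \<tau>) (auto intro!: mult_nonneg_nonneg intro: less_imp_le)
      show "0 \<le> e \<tau>" for \<tau> unfolding e_def using Cn by (cases \<tau>) auto
      show "net_exists (recip p) (recip q) (N i) (\<nu> (i, m, k)) (e (i, m, k))" for i m k
        unfolding u_def[symmetric] v_def[symmetric] e_def prod.case A_def
        using net1[OF N nu0[of i m k], of i] net2[OF N nu0[of i m k], of i] by (simp add: A2_def)
      show "0 < b \<tau>" for \<tau> unfolding b_def using G T xyz0 by (cases \<tau>) simp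
      show "K (i, m, k) * mesh i powr recip q * (2 * mesh i powr (1 - recip p) * e (i, m, k)) \<le> b (i, m, k)" for i m k
        using bb[of i m k] by (simp add: u_def v_def)
      show "0 \<le> \<nu> \<tau>" for \<tau> using nu0 by (cases \<tau>) (auto intro: less_imp_le)
    qed assumption+
    also have "\<epsilon> = C * real n powr (- \<alpha>\<^sub>0) / ln (real n) powr (\<kappa> / \<gamma>)"
      unfolding \<epsilon>_def C_def T_def r(5) by (simp add: field_simps)
    finally show "entropy_number (lebesgue_on {0..1}) p (lebesgue_on {0..1}) q (RL_op \<alpha>) n
      \<le> ennreal (C * real n powr (- \<alpha>\<^sub>0) / (ln (real n)) powr ((\<alpha>\<^sub>0 + recip q - recip p) / \<gamma>))"
      by (simp add: \<kappa>_def u_def v_def)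
  qed
qed


section \<open>The two-sided estimate\<close>

theorem proposition8p1:
  fixes p q :: ennreal and lam \<gamma> \<alpha>\<^sub>0 :: real and \<alpha> :: "real \<Rightarrow> real"
  assumes "1 \<le> p" and "1 \<le> q"
    and "lam > 0" and "\<gamma> > 0"
    and "\<alpha>\<^sub>0 > max (recip p - recip q) 0"
    and "\<forall>t\<in>{0..1}. \<alpha> t = \<alpha>\<^sub>0 + lam * t powr \<gamma>"
  shows "\<exists>c>0. \<exists>C>0. \<forall>n::nat. n \<ge> 2 \<longrightarrow>
    ennreal (c * real n powr (- \<alpha>\<^sub>0) / (ln (real n)) powr ((\<alpha>\<^sub>0 + recip q - recip p) / \<gamma>))
      \<le> entropy_number (lebesgue_on {0..1}) p (lebesgue_on {0..1}) q (RL_op \<alpha>) n \<and>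
    entropy_number (lebesgue_on {0..1}) p (lebesgue_on {0..1}) q (RL_op \<alpha>) n
      \<le> ennreal (C * real n powr (- \<alpha>\<^sub>0) / (ln (real n)) powr ((\<alpha>\<^sub>0 + recip q - recip p) / \<gamma>))"
proof -
  have a0: "0 < \<alpha>\<^sub>0" using assms(5) by simp
  have \<alpha>: "\<alpha> t = \<alpha>\<^sub>0 + lam * t powr \<gamma>" if "t \<in> {0..1}" for t using assms(6) that by blast
  show ?thesis
    using entropy_number_lower_bound[OF assms(1-4) a0 \<alpha>] entropy_number_upper_bound[OF assms(1-5) \<alpha>] by blast
qed

end
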